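(* Let $(q,h,\beta,\gamma)$ and $(\tilde q,\tilde h,\tilde\beta,\tilde\gamma)$ be two sets of coefficients, with the same $H\in\mathbb{C}$ and the same $d\in(0,\pi)$, and let $B,B^\infty$ and $\tilde B,\tilde B^\infty$ be the corresponding boundary value problems (see context). Let $m\in\mathbb{N}_0\cup\{-1\}$, suppose that $q,\tilde q$ are $C^m$ near $\pi$ and that $q^{(j)}(\pi)=\tilde q^{(j)}(\pi)$ for $j=0,1,\dots,m$. Let $\Lambda_1,\Lambda_1^\infty\subset\mathbb{N}_0$ be finite sets with $\#\Lambda_1+\#\Lambda_1^\infty=\left[\frac{m+2}{2}\right]$, and suppose that $\lambda_n=\tilde\lambda_n$ for all $n\in\mathbb{N}_0\setminus\Lambda_1$ and $\lambda_n^\infty=\tilde\lambda_n^\infty$ for all $n\in\mathbb{N}_0\setminus\Lambda_1^\infty$. Then $h=\tilde h$, $\beta=\tilde\beta$, $\gamma=\tilde\gamma$ and $q=\tilde q$ a.e. on $[0,\pi]$.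
   Context: For coefficients $q\in L^1([0,\pi];\mathbb{C})$, $h,H,\gamma\in\mathbb{C}$, $\beta\in\mathbb{R}$ with $\beta>0$, and $d\in(0,\pi)$, consider the equation $-y''+q(x)y=\lambda y$ on $(0,\pi)$ with the boundary condition $y'(0)-hy(0)=0$ and the jump conditions $y(d+0)=\beta y(d-0)$, $y'(d+0)=\beta^{-1}y'(d-0)+\gamma y(d-0)$. Problem $B$ has in addition the condition $y'(\pi)+Hy(\pi)=0$; problem $B^\infty$ has instead the condition $y(\pi)=0$. Let $\varphi(x,\lambda)$ be the solution of the equation satisfying the jump conditions and $\varphi(0,\lambda)=1,\varphi'(0,\lambda)=h$. The eigenvalues of $B$ and $B^\infty$ are the zeros of the entire functions $\Delta(\lambda)=\varphi'(\pi,\lambda)+H\varphi(\pi,\lambda)$ and $\Delta^\infty(\lambda)=-\varphi(\pi,\lambda)$, respectively; the algebraic multiplicity of an eigenvalue is its order as a zero. $\sigma(B)=\{\lambda_n\}_{n\in\mathbb{N}_0}$ and $\sigma(B^\infty)=\{\lambda_n^\infty\}_{n\in\mathbb{N}_0}$ are the sequences of all eigenvalues, repeated according to algebraic multiplicity, ordered by nondecreasing modulus, with identical eigenvalues adjacent. Symbols with a tilde denote the corresponding objects for $(\tilde q,\tilde h,H,\tilde\beta,\tilde\gamma,d)$. "$C^m$ near $\pi$" means $C^m$ on $[\pi-\delta,\pi]$ for some $\delta>0$; by convention $C^{-1}$ means $L^1$ (no extra smoothness, and no condition on derivatives at $\pi$). $[\,\cdot\,]$ denotes the integer part. *)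

theory Defs
  imports "HOL-Complex_Analysis.Complex_Analysis"
begin

(* f is locally absolutely continuous on the interval I with a.e. derivative g, expressed
   as "f is an indefinite integral of the locally Lebesgue integrable function g". *)
definition ac_deriv_on :: "real set \<Rightarrow> (real \<Rightarrow> complex) \<Rightarrow> (real \<Rightarrow> complex) \<Rightarrow> bool" where
  "ac_deriv_on I f g \<longleftrightarrow>
     (\<forall>a\<in>I. \<forall>b\<in>I. a \<le> b \<longrightarrow>
        g absolutely_integrable_on {a..b} \<and> f b - f a = integral {a..b} g)"

(* y solves - y'' + q y = lam y on the interval I: y has derivative dy (one-sided at an
   endpoint belonging to I), dy is locally absolutely continuous, the equation holds a.e. *)
definition sl_solution ::
  "(real \<Rightarrow> complex) \<Rightarrow> complex \<Rightarrow> real set \<Rightarrow> (real \<Rightarrow> complex) \<Rightarrow> (real \<Rightarrow> complex) \<Rightarrow> bool" where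
  "sl_solution q lam I y dy \<longleftrightarrow>
     (\<forall>x\<in>I. (y has_vector_derivative dy x) (at x within I)) \<and>
     (\<exists>ddy. ac_deriv_on I dy ddy \<and>
        (AE x in lebesgue. x \<in> I \<longrightarrow> - ddy x + q x * y x = lam * y x))"

definition jump_cond ::
  "real \<Rightarrow> complex \<Rightarrow> real \<Rightarrow> (real \<Rightarrow> complex) \<Rightarrow> (real \<Rightarrow> complex) \<Rightarrow> bool" where
  "jump_cond \<beta> \<gamma> d y dy \<longleftrightarrow>
     (\<exists>u v. (y \<longlongrightarrow> u) (at_left d) \<and> (dy \<longlongrightarrow> v) (at_left d) \<and>
        (y \<longlongrightarrow> of_real \<beta> * u) (at_right d) \<and>
        (dy \<longlongrightarrow> of_real (inverse \<beta>) * v + \<gamma> * u) (at_right d))"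

(* (y, dy) is the pair of phi(., lam) and its derivative. The values at the point d itself
   (and outside [0, pi]) are left open; all others are determined. *)
definition is_phi ::
  "(real \<Rightarrow> complex) \<Rightarrow> complex \<Rightarrow> real \<Rightarrow> complex \<Rightarrow> real \<Rightarrow> complex \<Rightarrow>
     (real \<Rightarrow> complex) \<Rightarrow> (real \<Rightarrow> complex) \<Rightarrow> bool" where
  "is_phi q h \<beta> \<gamma> d lam y dy \<longleftrightarrow>
     sl_solution q lam {0..<d} y dy \<and> sl_solution q lam {d<..pi} y dy \<and>
     jump_cond \<beta> \<gamma> d y dy \<and> y 0 = 1 \<and> dy 0 = h"

definition phi_pair ::
  "(real \<Rightarrow> complex) \<Rightarrow> complex \<Rightarrow> real \<Rightarrow> complex \<Rightarrow> real \<Rightarrow> complex \<Rightarrow>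
     (real \<Rightarrow> complex) \<times> (real \<Rightarrow> complex)" where
  "phi_pair q h \<beta> \<gamma> d lam = (SOME (y, dy). is_phi q h \<beta> \<gamma> d lam y dy)"

definition phi ::
  "(real \<Rightarrow> complex) \<Rightarrow> complex \<Rightarrow> real \<Rightarrow> complex \<Rightarrow> real \<Rightarrow> real \<Rightarrow> complex \<Rightarrow> complex" where
  "phi q h \<beta> \<gamma> d x lam = fst (phi_pair q h \<beta> \<gamma> d lam) x"

definition dphi ::
  "(real \<Rightarrow> complex) \<Rightarrow> complex \<Rightarrow> real \<Rightarrow> complex \<Rightarrow> real \<Rightarrow> real \<Rightarrow> complex \<Rightarrow> complex" where
  "dphi q h \<beta> \<gamma> d x lam = snd (phi_pair q h \<beta> \<gamma> d lam) x"

definition Delta ::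
  "(real \<Rightarrow> complex) \<Rightarrow> complex \<Rightarrow> complex \<Rightarrow> real \<Rightarrow> complex \<Rightarrow> real \<Rightarrow> complex \<Rightarrow> complex" where
  "Delta q h H \<beta> \<gamma> d lam = dphi q h \<beta> \<gamma> d pi lam + H * phi q h \<beta> \<gamma> d pi lam"

definition Delta_inf ::
  "(real \<Rightarrow> complex) \<Rightarrow> complex \<Rightarrow> real \<Rightarrow> complex \<Rightarrow> real \<Rightarrow> complex \<Rightarrow> complex" where
  "Delta_inf q h \<beta> \<gamma> d lam = - phi q h \<beta> \<gamma> d pi lam"

(* Such an enumeration need not be unique: distinct zeros may have equal modulus. *)
definition zero_sequence :: "(complex \<Rightarrow> complex) \<Rightarrow> (nat \<Rightarrow> complex) \<Rightarrow> bool" where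
  "zero_sequence F l \<longleftrightarrow>
     range l = {z. F z = 0} \<and>
     (\<forall>z. F z = 0 \<longrightarrow> finite {n. l n = z} \<and> int (card {n. l n = z}) = zorder F z) \<and>
     (\<forall>i j. i \<le> j \<longrightarrow> norm (l i) \<le> norm (l j)) \<and>
     (\<forall>i j k. i \<le> j \<longrightarrow> j \<le> k \<longrightarrow> l i = l k \<longrightarrow> l j = l i)"

primrec nderiv_within :: "real set \<Rightarrow> nat \<Rightarrow> (real \<Rightarrow> complex) \<Rightarrow> real \<Rightarrow> complex" where
  "nderiv_within S 0 f = f"
| "nderiv_within S (Suc j) f = (\<lambda>x. vector_derivative (nderiv_within S j f) (at x within S))"

definition C_on :: "nat \<Rightarrow> (real \<Rightarrow> complex) \<Rightarrow> real set \<Rightarrow> bool" where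
  "C_on m f S \<longleftrightarrow>
     (\<forall>j<m. \<forall>x\<in>S. nderiv_within S j f differentiable (at x within S)) \<and>
     continuous_on S (nderiv_within S m f)"

(* No condition for m = -1. *)
definition C_near_pi :: "int \<Rightarrow> (real \<Rightarrow> complex) \<Rightarrow> bool" where
  "C_near_pi m f \<longleftrightarrow>
     (m \<ge> 0 \<longrightarrow> (\<exists>\<delta>. 0 < \<delta> \<and> \<delta> \<le> pi \<and> C_on (nat m) f {pi - \<delta>..pi}))"

(* The j-th derivative at pi from the left; it depends only on f near pi and agrees with
   nderiv_within {pi - \<delta>..pi} j f pi for every \<delta> > 0. *)
definition nderiv_at_pi :: "nat \<Rightarrow> (real \<Rightarrow> complex) \<Rightarrow> complex" where
  "nderiv_at_pi j f = nderiv_within {0..pi} j f pi"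

end

theory Submission
  imports Defs
begin

text \<open>
  Both characteristic functions are entire of order at most 1/2. Entire functions of order below 1
  with the same zeros are proportional, so \<open>\<Delta>\<close> and its tilde version agree up to a constant and the
  finitely many linear factors that belong to the exceptional eigenvalues, and likewise for \<open>\<Delta>\<^sup>\<infinity>\<close>.
  Hence the quotient of the functions \<open>\<phi>'(\<pi>)/\<phi>(\<pi>) + H\<close> of the two problems is a constant times a
  rational function \<open>X/V\<close>, with \<open>X\<close> and \<open>V\<close> monic of the same degree \<open>[(m + 2)/2]\<close>. For
  \<open>\<lambda> = - r\<^sup>2\<close>, \<open>r \<rightarrow> \<infinity>\<close>, the Wronskian of \<open>\<phi>\<close> and its tilde version at \<open>\<pi>\<close> is an integral of the
  difference of the potentials against \<open>exp (- 2 r (\<pi> - t))\<close>, and the matching derivatives at \<open>\<pi>\<close>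
  make it so small that the constant is 1 and \<open>X = V\<close>. Thus \<open>\<phi>'(\<pi>)/\<phi>(\<pi>)\<close> is the same for both
  problems. The rest is Bennewitz's argument: let \<open>s\<close> be the solution started at \<open>x\<close> with Cauchy data
  \<open>(0, 1)\<close>. The Wronskian at \<open>\<pi>\<close> of \<open>s\<close> and its tilde version is an entire function of order 1/2 that
  tends to 0 on two opposite rays, so it vanishes by Phragmen--Lindelof. This makes the solutions
  with Cauchy data \<open>(1, 0)\<close> and \<open>(0, 1)\<close> at \<open>\<pi>\<close> of the two problems proportional at every \<open>x\<close>, with a
  constant factor of square 1 on either side of \<open>d\<close>, and all coefficients can be read off.
\<close>

section \<open>Absolutely continuous functions\<close>

text \<open>The coefficients are complex: eigenvalues may be nonreal and multiple, and neither
  orthogonality nor positivity is at hand, so everything rests on entire functions and Wronskians.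
  As the potentials are merely integrable, equations are read as indefinite integrals, and
  Lagrange's identity is the basic tool. The number \<open>p = [(m + 2)/2]\<close> comes from
  counting powers: \<open>X - V\<close> times a logarithmic derivative of size \<open>r\<close>
  equals \<open>X\<close>, of size \<open>r^(2 p)\<close>, times the Wronskian divided by the
  product of the two end values, which is \<open>o(r^(- (m + 1)))\<close>. So
  \<open>X - V = o(r^(2 p - m - 2))\<close>, and \<open>2 p \<le> m + 2\<close> makes this
  polynomial vanish. The jump does not destroy the dominance of the growing exponential: it
  multiplies it by \<open>(\<beta> + 1/\<beta>)/2\<close> up to \<open>O(1/k)\<close>, and this is
  not 0 because \<open>\<beta> > 0\<close>. The two rays are the imaginary half axes of
  \<open>\<lambda> = - k^2\<close>: there \<open>k\<close> has argument
  \<open>\<plusminus>pi/4\<close> and stays in the sector \<open>norm k \<le> 2 * Re k\<close>,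
  where the exponential asymptotics hold, while growth order 1/2 is below the critical order 1 of a
  half plane.\<close>

lemma ac_deriv_onD:
  assumes "ac_deriv_on {a..b} F f" "a \<le> s" "s \<le> t" "t \<le> b"
  shows "f absolutely_integrable_on {s..t}" "(f has_integral (F t - F s)) {s..t}"
    "f integrable_on {s..t}" "integral {s..t} f = F t - F s"
proof -
  have *: "f absolutely_integrable_on {s..t} \<and> F t - F s = integral {s..t} f"
    using assms unfolding ac_deriv_on_def by auto
  then show "f absolutely_integrable_on {s..t}" "integral {s..t} f = F t - F s" by auto
  show "f integrable_on {s..t}" using * set_lebesgue_integral_eq_integral(1) by blast
  then show "(f has_integral (F t - F s)) {s..t}" using * by (metis integrable_integral)
qed

lemma ac_deriv_onI:
  assumes "f absolutely_integrable_on {a..b}"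
    and "\<And>x. a \<le> x \<Longrightarrow> x \<le> b \<Longrightarrow> (f has_integral (F x - F a)) {a..x}"
  shows "ac_deriv_on {a..b} F f"
  unfolding ac_deriv_on_def
proof (intro ballI impI conjI)
  fix s t assume st: "s \<in> {a..b}" "t \<in> {a..b}" "s \<le> t"
  show *: "f absolutely_integrable_on {s..t}"
    by (rule absolutely_integrable_on_subinterval[OF assms(1)]) (use st in auto)
  have "integral {a..s} f + integral {s..t} f = integral {a..t} f"
    by (rule Henstock_Kurzweil_Integration.integral_combine)
       (use st assms(2)[of t] in \<open>auto simp: has_integral_integrable\<close>)
  moreover have "integral {a..s} f = F s - F a" "integral {a..t} f = F t - F a"
    using st assms(2)[of s] assms(2)[of t] by (auto intro: integral_unique)
  ultimately show "F t - F s = integral {s..t} f" by (auto simp: algebra_simps)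
qed

lemma ac_deriv_on_subset:
  assumes "ac_deriv_on I F f" "J \<subseteq> I"
  shows "ac_deriv_on J F f"
  using assms unfolding ac_deriv_on_def by blast

lemma ac_deriv_on_integral:
  assumes "f absolutely_integrable_on {a..b}"
  shows "ac_deriv_on {a..b} (\<lambda>x. c + integral {a..x} f) f"
proof (rule ac_deriv_onI[OF assms])
  fix x assume x: "a \<le> x" "x \<le> b"
  have "f absolutely_integrable_on {a..x}"
    by (rule absolutely_integrable_on_subinterval[OF assms]) (use x in auto)
  then have "f integrable_on {a..x}" using set_lebesgue_integral_eq_integral(1) by blast
  then show "(f has_integral (c + integral {a..x} f - (c + integral {a..a} f))) {a..x}"
    by (auto simp: integrable_integral)
qed

lemma ac_deriv_on_C1:
  assumes "\<And>x. x \<in> {a..b} \<Longrightarrow> (F has_vector_derivative f x) (at x within {a..b})"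
    and "continuous_on {a..b} f"
  shows "ac_deriv_on {a..b} F f"
proof (rule ac_deriv_onI)
  show "f absolutely_integrable_on {a..b}"
    using assms(2) by (rule absolutely_integrable_continuous_real)
  fix x assume x: "a \<le> x" "x \<le> b"
  show "(f has_integral (F x - F a)) {a..x}"
    by (rule fundamental_theorem_of_calculus)
       (use x in \<open>auto intro: has_vector_derivative_within_subset[OF assms(1)]\<close>)
qed

lemma ac_deriv_on_continuous:
  assumes "ac_deriv_on {a..b} F f"
  shows "continuous_on {a..b} F"
proof (cases "a \<le> b")
  case True
  have "continuous_on {a..b} (\<lambda>x. F a + integral {a..x} f)"
    by (intro continuous_intros indefinite_integral_continuous_1)
       (use ac_deriv_onD[OF assms, of a b] True in auto)
  moreover have "F a + integral {a..x} f = F x" if "x \<in> {a..b}" for x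
    using ac_deriv_onD(4)[OF assms, of a x] that by auto
  ultimately show ?thesis by (metis (no_types, lifting) continuous_on_cong)
qed auto

lemma ac_deriv_on_add:
  assumes "ac_deriv_on I F f" "ac_deriv_on I G g"
  shows "ac_deriv_on I (\<lambda>x. F x + G x) (\<lambda>x. f x + g x)"
  unfolding ac_deriv_on_def
proof (intro ballI impI conjI)
  fix a b assume "a \<in> I" "b \<in> I" "a \<le> b"
  then have *: "f absolutely_integrable_on {a..b}" "g absolutely_integrable_on {a..b}"
     "F b - F a = integral {a..b} f" "G b - G a = integral {a..b} g"
    using assms unfolding ac_deriv_on_def by auto
  then show "(\<lambda>x. f x + g x) absolutely_integrable_on {a..b}" by (auto intro: set_integral_add)
  have "integral {a..b} (\<lambda>x. f x + g x) = integral {a..b} f + integral {a..b} g"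
    using * by (auto intro!: Henstock_Kurzweil_Integration.integral_add simp: set_lebesgue_integral_eq_integral)
  with * show "F b + G b - (F a + G a) = integral {a..b} (\<lambda>x. f x + g x)" by (simp add: algebra_simps)
qed

lemma ac_deriv_on_cmult:
  assumes "ac_deriv_on I F f"
  shows "ac_deriv_on I (\<lambda>x. c * F x) (\<lambda>x. c * f x)"
  using assms unfolding ac_deriv_on_def
  by (auto intro!: set_integrable_mult_right simp: right_diff_distrib[symmetric])

lemma ac_deriv_on_cong:
  assumes "ac_deriv_on I F f" "is_interval I" "\<And>x. x \<in> I \<Longrightarrow> F x = G x" "\<And>x. x \<in> I \<Longrightarrow> f x = g x"
  shows "ac_deriv_on I G g"
  unfolding ac_deriv_on_def
proof (intro ballI impI)
  fix a b assume ab: "a \<in> I" "b \<in> I" "a \<le> b"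
  have sub: "x \<in> I" if "x \<in> {a..b}" for x
    using assms(2) ab that by (meson atLeastAtMost_iff mem_is_interval_1_I)
  have "integral {a..b} f = integral {a..b} g"
    by (rule integral_cong) (use sub assms in auto)
  moreover have "f absolutely_integrable_on {a..b} \<longleftrightarrow> g absolutely_integrable_on {a..b}"
    by (rule set_integrable_cong) (use sub assms in auto)
  ultimately show "g absolutely_integrable_on {a..b} \<and> G b - G a = integral {a..b} g"
    using assms(1,3) ab unfolding ac_deriv_on_def by metis
qed

lemma abs_int_mult_continuous:
  fixes f g :: "real \<Rightarrow> complex"
  assumes f: "f absolutely_integrable_on {a..b}" and g: "continuous_on {a..b} g"
  shows "(\<lambda>x. f x * g x) absolutely_integrable_on {a..b}"
proof -
  have "bounded (g ` {a..b})"
    by (intro compact_imp_bounded compact_continuous_image g) auto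
  moreover have "g \<in> borel_measurable (lebesgue_on {a..b})"
    by (intro continuous_imp_measurable_on_sets_lebesgue g) auto
  ultimately have "(\<lambda>x. g x * f x) absolutely_integrable_on {a..b}"
    by (intro absolutely_integrable_bounded_measurable_product[OF _ _ _ _ f])
      (auto simp: bilinear_conv_bounded_bilinear bounded_bilinear_mult)
  then show ?thesis by (simp add: mult.commute)
qed

lemma abs_integrable_imp_integrable:
  fixes f :: "real \<Rightarrow> complex"
  assumes "f absolutely_integrable_on S"
  shows "f integrable_on S"
  using assms set_lebesgue_integral_eq_integral(1) by blast

lemma abs_integrable_imp_norm:
  fixes f :: "real \<Rightarrow> complex"
  assumes "f absolutely_integrable_on S"
  shows "(\<lambda>x. norm (f x)) integrable_on S"
  using assms absolutely_integrable_on_def by blast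

text \<open>The product rule is proved on integrals, without pointwise derivatives. On a short
  interval \<open>{s..t}\<close> the increment of \<open>F * G\<close> is the integral of
  \<open>f u * G t + F s * g u\<close>, and replacing \<open>G t\<close> and \<open>F s\<close> by
  \<open>G u\<close> and \<open>F u\<close> costs at most \<open>e\<close> times the integral of
  \<open>norm f + norm g\<close>. Both sides of this estimate add up over adjacent intervals, so it
  extends to the whole interval, and \<open>e\<close> is arbitrary.\<close>

lemma ac_deriv_on_mult:
  assumes F: "ac_deriv_on {a..b} F f" and G: "ac_deriv_on {a..b} G g"
  shows "ac_deriv_on {a..b} (\<lambda>x. F x * G x) (\<lambda>x. f x * G x + F x * g x)"
proof (cases "a \<le> b")
  case False
  then show ?thesis by (auto simp: ac_deriv_on_def)
next
  case ab: True
  have cF: "continuous_on {a..b} F" and cG: "continuous_on {a..b} G"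
    using F G ac_deriv_on_continuous by auto
  have fi: "f absolutely_integrable_on {a..b}" and gi: "g absolutely_integrable_on {a..b}"
    using ac_deriv_onD[OF F, of a b] ac_deriv_onD[OF G, of a b] ab by auto
  define k where "k = (\<lambda>x. f x * G x + F x * g x)"
  have "(\<lambda>x. F x * g x) absolutely_integrable_on {a..b}"
    using abs_int_mult_continuous[OF gi cF] by (simp add: mult.commute)
  then have ki: "k absolutely_integrable_on {a..b}"
    unfolding k_def using abs_int_mult_continuous[OF fi cG] by (auto intro: set_integral_add)
  define w where "w = (\<lambda>x. norm (f x) + norm (g x))"
  have wi: "w integrable_on {s..t}" if "a \<le> s" "s \<le> t" "t \<le> b" for s t
    unfolding w_def
    by (intro integrable_add abs_integrable_imp_norm)
       (use ac_deriv_onD[OF F, of s t] ac_deriv_onD[OF G, of s t] that in auto)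
  have main: "norm (F t * G t - F s * G s - integral {s..t} k) \<le> e * integral {s..t} w"
    if "0 < e" and st: "a \<le> s" "s \<le> t" "t \<le> b" for e s t
  proof -
    define R where "R s t \<longleftrightarrow> (a \<le> s \<longrightarrow> t \<le> b \<longrightarrow>
      norm (F t * G t - F s * G s - integral {s..t} k) \<le> e * integral {s..t} w)" for s t
    have ki': "k integrable_on {s..t}" if "a \<le> s" "s \<le> t" "t \<le> b" for s t
      using ki that by (auto intro!: abs_integrable_imp_integrable absolutely_integrable_on_subinterval[OF ki])
    \<comment> \<open>Bisection: an estimate that adds up over adjacent intervals and holds on all
      short intervals around each point holds globally. Short means that \<open>F\<close> and
      \<open>G\<close> oscillate by at most \<open>e\<close>.\<close>
    have "R s t"
      using \<open>s \<le> t\<close>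
    proof (induction rule: Bolzano)
      case (trans x y z)
      show ?case unfolding R_def
      proof (intro impI)
        assume xz: "a \<le> x" "z \<le> b"
        have 1: "integral {x..y} k + integral {y..z} k = integral {x..z} k"
          by (rule Henstock_Kurzweil_Integration.integral_combine) (use trans xz ki' in auto)
        have 2: "integral {x..y} w + integral {y..z} w = integral {x..z} w"
          by (rule Henstock_Kurzweil_Integration.integral_combine) (use trans xz wi in auto)
        have "norm (F y * G y - F x * G x - integral {x..y} k) \<le> e * integral {x..y} w"
          "norm (F z * G z - F y * G y - integral {y..z} k) \<le> e * integral {y..z} w"
          using trans xz unfolding R_def by auto
        then have "norm ((F y * G y - F x * G x - integral {x..y} k) + (F z * G z - F y * G y - integral {y..z} k))
           \<le> e * integral {x..y} w + e * integral {y..z} w"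
          by (meson add_mono norm_triangle_le)
        then show "norm (F z * G z - F x * G x - integral {x..z} k) \<le> e * integral {x..z} w"
          unfolding 1[symmetric] 2[symmetric] by (simp add: algebra_simps)
      qed
    next
      case (local x)
      then have x: "x \<in> {a..b}" using st by auto
      obtain d1 where d1: "d1 > 0" "\<And>u. u \<in> {a..b} \<Longrightarrow> dist u x < d1 \<Longrightarrow> dist (F u) (F x) < e/2"
        using cF x \<open>0 < e\<close> unfolding continuous_on_iff by (meson half_gt_zero)
      obtain d2 where d2: "d2 > 0" "\<And>u. u \<in> {a..b} \<Longrightarrow> dist u x < d2 \<Longrightarrow> dist (G u) (G x) < e/2"
        using cG x \<open>0 < e\<close> unfolding continuous_on_iff by (meson half_gt_zero)
      show ?case
      proof (intro exI[of _ "min d1 d2"] conjI allI impI)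
        show "0 < min d1 d2" using d1 d2 by auto
        fix s t assume *: "s \<le> x \<and> x \<le> t \<and> t - s < min d1 d2"
        show "R s t" unfolding R_def
        proof (intro impI)
          assume st: "a \<le> s" "t \<le> b"
          have "s \<le> t" using * by auto
          have oF: "norm (F s - F u) \<le> e" if "u \<in> {s..t}" for u
          proof -
            have "dist (F s) (F x) < e/2" "dist (F u) (F x) < e/2"
              using d1(2)[of s] d1(2)[of u] * st that by (auto simp: dist_real_def)
            then show ?thesis by (smt (verit) dist_norm dist_triangle3 dist_commute field_sum_of_halves)
          qed
          have oG: "norm (G t - G u) \<le> e" if "u \<in> {s..t}" for u
          proof -
            have "dist (G t) (G x) < e/2" "dist (G u) (G x) < e/2"
              using d2(2)[of t] d2(2)[of u] * st that by (auto simp: dist_real_def)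
            then show ?thesis by (smt (verit) dist_norm dist_triangle3 dist_commute field_sum_of_halves)
          qed
          have hf: "(f has_integral (F t - F s)) {s..t}" and hg: "(g has_integral (G t - G s)) {s..t}"
            using ac_deriv_onD(2)[OF F] ac_deriv_onD(2)[OF G] st \<open>s \<le> t\<close> by auto
          have hk: "(k has_integral integral {s..t} k) {s..t}"
            using ki' st \<open>s \<le> t\<close> by auto
          have "((\<lambda>u. f u * G t + F s * g u - k u) has_integral
              ((F t - F s) * G t + F s * (G t - G s) - integral {s..t} k)) {s..t}"
            by (intro has_integral_diff has_integral_add has_integral_mult_left has_integral_mult_right hf hg hk)
          moreover have "(F t - F s) * G t + F s * (G t - G s) - integral {s..t} k =
             F t * G t - F s * G s - integral {s..t} k" by (simp add: algebra_simps)
          ultimately have I: "((\<lambda>u. f u * G t + F s * g u - k u) has_integral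
              (F t * G t - F s * G s - integral {s..t} k)) {s..t}" by simp
          have "norm (F t * G t - F s * G s - integral {s..t} k) = norm (integral {s..t} (\<lambda>u. f u * G t + F s * g u - k u))"
            using I by (simp add: integral_unique)
          also have "\<dots> \<le> integral {s..t} (\<lambda>u. e * w u)"
          proof (rule integral_norm_bound_integral)
            show "(\<lambda>u. f u * G t + F s * g u - k u) integrable_on {s..t}" using I by blast
            show "(\<lambda>u. e * w u) integrable_on {s..t}"
              using wi[OF st(1) \<open>s \<le> t\<close> st(2)] by (rule integrable_on_mult_right)
            fix u assume u: "u \<in> {s..t}"
            have "f u * G t + F s * g u - k u = f u * (G t - G u) + (F s - F u) * g u"
              by (simp add: k_def algebra_simps)
            also have "norm \<dots> \<le> norm (f u) * norm (G t - G u) + norm (F s - F u) * norm (g u)"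
              by (metis norm_mult norm_triangle_ineq)
            also have "\<dots> \<le> norm (f u) * e + e * norm (g u)"
              using oF[OF u] oG[OF u] \<open>0 < e\<close> by (intro add_mono mult_mono) auto
            finally show "norm (f u * G t + F s * g u - k u) \<le> e * w u"
              by (simp add: w_def algebra_simps)
          qed
          finally show "norm (F t * G t - F s * G s - integral {s..t} k) \<le> e * integral {s..t} w"
            by simp
        qed
      qed
    qed
    then show ?thesis using st unfolding R_def by auto
  qed
  show ?thesis
    unfolding k_def[symmetric]
  proof (rule ac_deriv_onI[OF ki])
    fix x assume x: "a \<le> x" "x \<le> b"
    have "norm (F x * G x - F a * G a - integral {a..x} k) \<le> e" if "e > 0" for e
    proof -
      have nn: "integral {a..x} w \<ge> 0" by (intro integral_nonneg wi) (use x in \<open>auto simp: w_def\<close>)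
      have "norm (F x * G x - F a * G a - integral {a..x} k) \<le> (e / (integral {a..x} w + 1)) * integral {a..x} w"
        by (rule main) (use x that nn in auto)
      also have "\<dots> \<le> e" using nn that by (simp add: field_simps)
      finally show ?thesis .
    qed
    then have "norm (F x * G x - F a * G a - integral {a..x} k) \<le> 0"
      by (rule field_le_epsilon) simp
    then have "F x * G x - F a * G a = integral {a..x} k" by simp
    moreover have "k integrable_on {a..x}"
      using x by (auto intro!: abs_integrable_imp_integrable absolutely_integrable_on_subinterval[OF ki])
    ultimately show "(k has_integral (F x * G x - F a * G a)) {a..x}" by (metis integrable_integral)
  qed
qed

text \<open>The weight of the iterated kernel in Picard's iteration and in Gronwall's inequality.\<close>

lemma has_integral_power_fact:
  fixes g :: "real \<Rightarrow> real"
  assumes g: "g integrable_on {a..b}" and nn: "\<And>x. x \<in> {a..b} \<Longrightarrow> 0 \<le> g x" and x: "a \<le> x" "x \<le> b"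
  shows "((\<lambda>t. g t * (integral {a..t} g ^ n / fact n)) has_integral (integral {a..x} g ^ Suc n / fact (Suc n))) {a..x}"
proof -
  have gai: "g absolutely_integrable_on {a..b}"
    using g nn by (intro nonnegative_absolutely_integrable_1) auto
  \<comment> \<open>The product rule above is for complex valued functions, so the real weight is
    embedded into the complex numbers and the real part is taken at the end.\<close>
  let ?g = "\<lambda>t. complex_of_real (g t)"
  define G where "G = (\<lambda>t. 0 + integral {a..t} ?g)"
  have cgai: "?g absolutely_integrable_on {a..b}"
    using absolutely_integrable_linear[OF gai bounded_linear_of_real] by (simp add: o_def)
  have G: "ac_deriv_on {a..b} G ?g"
    unfolding G_def by (rule ac_deriv_on_integral) (rule cgai)
  have Geq: "G t = of_real (integral {a..t} g)" if "t \<in> {a..b}" for t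
  proof -
    have "g integrable_on {a..t}" by (rule integrable_on_subinterval[OF g]) (use that in auto)
    from integral_linear[OF this bounded_linear_of_real]
    show ?thesis by (auto simp: G_def o_def)
  qed
  have P: "ac_deriv_on {a..b} (\<lambda>t. G t ^ Suc n) (\<lambda>t. of_nat (Suc n) * ?g t * G t ^ n)" for n
  proof (induction n)
    case 0
    then show ?case using G by simp
  next
    case (Suc n)
    have "ac_deriv_on {a..b} (\<lambda>t. G t * G t ^ Suc n)
        (\<lambda>t. ?g t * G t ^ Suc n + G t * (of_nat (Suc n) * ?g t * G t ^ n))"
      by (rule ac_deriv_on_mult[OF G Suc])
    then show ?case
      by (rule ac_deriv_on_cong) (auto simp: algebra_simps)
  qed
  have "G a = 0" by (simp add: G_def)
  have "((\<lambda>t. of_nat (Suc n) * ?g t * G t ^ n) has_integral (G x ^ Suc n)) {a..x}"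
    using ac_deriv_onD(2)[OF P[of n], of a x] x \<open>G a = 0\<close> by auto
  then have *: "((\<lambda>t. (1 / fact (Suc n)) * (of_nat (Suc n) * ?g t * G t ^ n)) has_integral ((1 / fact (Suc n)) * (G x ^ Suc n))) {a..x}"
    by (rule has_integral_mult_right)
  have Gx: "complex_of_real (integral {a..x} g ^ Suc n / fact (Suc n)) = 1 / fact (Suc n) * G x ^ Suc n"
    using Geq[of x] x by simp
  from * have "((\<lambda>t. complex_of_real (g t * (integral {a..t} g ^ n / fact n))) has_integral of_real (integral {a..x} g ^ Suc n / fact (Suc n))) {a..x}"
    unfolding Gx
  proof (rule has_integral_eq[rotated])
    fix t assume "t \<in> {a..x}"
    then have "G t = of_real (integral {a..t} g)" using x by (intro Geq) auto
    moreover have "(1 / fact (Suc n)) * complex_of_nat (Suc n) = 1 / fact n"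
      by (simp add: field_simps del: of_nat_Suc)
    ultimately show "(1 / fact (Suc n)) * (of_nat (Suc n) * ?g t * G t ^ n) = complex_of_real (g t * (integral {a..t} g ^ n / fact n))"
      by (simp add: mult.assoc[symmetric] del: of_nat_Suc fact_Suc)
  qed
  from has_integral_linear[OF this bounded_linear_Re] show ?thesis
    by (simp only: o_def Re_complex_of_real)
qed

text \<open>Since \<open>g\<close> is only integrable, the inequality is iterated instead of being
  differentiated. After \<open>K\<close> rounds the bound is a partial sum of the exponential series
  plus a remainder \<open>M * G^K / K!\<close>, where \<open>M\<close> bounds the continuous
  function \<open>n\<close>; the remainder tends to 0.\<close>

lemma gronwall:
  fixes g n :: "real \<Rightarrow> real"
  assumes g: "g integrable_on {a..b}" and nn: "\<And>x. x \<in> {a..b} \<Longrightarrow> 0 \<le> g x"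
    and cont: "continuous_on {a..b} n"
    and gn: "(\<lambda>t. g t * n t) integrable_on {a..b}"
    and le: "\<And>x. x \<in> {a..b} \<Longrightarrow> n x \<le> N + integral {a..x} (\<lambda>t. g t * n t)"
    and "0 \<le> N" and x: "x \<in> {a..b}"
  shows "n x \<le> N * exp (integral {a..x} g)"
proof -
  have "bounded (n ` {a..b})"
    by (intro compact_imp_bounded compact_continuous_image cont) auto
  then obtain M where M: "\<And>x. x \<in> {a..b} \<Longrightarrow> \<bar>n x\<bar> \<le> M"
    unfolding bounded_iff by (metis image_eqI real_norm_def)
  define G where "G x = integral {a..x} g" for x
  have int: "((\<lambda>t. g t * (G t ^ k / fact k)) has_integral (G x ^ Suc k / fact (Suc k))) {a..x}" if "x \<in> {a..b}" for x k
    unfolding G_def using has_integral_power_fact[OF g nn, of x k] that by auto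
  \<comment> \<open>Each round integrates the previous bound, which raises every index by one, and
    the summand \<open>N\<close> of the hypothesis restores the term of index 0.\<close>
  have step: "n x \<le> (\<Sum>k<K. N * (G x ^ k / fact k)) + M * (G x ^ K / fact K)" if "x \<in> {a..b}" for K x
    using that
  proof (induction K arbitrary: x)
    case 0
    then show ?case using M[of x] by auto
  next
    case (Suc K)
    have I: "((\<lambda>t. g t * ((\<Sum>k<K. N * (G t ^ k / fact k)) + M * (G t ^ K / fact K))) has_integral
        ((\<Sum>k<K. N * (G x ^ Suc k / fact (Suc k))) + M * (G x ^ Suc K / fact (Suc K)))) {a..x}"
    proof -
      have "((\<lambda>t. (\<Sum>k<K. N * (g t * (G t ^ k / fact k))) + M * (g t * (G t ^ K / fact K))) has_integral
        ((\<Sum>k<K. N * (G x ^ Suc k / fact (Suc k))) + M * (G x ^ Suc K / fact (Suc K)))) {a..x}"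
        by (intro has_integral_add has_integral_sum has_integral_mult_right int Suc.prems) auto
      then show ?thesis
        by (rule has_integral_eq[rotated]) (simp add: algebra_simps sum_distrib_left)
    qed
    have "n x \<le> N + integral {a..x} (\<lambda>t. g t * n t)" using le Suc.prems by auto
    also have "integral {a..x} (\<lambda>t. g t * n t) \<le> (\<Sum>k<K. N * (G x ^ Suc k / fact (Suc k))) + M * (G x ^ Suc K / fact (Suc K))"
    proof (rule has_integral_le[OF integrable_integral I])
      show "(\<lambda>t. g t * n t) integrable_on {a..x}"
        by (rule integrable_on_subinterval[OF gn]) (use Suc.prems in auto)
      fix t assume "t \<in> {a..x}"
      then show "g t * n t \<le> g t * ((\<Sum>k<K. N * (G t ^ k / fact k)) + M * (G t ^ K / fact K))"
        using Suc.prems nn[of t] Suc.IH[of t] by (intro mult_left_mono) auto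
    qed
    also have "N + ((\<Sum>k<K. N * (G x ^ Suc k / fact (Suc k))) + M * (G x ^ Suc K / fact (Suc K)))
       = (\<Sum>k<Suc K. N * (G x ^ k / fact k)) + M * (G x ^ Suc K / fact (Suc K))"
      by (simp only: sum.lessThan_Suc_shift) (simp del: fact_Suc)
    finally show ?case by simp
  qed
  have s: "(\<lambda>k. G x ^ k / fact k) sums exp (G x)"
    using exp_converges[of "G x"] by (simp add: field_simps scaleR_conv_of_real)
  have "(\<lambda>K. (\<Sum>k<K. N * (G x ^ k / fact k)) + M * (G x ^ K / fact K)) \<longlonglongrightarrow> N * exp (G x) + M * 0"
    by (intro tendsto_intros summable_LIMSEQ_zero[OF sums_summable[OF s]])
       (use sums_mult[OF s, of N] in \<open>simp add: sums_def\<close>)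
  then have "n x \<le> N * exp (G x) + M * 0"
    by (rule Lim_bounded2) (use step x in auto)
  then show ?thesis by (simp add: G_def)
qed

section \<open>Initial value problems with integrable coefficients\<close>

text \<open>Solutions of \<open>y'' = P y\<close> on a closed interval; the Sturm--Liouville equation is the case
  \<open>P = q - \<lambda>\<close>.\<close>

definition sol :: "(real \<Rightarrow> complex) \<Rightarrow> real \<Rightarrow> real \<Rightarrow> (real \<Rightarrow> complex) \<Rightarrow> (real \<Rightarrow> complex) \<Rightarrow> bool" where
  "sol P a b y dy \<longleftrightarrow>
     (\<forall>x\<in>{a..b}. (y has_vector_derivative dy x) (at x within {a..b})) \<and>
     ac_deriv_on {a..b} dy (\<lambda>x. P x * y x)"

lemma sol_continuous:
  assumes "sol P a b y dy"
  shows "continuous_on {a..b} y" "continuous_on {a..b} dy"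
proof -
  show "continuous_on {a..b} dy" using assms ac_deriv_on_continuous unfolding sol_def by blast
  show "continuous_on {a..b} y" using assms unfolding sol_def
    by (meson continuous_on_eq_continuous_within has_vector_derivative_continuous)
qed

lemma sol_ac:
  assumes "sol P a b y dy"
  shows "ac_deriv_on {a..b} y dy" "ac_deriv_on {a..b} dy (\<lambda>x. P x * y x)"
  using assms sol_continuous[OF assms] unfolding sol_def by (auto intro: ac_deriv_on_C1)

lemma sol_subset:
  assumes "sol P a b y dy" "a \<le> s" "t \<le> b"
  shows "sol P s t y dy"
  using assms unfolding sol_def
  by (auto intro!: ac_deriv_on_subset[of "{a..b}" _ _ "{s..t}"]
      has_vector_derivative_within_subset[of y _ _ "{a..b}" "{s..t}"])

lemma sol_add:
  assumes "sol P a b y dy" "sol P a b z dz"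
  shows "sol P a b (\<lambda>x. y x + z x) (\<lambda>x. dy x + dz x)"
  using assms ac_deriv_on_add[of "{a..b}" dy "\<lambda>x. P x * y x" dz "\<lambda>x. P x * z x"]
  unfolding sol_def by (auto intro!: derivative_eq_intros simp: distrib_left)

lemma sol_cmult:
  assumes "sol P a b y dy"
  shows "sol P a b (\<lambda>x. c * y x) (\<lambda>x. c * dy x)"
  using assms ac_deriv_on_cmult[of "{a..b}" dy "\<lambda>x. P x * y x" c]
  unfolding sol_def
  by (auto intro!: has_vector_derivative_mult_right simp: mult.left_commute)

lemma sol_lincomb:
  assumes "sol P a b y dy" "sol P a b z dz"
  shows "sol P a b (\<lambda>x. c * y x + e * z x) (\<lambda>x. c * dy x + e * dz x)"
  using assms by (intro sol_add sol_cmult)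

text \<open>In the derivative of the Wronskian the terms \<open>dy * dz\<close> cancel and only the
  difference of the potentials survives. It serves in three settings: equal potentials, potentials
  that differ by the spectral parameter, and the potentials of the two problems.\<close>

lemma sol_lagrange:
  assumes y: "sol P a b y dy" and z: "sol R a b z dz"
  shows "ac_deriv_on {a..b} (\<lambda>x. y x * dz x - dy x * z x) (\<lambda>x. (R x - P x) * y x * z x)"
proof -
  have "ac_deriv_on {a..b} (\<lambda>x. y x * dz x + (-1) * (dy x * z x))
     (\<lambda>x. (dy x * dz x + y x * (R x * z x)) + (-1) * ((P x * y x) * z x + dy x * dz x))"
    by (intro ac_deriv_on_add ac_deriv_on_cmult ac_deriv_on_mult sol_ac[OF y] sol_ac[OF z])
  then show ?thesis
    by (rule ac_deriv_on_cong) (auto simp: algebra_simps)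
qed

lemma sol_wronskian:
  assumes "sol P a b y dy" "sol P a b z dz" "x \<in> {a..b}" "t \<in> {a..b}"
  shows "y x * dz x - dy x * z x = y t * dz t - dy t * z t"
proof -
  have *: "y t * dz t - dy t * z t = y a * dz a - dy a * z a" if "t \<in> {a..b}" for t
    using ac_deriv_onD(4)[OF sol_lagrange[OF assms(1,2)], of a t] that by auto
  show ?thesis using *[OF assms(3)] *[OF assms(4)] by simp
qed

text \<open>Gronwall's inequality for the sum of the norms of \<open>y\<close> and
  \<open>dy\<close>; the weight \<open>1 + norm (P t)\<close> covers the right sides of both
  equations \<open>y' = dy\<close> and \<open>dy' = P y\<close>. It gives uniqueness and, later,
  bounds that are uniform in the spectral parameter.\<close>

lemma sol_bound:
  assumes y: "sol P a b y dy" and P: "P absolutely_integrable_on {a..b}" and x: "x \<in> {a..b}"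
  shows "norm (y x) + norm (dy x) \<le> (norm (y a) + norm (dy a)) * exp (integral {a..b} (\<lambda>t. 1 + norm (P t)))"
proof -
  note c = sol_continuous[OF y]
  have gi: "(\<lambda>t. 1 + norm (P t)) integrable_on {a..b}"
    by (intro integrable_add abs_integrable_imp_norm P) auto
  have i1: "(\<lambda>t. norm (P t) * norm (y t)) integrable_on {a..b}"
    using abs_integrable_imp_norm[OF abs_int_mult_continuous[OF P c(1)]] by (simp add: norm_mult)
  have i2: "(\<lambda>t. norm (P t) * norm (dy t)) integrable_on {a..b}"
    using abs_integrable_imp_norm[OF abs_int_mult_continuous[OF P c(2)]] by (simp add: norm_mult)
  have i3: "(\<lambda>t. norm (y t)) integrable_on {a..b}" "(\<lambda>t. norm (dy t)) integrable_on {a..b}"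
    by (intro integrable_continuous_real continuous_intros c)+
  let ?n = "\<lambda>t. norm (y t) + norm (dy t)"
  have gni: "(\<lambda>t. (1 + norm (P t)) * ?n t) integrable_on {a..b}"
    using integrable_add[OF integrable_add[OF i3] integrable_add[OF i1 i2]]
    by (simp add: algebra_simps)
  have "?n x \<le> ?n a * exp (integral {a..x} (\<lambda>t. 1 + norm (P t)))"
  proof (rule gronwall[OF gi _ _ gni _ _ x])
    fix t assume t: "t \<in> {a..b}"
    have sub: "h integrable_on {a..t}" if "h integrable_on {a..b}" for h :: "real \<Rightarrow> real"
      by (rule integrable_on_subinterval[OF that]) (use t in auto)
    have "norm (y t) \<le> norm (y a) + norm (integral {a..t} dy)"
      using ac_deriv_onD(4)[OF sol_ac(1)[OF y], of a t] t by (simp add: norm_triangle_sub)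
    also have "norm (integral {a..t} dy) \<le> integral {a..t} (\<lambda>t. norm (dy t))"
      by (rule integral_norm_bound_integral) (use ac_deriv_onD(3)[OF sol_ac(1)[OF y], of a t] sub[OF i3(2)] t in auto)
    finally have A: "norm (y t) \<le> norm (y a) + integral {a..t} (\<lambda>t. norm (dy t))" by simp
    have "norm (dy t) \<le> norm (dy a) + norm (integral {a..t} (\<lambda>x. P x * y x))"
      using ac_deriv_onD(4)[OF sol_ac(2)[OF y], of a t] t by (simp add: norm_triangle_sub)
    also have "norm (integral {a..t} (\<lambda>x. P x * y x)) \<le> integral {a..t} (\<lambda>t. norm (P t) * norm (y t))"
      by (rule integral_norm_bound_integral)
         (use ac_deriv_onD(3)[OF sol_ac(2)[OF y], of a t] sub[OF i1] t in \<open>auto simp: norm_mult\<close>)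
    finally have B: "norm (dy t) \<le> norm (dy a) + integral {a..t} (\<lambda>t. norm (P t) * norm (y t))" by simp
    have "integral {a..t} (\<lambda>t. norm (dy t)) + integral {a..t} (\<lambda>t. norm (P t) * norm (y t))
       = integral {a..t} (\<lambda>t. norm (dy t) + norm (P t) * norm (y t))"
      by (rule Henstock_Kurzweil_Integration.integral_add[symmetric]) (intro sub i1 i3)+
    also have "\<dots> \<le> integral {a..t} (\<lambda>t. (1 + norm (P t)) * ?n t)"
    proof (rule integral_le)
      show "(\<lambda>t. norm (dy t) + norm (P t) * norm (y t)) integrable_on {a..t}"
        by (intro integrable_add sub i1 i3)
      show "(\<lambda>t. (1 + norm (P t)) * ?n t) integrable_on {a..t}" by (intro sub gni)
      show "norm (dy t) + norm (P t) * norm (y t) \<le> (1 + norm (P t)) * ?n t" for t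
        by (simp add: algebra_simps)
    qed
    finally show "?n t \<le> ?n a + integral {a..t} (\<lambda>t. (1 + norm (P t)) * ?n t)" using A B by linarith
  qed (auto intro!: continuous_intros c)
  also have "integral {a..x} (\<lambda>t. 1 + norm (P t)) \<le> integral {a..b} (\<lambda>t. 1 + norm (P t))"
    by (rule integral_subset_le) (use x gi in \<open>auto intro: integrable_on_subinterval[OF gi]\<close>)
  finally show ?thesis by (simp add: mult_left_mono)
qed

lemma sol_unique:
  assumes "sol P a b y dy" "sol P a b z dz" "P absolutely_integrable_on {a..b}"
    "y a = z a" "dy a = dz a" "x \<in> {a..b}"
  shows "y x = z x" "dy x = dz x"
proof -
  have "sol P a b (\<lambda>x. 1 * y x + (-1) * z x) (\<lambda>x. 1 * dy x + (-1) * dz x)"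
    by (rule sol_lincomb[OF assms(1,2)])
  from sol_bound[OF this assms(3,6)] have "norm (y x - z x) + norm (dy x - dz x) \<le> 0"
    using assms by simp
  then have "norm (y x - z x) = 0" "norm (dy x - dz x) = 0"
    by (smt (verit) norm_ge_zero)+
  then show "y x = z x" "dy x = dz x" by auto
qed

text \<open>Picard iteration for the fixed point equation \<open>y = U y\<close>, where
  \<open>V y\<close> is the derivative belonging to \<open>U y\<close>. The factorial weights make
  the iterates converge uniformly on the whole interval at once, so no gluing of short intervals is
  needed.\<close>

lemma sol_exists:
  assumes P: "P absolutely_integrable_on {a..b}" and ab: "a \<le> b"
  shows "\<exists>y dy. sol P a b y dy \<and> y a = y0 \<and> dy a = y1"
proof -
  define V where "V y x = y1 + integral {a..x} (\<lambda>t. P t * y t)" for y x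
  define U where "U y x = y0 + integral {a..x} (V y)" for y x
  define G where "G x = integral {a..x} (\<lambda>t. norm (P t))" for x
  note Pn = abs_integrable_imp_norm[OF P]
  have acV: "ac_deriv_on {a..b} (V y) (\<lambda>t. P t * y t)" if "continuous_on {a..b} y" for y
    unfolding V_def by (rule ac_deriv_on_integral[OF abs_int_mult_continuous[OF P that]])
  have cV: "continuous_on {a..b} (V y)" if "continuous_on {a..b} y" for y
    using acV[OF that] by (rule ac_deriv_on_continuous)
  have dU: "(U y has_vector_derivative V y x) (at x within {a..b})"
    if "continuous_on {a..b} y" "x \<in> {a..b}" for y x
    unfolding U_def using integral_has_vector_derivative[OF cV[OF that(1)] that(2)]
    by (auto intro!: derivative_eq_intros)
  have cU: "continuous_on {a..b} (U y)" if "continuous_on {a..b} y" for y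
    using dU[OF that] has_vector_derivative_continuous
    unfolding continuous_on_eq_continuous_within by blast
  \<comment> \<open>The inner integration against \<open>norm P\<close> turns
    \<open>G^n / n!\<close> into the next weight; the outer one is bounded crudely by the factor
    \<open>b - a\<close>.\<close>
  have step: "norm (U y x - U z x) \<le> (C * (b - a)) * (G x ^ Suc n / fact (Suc n))"
    if cy: "continuous_on {a..b} y" and cz: "continuous_on {a..b} z" and "C \<ge> 0"
      and le: "\<And>t. t \<in> {a..b} \<Longrightarrow> norm (y t - z t) \<le> C * (G t ^ n / fact n)" and x: "x \<in> {a..b}"
    for y z x C n
  proof -
    have GI: "((\<lambda>t. norm (P t) * (C * (G t ^ n / fact n))) has_integral C * (G t ^ Suc n / fact (Suc n))) {a..t}"
      if "t \<in> {a..b}" for t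
    proof -
      have "((\<lambda>t. C * (norm (P t) * (G t ^ n / fact n))) has_integral C * (G t ^ Suc n / fact (Suc n))) {a..t}"
        unfolding G_def by (intro has_integral_mult_right has_integral_power_fact[OF Pn]) (use that in auto)
      then show ?thesis by (rule has_integral_eq[rotated]) (simp add: algebra_simps)
    qed
    have VV: "norm (V y t - V z t) \<le> C * (G x ^ Suc n / fact (Suc n))" if t: "t \<in> {a..x}" for t
    proof -
      have tb: "t \<in> {a..b}" using t x by auto
      have I: "(\<lambda>t. P t * w t) integrable_on {a..t}" if "continuous_on {a..b} w" for w
        using ac_deriv_onD(3)[OF acV[OF that], of a t] tb by auto
      have "V y t - V z t = integral {a..t} (\<lambda>t. P t * y t - P t * z t)"
        unfolding V_def using I[OF cy] I[OF cz]
        by (simp add: Henstock_Kurzweil_Integration.integral_diff)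
      also have "norm \<dots> \<le> integral {a..t} (\<lambda>t. norm (P t) * (C * (G t ^ n / fact n)))"
      proof (rule integral_norm_bound_integral)
        show "(\<lambda>t. P t * y t - P t * z t) integrable_on {a..t}" by (intro integrable_diff I cy cz)
        show "(\<lambda>t. norm (P t) * (C * (G t ^ n / fact n))) integrable_on {a..t}" using GI[OF tb] by blast
        fix u assume "u \<in> {a..t}"
        then have "norm (y u - z u) \<le> C * (G u ^ n / fact n)" using tb by (intro le) auto
        then show "norm (P u * y u - P u * z u) \<le> norm (P u) * (C * (G u ^ n / fact n))"
          unfolding right_diff_distrib[symmetric] norm_mult by (intro mult_left_mono) auto
      qed
      also have "\<dots> = C * (G t ^ Suc n / fact (Suc n))" using GI[OF tb] by (rule integral_unique)
      also have "\<dots> \<le> C * (G x ^ Suc n / fact (Suc n))"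
      proof -
        have "0 \<le> G t" unfolding G_def
          by (intro integral_nonneg) (use tb in \<open>auto intro: integrable_on_subinterval[OF Pn]\<close>)
        moreover have "G t \<le> G x" unfolding G_def
          by (rule integral_subset_le) (use t x in \<open>auto intro: integrable_on_subinterval[OF Pn]\<close>)
        ultimately show ?thesis
          using \<open>C \<ge> 0\<close> by (intro mult_left_mono divide_right_mono power_mono) auto
      qed
      finally show ?thesis .
    qed
    have I: "V w integrable_on {a..x}" if "continuous_on {a..b} w" for w
      by (rule integrable_on_subinterval[OF integrable_continuous_real[OF cV[OF that]]]) (use x in auto)
    have "U y x - U z x = integral {a..x} (\<lambda>t. V y t - V z t)"
      unfolding U_def using I[OF cy] I[OF cz] by (simp add: Henstock_Kurzweil_Integration.integral_diff)
    also have "norm \<dots> \<le> integral {a..x} (\<lambda>t. C * (G x ^ Suc n / fact (Suc n)))"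
      by (rule integral_norm_bound_integral) (use VV I cy cz in \<open>auto intro!: integrable_diff\<close>)
    also have "\<dots> = (x - a) * (C * (G x ^ Suc n / fact (Suc n)))" using x by simp
    also have "\<dots> \<le> (b - a) * (C * (G x ^ Suc n / fact (Suc n)))"
    proof (rule mult_right_mono)
      have "0 \<le> G x" unfolding G_def
        by (intro integral_nonneg) (use x in \<open>auto intro: integrable_on_subinterval[OF Pn]\<close>)
      then show "0 \<le> C * (G x ^ Suc n / fact (Suc n))" using \<open>C \<ge> 0\<close> by auto
    qed (use x in auto)
    finally show ?thesis by (simp add: algebra_simps)
  qed
  define Y where "Y n = (U ^^ n) (\<lambda>x. 0)" for n
  have Ysuc: "Y (Suc n) = U (Y n)" for n by (simp add: Y_def)
  have cY: "continuous_on {a..b} (Y n)" for n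
  proof (induction n)
    case 0 show ?case by (simp add: Y_def)
  next
    case (Suc n) then show ?case using cU by (simp add: Ysuc)
  qed
  have "bounded (Y 1 ` {a..b})"
    by (intro compact_imp_bounded compact_continuous_image cY) auto
  then obtain M where M: "\<And>x. x \<in> {a..b} \<Longrightarrow> norm (Y 1 x) \<le> M"
    unfolding bounded_iff by (metis image_eqI)
  have "M \<ge> 0" using order_trans[OF norm_ge_zero M[of a]] ab by simp
  have D: "norm (Y (Suc n) x - Y n x) \<le> (M * (b - a) ^ n) * (G x ^ n / fact n)" if "x \<in> {a..b}" for n x
    using that
  proof (induction n arbitrary: x)
    case 0 then show ?case using M by (simp add: Y_def)
  next
    case (Suc n)
    have "norm (U (Y (Suc n)) x - U (Y n) x) \<le> ((M * (b - a) ^ n) * (b - a)) * (G x ^ Suc n / fact (Suc n))"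
      by (rule step[OF cY cY _ Suc.IH Suc.prems]) (use \<open>M \<ge> 0\<close> ab in auto)
    then show ?case by (simp add: Ysuc algebra_simps)
  qed
  define B where "B n = M * (((b - a) * G b) ^ n / fact n)" for n
  have DB: "norm (Y (Suc n) x - Y n x) \<le> B n" if x: "x \<in> {a..b}" for n x
  proof -
    have "0 \<le> G x" unfolding G_def
      by (intro integral_nonneg) (use x in \<open>auto intro: integrable_on_subinterval[OF Pn]\<close>)
    moreover have "G x \<le> G b" unfolding G_def
      by (rule integral_subset_le) (use x in \<open>auto intro: integrable_on_subinterval[OF Pn]\<close>)
    ultimately have "(M * (b - a) ^ n) * (G x ^ n / fact n) \<le> (M * (b - a) ^ n) * (G b ^ n / fact n)"
      using \<open>M \<ge> 0\<close> ab by (intro mult_left_mono divide_right_mono power_mono) auto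
    then show ?thesis using D[OF x, of n] by (simp add: B_def power_mult_distrib)
  qed
  have "summable B"
    unfolding B_def using exp_converges[of "(b - a) * G b"]
    by (intro summable_mult) (auto simp: field_simps scaleR_conv_of_real sums_iff)
  define y where "y x = (\<Sum>i. Y (Suc i) x - Y i x)" for x
  have "uniform_limit {a..b} (\<lambda>n x. \<Sum>i<n. Y (Suc i) x - Y i x) y sequentially"
    unfolding y_def by (rule Weierstrass_m_test[OF DB \<open>summable B\<close>])
  moreover have "(\<Sum>i<n. Y (Suc i) x - Y i x) = Y n x" for n x
    by (subst sum_lessThan_telescope) (simp add: Y_def)
  ultimately have ul: "uniform_limit {a..b} (\<lambda>n. Y n) y sequentially" by simp
  have cy: "continuous_on {a..b} y"
    by (rule uniform_limit_theorem[OF _ ul]) (use cY in auto)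
  have fp: "y x = U y x" if x: "x \<in> {a..b}" for x
  proof -
    have lim: "(\<lambda>n. Y n x) \<longlonglongrightarrow> y x" using tendsto_uniform_limitI[OF ul x] .
    \<comment> \<open>The case \<open>n = 0\<close> of \<open>step\<close>, with weight 1, says that
      \<open>U\<close> is Lipschitz for the supremum norm, with constant \<open>K\<close> at
      \<open>x\<close>.\<close>
    have "(\<lambda>n. Y (Suc n) x) \<longlonglongrightarrow> U y x"
    proof (rule metric_LIMSEQ_I)
      fix e :: real assume "e > 0"
      define K where "K = (b - a) * (G x ^ Suc 0 / fact (Suc 0))"
      have "K \<ge> 0" unfolding K_def G_def
        using x by (auto intro!: mult_nonneg_nonneg integral_nonneg intro: integrable_on_subinterval[OF Pn])
      define e' where "e' = e / (K + 1)"
      have "e' > 0" using \<open>e > 0\<close> \<open>K \<ge> 0\<close> by (simp add: e'_def)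
      then obtain N where N: "\<And>n t. n \<ge> N \<Longrightarrow> t \<in> {a..b} \<Longrightarrow> dist (Y n t) (y t) < e'"
        using ul unfolding uniform_limit_sequentially_iff by metis
      show "\<exists>N. \<forall>n\<ge>N. dist (Y (Suc n) x) (U y x) < e"
      proof (intro exI allI impI)
        fix n assume "n \<ge> N"
        have "norm (U (Y n) x - U y x) \<le> (e' * (b - a)) * (G x ^ Suc 0 / fact (Suc 0))"
        proof (rule step[OF cY cy _ _ x])
          fix t assume "t \<in> {a..b}"
          then show "norm (Y n t - y t) \<le> e' * (G t ^ 0 / fact 0)"
            using N[OF \<open>n \<ge> N\<close>, of t] by (simp add: dist_norm)
        qed (use \<open>e' > 0\<close> in auto)
        also have "\<dots> = e' * K" by (simp add: K_def)
        also have "\<dots> < e" using \<open>e > 0\<close> \<open>K \<ge> 0\<close> by (simp add: e'_def field_simps)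
        finally show "dist (Y (Suc n) x) (U y x) < e" by (simp add: Ysuc dist_norm)
      qed
    qed
    moreover have "(\<lambda>n. Y (Suc n) x) \<longlonglongrightarrow> y x" using lim by (rule LIMSEQ_Suc)
    ultimately show ?thesis using LIMSEQ_unique by blast
  qed
  \<comment> \<open>The pair \<open>(U y, V y)\<close> is used in place of \<open>y\<close> because
    its derivatives are known by construction; only the term \<open>P * y\<close> has to be
    rewritten by the fixed point equation.\<close>
  have "sol P a b (U y) (V y)"
    unfolding sol_def
  proof (intro conjI ballI dU cy)
    have "ac_deriv_on {a..b} (V y) (\<lambda>t. P t * y t)" by (rule acV[OF cy])
    then show "ac_deriv_on {a..b} (V y) (\<lambda>x. P x * U y x)"
      by (rule ac_deriv_on_cong) (use fp in auto)
  qed auto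
  moreover have "U y a = y0" "V y a = y1" by (auto simp: U_def V_def)
  ultimately show ?thesis by blast
qed

text \<open>The solution with Cauchy data at the right end point is a combination of the two
  fundamental solutions at the left one, whose Wronskian is 1.\<close>

lemma sol_exists_right:
  assumes P: "P absolutely_integrable_on {a..b}" and ab: "a \<le> b"
  shows "\<exists>y dy. sol P a b y dy \<and> y b = y0 \<and> dy b = y1"
proof -
  obtain c dc where c: "sol P a b c dc" "c a = 1" "dc a = 0" using sol_exists[OF assms] by blast
  obtain s ds where s: "sol P a b s ds" "s a = 0" "ds a = 1" using sol_exists[OF assms] by blast
  have W: "c b * ds b - dc b * s b = 1"
    using sol_wronskian[OF c(1) s(1), of b a] c s ab by auto
  let ?A = "y0 * ds b - y1 * s b" and ?B = "y1 * c b - y0 * dc b"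
  have "sol P a b (\<lambda>x. ?A * c x + ?B * s x) (\<lambda>x. ?A * dc x + ?B * ds x)"
    by (rule sol_lincomb[OF c(1) s(1)])
  moreover have "?A * c b + ?B * s b = y0 * (c b * ds b - dc b * s b)" by (simp add: algebra_simps)
  moreover have "?A * dc b + ?B * ds b = y1 * (c b * ds b - dc b * s b)" by (simp add: algebra_simps)
  ultimately show ?thesis using W by (intro exI conjI) (assumption, simp_all)
qed

section \<open>Entire functions of order at most 1/2\<close>

text \<open>The constants are nonnegative so that two such bounds can be added and multiplied by
  monotonicity; \<open>order_halfI\<close> provides this from arbitrary real constants.\<close>

definition order_half :: "(complex \<Rightarrow> complex) \<Rightarrow> bool" where
  "order_half F \<longleftrightarrow> (\<exists>A B. A \<ge> 0 \<and> B \<ge> 0 \<and> (\<forall>z. norm (F z) \<le> A * exp (B * sqrt (norm z))))"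

lemma order_halfI:
  assumes "\<And>z. norm (F z) \<le> A * exp (B * sqrt (norm z))"
  shows "order_half F"
  unfolding order_half_def
proof (intro exI conjI allI)
  fix z
  have "norm (F z) \<le> A * exp (B * sqrt (norm z))" by (rule assms)
  also have "\<dots> \<le> max A 0 * exp (max B 0 * sqrt (norm z))"
    by (intro mult_mono) (auto intro!: mult_right_mono)
  finally show "norm (F z) \<le> max A 0 * exp (max B 0 * sqrt (norm z))" .
qed auto

section \<open>Closure properties of the growth class\<close>

lemma order_half_mult:
  assumes "order_half F" "order_half G"
  shows "order_half (\<lambda>z. F z * G z)"
proof -
  obtain A B where F: "A \<ge> 0" "\<And>z. norm (F z) \<le> A * exp (B * sqrt (norm z))"
    using assms(1) unfolding order_half_def by blast
  obtain C D where G: "C \<ge> 0" "\<And>z. norm (G z) \<le> C * exp (D * sqrt (norm z))"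
    using assms(2) unfolding order_half_def by blast
  show ?thesis
  proof (rule order_halfI)
    fix z
    have "norm (F z * G z) \<le> (A * exp (B * sqrt (norm z))) * (C * exp (D * sqrt (norm z)))"
      unfolding norm_mult using F G by (intro mult_mono) auto
    also have "\<dots> = (A * C) * exp ((B + D) * sqrt (norm z))"
      by (simp add: algebra_simps exp_add)
    finally show "norm (F z * G z) \<le> (A * C) * exp ((B + D) * sqrt (norm z))" .
  qed
qed

lemma order_half_add:
  assumes "order_half F" "order_half G"
  shows "order_half (\<lambda>z. F z + G z)"
proof -
  obtain A B where F: "A \<ge> 0" "B \<ge> 0" "\<And>z. norm (F z) \<le> A * exp (B * sqrt (norm z))"
    using assms(1) unfolding order_half_def by blast
  obtain C D where G: "C \<ge> 0" "D \<ge> 0" "\<And>z. norm (G z) \<le> C * exp (D * sqrt (norm z))"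
    using assms(2) unfolding order_half_def by blast
  show ?thesis
  proof (rule order_halfI)
    fix z
    have "norm (F z + G z) \<le> A * exp (B * sqrt (norm z)) + C * exp (D * sqrt (norm z))"
      using F(3)[of z] G(3)[of z] norm_triangle_ineq[of "F z" "G z"] by linarith
    also have "\<dots> \<le> A * exp ((B + D) * sqrt (norm z)) + C * exp ((B + D) * sqrt (norm z))"
      using F G by (intro add_mono mult_left_mono) (auto intro!: mult_right_mono)
    also have "\<dots> = (A + C) * exp ((B + D) * sqrt (norm z))"
      by (simp add: algebra_simps)
    finally show "norm (F z + G z) \<le> (A + C) * exp ((B + D) * sqrt (norm z))" .
  qed
qed

lemma order_half_const: "order_half (\<lambda>z. c)"
  by (rule order_halfI[of _ "norm c" 0]) simp

lemma order_half_cmult: "order_half F \<Longrightarrow> order_half (\<lambda>z. c * F z)"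
  by (intro order_half_mult order_half_const)

lemma order_half_diff:
  assumes "order_half F" "order_half G"
  shows "order_half (\<lambda>z. F z - G z)"
  using order_half_add[OF assms(1) order_half_cmult[OF assms(2), of "-1"]] by simp

lemma order_half_linear: "order_half (\<lambda>z. z - a)"
proof (rule order_halfI)
  fix z :: complex
  define s where "s = sqrt (norm z)"
  have s: "s \<ge> 0" "norm z = s\<^sup>2" by (auto simp: s_def)
  have "norm z \<le> exp (2 * s)"
  proof -
    have "s \<le> exp s" using exp_ge_add_one_self[of s] by linarith
    then have "s * s \<le> exp s * exp s" using s by (intro mult_mono) auto
    then show ?thesis using s by (simp add: power2_eq_square exp_add[symmetric])
  qed
  moreover have "norm a \<le> norm a * exp (2 * s)"
    using s by (simp add: mult_le_cancel_left1)
  ultimately have "norm (z - a) \<le> exp (2 * s) + norm a * exp (2 * s)"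
    using norm_triangle_ineq4[of z a] by linarith
  then show "norm (z - a) \<le> (1 + norm a) * exp (2 * sqrt (norm z))"
    by (simp add: s_def algebra_simps)
qed

lemma order_half_prod_linear:
  "order_half (\<lambda>z. \<Prod>n\<in>S. z - a n)"
  by (induction S rule: infinite_finite_induct)
     (auto intro: order_half_const order_half_mult order_half_linear)

text \<open>The square root is subadditive. The shift is needed because the quotient theorem below
  assumes that the denominator does not vanish at the origin.\<close>

lemma order_half_shift:
  assumes "order_half F"
  shows "order_half (\<lambda>z. F (z + w))"
proof -
  obtain A B where F: "A \<ge> 0" "B \<ge> 0" "\<And>z. norm (F z) \<le> A * exp (B * sqrt (norm z))"
    using assms(1) unfolding order_half_def by blast
  show ?thesis
  proof (rule order_halfI)
    fix z
    have "sqrt (norm (z + w)) \<le> sqrt (norm z + norm w)" by (simp add: norm_triangle_ineq)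
    also have "\<dots> \<le> sqrt (norm z) + sqrt (norm w)" by (rule sqrt_add_le_add_sqrt) auto
    finally have "exp (B * sqrt (norm (z + w))) \<le> exp (B * (sqrt (norm z) + sqrt (norm w)))"
      using F by (auto intro: mult_left_mono)
    then have "norm (F (z + w)) \<le> A * exp (B * (sqrt (norm z) + sqrt (norm w)))"
      using F by (meson mult_left_mono order_trans)
    then show "norm (F (z + w)) \<le> (A * exp (B * sqrt (norm w))) * exp (B * sqrt (norm z))"
      by (simp add: algebra_simps exp_add)
  qed
qed

lemma order_half_uminus_arg:
  assumes "order_half F"
  shows "order_half (\<lambda>z. F (- z))"
  using assms unfolding order_half_def by (metis norm_minus_cancel)

text \<open>\<open>F\<close> is multiplied by \<open>exp (- e * k z)\<close> with
  \<open>k z = (z + 1) powr (3/4)\<close>. The exponent 3/4 lies above 1/2, so that the factor beats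
  the growth of \<open>F\<close> on large arcs, and below 1, so that the real part of
  \<open>k\<close> stays positive up to the boundary of the half plane. The maximum principle on a
  half disc gives the bound, and then \<open>e\<close> tends to 0.\<close>

lemma phragmen_lindelof_half_plane:
  assumes hol: "F holomorphic_on UNIV" and gr: "order_half F" and K: "K > 0"
    and bd: "\<And>t::real. norm (F (\<i> * of_real t)) \<le> K" and z: "Re z \<ge> 0"
  shows "norm (F z) \<le> K"
proof -
  obtain A B where F: "A \<ge> 0" "B \<ge> 0" "\<And>z. norm (F z) \<le> A * exp (B * sqrt (norm z))"
    using gr unfolding order_half_def by blast
  \<comment> \<open>The shift by 1 keeps the branch cut of \<open>Ln\<close> outside a neighbourhood
    of the closed half plane. There the argument of \<open>z + 1\<close> is below
    \<open>pi/2\<close> in modulus, whence the constant \<open>cos (3 * pi / 8)\<close>.\<close>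
  define k where "k z = exp ((3/4) * Ln (z + 1))" for z :: complex
  define c where "c = cos (3 * pi / 8)"
  have "c > 0" unfolding c_def by (rule cos_gt_zero_pi) (use pi_gt_zero in linarith)+
  have Rek: "Re (k z) \<ge> c * norm z powr (3/4)" if "Re z \<ge> 0" for z
  proof -
    have z1: "Re (z + 1) > 0" using that by simp
    then have nz: "z + 1 \<noteq> 0" by (metis less_irrefl zero_complex.sel(1))
    have a: "\<bar>Im (Ln (z + 1))\<bar> < pi / 2" using z1 by (rule Re_Ln_pos_lt_imp)
    have eq: "Re (k z) = exp (3/4 * ln (norm (z + 1))) * cos (3/4 * Im (Ln (z + 1)))"
      unfolding k_def using nz by (simp add: Re_exp)
    have "cos (3/4 * Im (Ln (z + 1))) = cos \<bar>3/4 * Im (Ln (z + 1))\<bar>" by (rule cos_abs_real[symmetric])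
    also have "\<dots> \<ge> c" unfolding c_def
      by (rule cos_monotone_0_pi_le) (use a pi_gt_zero in \<open>auto simp: abs_mult\<close>)
    finally (xtrans) have "cos (3/4 * Im (Ln (z + 1))) \<ge> c" .
    then have 1: "Re (k z) \<ge> exp (3/4 * ln (norm (z + 1))) * c"
      unfolding eq by (intro mult_left_mono) auto
    have "norm z \<le> norm (z + 1)"
    proof -
      have "(norm z)\<^sup>2 \<le> (norm (z + 1))\<^sup>2"
        unfolding cmod_power2 using that by (simp add: power2_eq_square algebra_simps)
      then show ?thesis by (rule power2_le_imp_le) simp
    qed
    then have "norm z powr (3/4) \<le> norm (z + 1) powr (3/4)" by (intro powr_mono2) auto
    also have "\<dots> = exp (3/4 * ln (norm (z + 1)))" using nz by (simp add: powr_def)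
    finally show ?thesis using 1 \<open>c > 0\<close>
      by (smt (verit, best) mult.commute mult_left_mono)
  qed
  have main: "norm (F z) * exp (- e * Re (k z)) \<le> K" if "e > 0" for e
  proof -
    have "((\<lambda>R. A * exp (B * sqrt R - (e * c) * R powr (3/4))) \<longlongrightarrow> 0) at_top"
      using \<open>e > 0\<close> \<open>c > 0\<close> by real_asymp
    then have "eventually (\<lambda>R. A * exp (B * sqrt R - (e * c) * R powr (3/4)) < K) at_top"
      using \<open>K > 0\<close> by (rule order_tendstoD)
    then have "eventually (\<lambda>R. A * exp (B * sqrt R - (e * c) * R powr (3/4)) < K \<and> R \<ge> norm z) at_top"
      using eventually_ge_at_top by (rule eventually_conj)
    then obtain R where R: "A * exp (B * sqrt R - (e * c) * R powr (3/4)) < K" "R \<ge> norm z"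
      using eventually_happens'[OF trivial_limit_at_top_linorder] by blast
    define g where "g z = F z * exp (- of_real e * k z)" for z
    have ng: "norm (g z) = norm (F z) * exp (- e * Re (k z))" for z
      by (simp add: g_def norm_mult)
    let ?S = "{z. Re z \<ge> 0} \<inter> cball 0 R"
    have hF: "F holomorphic_on {z. Re z > -1}" by (rule holomorphic_on_subset[OF hol]) simp
    have "z + 1 \<notin> \<real>\<^sub>\<le>\<^sub>0" if "Re z > -1" for z :: complex
      using that by (simp add: complex_nonpos_Reals_iff)
    then have hk: "k holomorphic_on {z. Re z > -1}"
      unfolding k_def by (intro holomorphic_intros) auto
    have "g holomorphic_on {z. Re z > -1}"
      unfolding g_def by (intro holomorphic_intros hF hk)
    then have holS: "g holomorphic_on ?S" by (rule holomorphic_on_subset) auto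
    have clS: "closed ?S" by (intro closed_Int closed_halfspace_Re_ge closed_cball)
    have "norm (g z) \<le> K"
    proof (rule maximum_modulus_frontier[where S = ?S and f = g])
      show "g holomorphic_on interior ?S" by (rule holomorphic_on_subset[OF holS interior_subset])
      show "continuous_on (closure ?S) g"
        using holS clS by (simp add: holomorphic_on_imp_continuous_on)
      show "z \<in> ?S" using z R by auto
      fix w assume w: "w \<in> frontier ?S"
      have "frontier ?S \<subseteq> ?S" using clS by (rule frontier_subset_closed)
      with w have wS: "Re w \<ge> 0" "norm w \<le> R" by auto
      have "Re w = 0 \<or> norm w = R"
      proof (rule ccontr)
        assume "\<not> (Re w = 0 \<or> norm w = R)"
        then have "w \<in> {z. Re z > 0} \<inter> ball 0 R" using wS by auto
        moreover have "{z. Re z > 0} \<inter> ball 0 R \<subseteq> interior ?S"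
          by (intro interior_maximal open_Int open_halfspace_Re_gt open_ball) auto
        ultimately show False using w by (auto simp: frontier_def)
      qed
      then show "norm (g w) \<le> K"
      proof
        assume "Re w = 0"
        then have "w = \<i> * of_real (Im w)" by (simp add: complex_eq_iff)
        then have "norm (F w) \<le> K" using bd by metis
        moreover have "Re (k w) \<ge> 0"
          using Rek[OF wS(1)] \<open>c > 0\<close> by (smt (verit) mult_nonneg_nonneg powr_ge_zero)
        then have "exp (- e * Re (k w)) \<le> 1" using \<open>e > 0\<close> by simp
        ultimately have "norm (F w) * exp (- e * Re (k w)) \<le> K * 1"
          using K by (intro mult_mono) auto
        then show ?thesis by (simp add: ng)
      next
        assume w: "norm w = R"
        have "e * (c * norm w powr (3/4)) \<le> e * Re (k w)"
          using Rek[OF wS(1)] \<open>e > 0\<close> by (intro mult_left_mono) auto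
        then have "norm (F w) * exp (- e * Re (k w)) \<le> (A * exp (B * sqrt R)) * exp (- (e * c) * R powr (3/4))"
          using F w by (intro mult_mono) (auto simp: algebra_simps)
        also have "\<dots> = A * exp (B * sqrt R - (e * c) * R powr (3/4))" by (simp add: exp_diff exp_minus field_simps)
        finally show ?thesis using R by (simp add: ng)
      qed
    qed (auto intro: bounded_Int)
    then show ?thesis by (simp add: ng)
  qed
  have "((\<lambda>e. norm (F z) * exp (- e * Re (k z))) \<longlongrightarrow> norm (F z) * exp (- 0 * Re (k z))) (at_right 0)"
    by (intro tendsto_intros)
  then have "norm (F z) * exp (- 0 * Re (k z)) \<le> K"
    by (rule tendsto_upperbound) (use main in \<open>auto simp: eventually_at_right_less intro: eventually_at_rightI[of 0 1]\<close>)
  then show ?thesis by simp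
qed

text \<open>The two limits and compactness bound \<open>F\<close> on the imaginary axis, hence in
  both half planes by the preceding lemma. By Liouville's theorem \<open>F\<close> is constant, and
  the constant is the limit 0.\<close>

lemma order_half_eq_0:
  assumes hol: "F holomorphic_on UNIV" and gr: "order_half F"
    and l1: "((\<lambda>t. F (\<i> * of_real t)) \<longlongrightarrow> 0) at_top" and l2: "((\<lambda>t. F (\<i> * of_real (- t))) \<longlongrightarrow> 0) at_top"
  shows "F z = 0"
proof -
  have cF: "continuous_on UNIV F" using hol holomorphic_on_imp_continuous_on by blast
  have "eventually (\<lambda>t. norm (F (\<i> * of_real t)) < 1 \<and> norm (F (\<i> * of_real (- t))) < 1) at_top"
    using tendstoD[OF l1, of 1] tendstoD[OF l2, of 1] by (intro eventually_conj) auto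
  then obtain T where T: "\<And>t. t \<ge> T \<Longrightarrow> norm (F (\<i> * of_real t)) < 1 \<and> norm (F (\<i> * of_real (- t))) < 1"
    unfolding eventually_at_top_linorder by blast
  have "bounded ((\<lambda>t. F (\<i> * of_real t)) ` {-\<bar>T\<bar>..\<bar>T\<bar>})"
    by (intro compact_imp_bounded compact_continuous_image continuous_on_compose2[OF cF] continuous_intros) auto
  then obtain M where M: "\<And>t. t \<in> {-\<bar>T\<bar>..\<bar>T\<bar>} \<Longrightarrow> norm (F (\<i> * of_real t)) \<le> M"
    unfolding bounded_iff by (metis image_eqI)
  have bd: "norm (F (\<i> * of_real t)) \<le> \<bar>M\<bar> + 1" for t
  proof (cases "t \<in> {-\<bar>T\<bar>..\<bar>T\<bar>}")
    case True then show ?thesis using M[of t] by auto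
  next
    case False
    then have "t \<ge> T \<or> - t \<ge> T" by auto
    then have "norm (F (\<i> * of_real t)) < 1" using T[of t] T[of "-t"] by auto
    then show ?thesis by auto
  qed
  have "norm (F z) \<le> \<bar>M\<bar> + 1" for z
  proof (cases "Re z \<ge> 0")
    case True
    show ?thesis by (rule phragmen_lindelof_half_plane[OF hol gr _ bd True]) auto
  next
    case False
    have "norm (F (- (- z))) \<le> \<bar>M\<bar> + 1"
    proof (rule phragmen_lindelof_half_plane[where F = "\<lambda>z. F (- z)"])
      show "(\<lambda>z. F (- z)) holomorphic_on UNIV"
        using holomorphic_on_compose_gen[OF holomorphic_on_minus[OF holomorphic_on_ident] hol, of UNIV] by (simp add: o_def)
      show "order_half (\<lambda>z. F (- z))" by (rule order_half_uminus_arg[OF gr])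
      fix t show "norm (F (- (\<i> * complex_of_real t))) \<le> \<bar>M\<bar> + 1" using bd[of "-t"] by simp
    qed (use False in auto)
    then show ?thesis by simp
  qed
  then have "bounded (range F)" unfolding bounded_iff by auto
  then obtain c where c: "\<And>z. F z = c"
    using Liouville_theorem[OF hol] unfolding constant_on_def by auto
  then have "((\<lambda>t::real. c) \<longlongrightarrow> 0) at_top" using l1 by simp
  then have "c = 0" using tendsto_const_iff[of "at_top::real filter" c 0] by simp
  then show ?thesis using c by simp
qed

text \<open>The Moebius map from \<open>w\<close> to \<open>w / (2 * M - w)\<close> sends the half
  plane \<open>Re w < M\<close> into the unit disc and fixes 0, so Schwarz's lemma applies to its
  composition with \<open>G\<close> after scaling.\<close>

lemma borel_caratheodory:
  assumes hol: "G holomorphic_on ball 0 R" and G0: "G 0 = 0"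
    and re: "\<And>z. norm z < R \<Longrightarrow> Re (G z) < M" and z: "norm z < R"
  shows "norm (G z) \<le> 2 * M * norm z / (R - norm z)"
proof -
  have "R > 0" using z norm_ge_zero by (metis le_less_trans)
  then have "M > 0" using re[of 0] G0 by simp
  define h where "h w = G (of_real R * w) / (2 * of_real M - G (of_real R * w))" for w
  have nz: "2 * of_real M - G w \<noteq> 0" if "norm w < R" for w
    using re[OF that] \<open>M > 0\<close> by (auto simp: complex_eq_iff)
  have "norm (h (z / of_real R)) \<le> norm (z / of_real R)"
  proof (rule Schwarz_Lemma(1))
    have "(\<lambda>w. G (of_real R * w)) holomorphic_on ball 0 1"
    proof -
      have "(G \<circ> (\<lambda>w. of_real R * w)) holomorphic_on ball 0 1"
        by (rule holomorphic_on_compose_gen[OF _ hol])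
           (use \<open>R > 0\<close> in \<open>auto simp: norm_mult intro!: holomorphic_intros\<close>)
      then show ?thesis by (simp add: o_def)
    qed
    then show "h holomorphic_on ball 0 1" unfolding h_def
      using nz \<open>R > 0\<close> by (intro holomorphic_intros) (auto simp: norm_mult)
    show "h 0 = 0" by (simp add: h_def G0)
    fix w :: complex assume "norm w < 1"
    then have w: "norm (of_real R * w) < R" using \<open>R > 0\<close> by (simp add: norm_mult)
    have "norm (G (of_real R * w)) < norm (2 * of_real M - G (of_real R * w))"
    proof (rule power2_less_imp_less)
      have "M * Re (G (of_real R * w)) < M * M" using re[OF w] \<open>M > 0\<close> by simp
      then show "(norm (G (of_real R * w)))\<^sup>2 < (norm (2 * of_real M - G (of_real R * w)))\<^sup>2"
        unfolding cmod_power2 by (simp add: power2_eq_square algebra_simps)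
    qed auto
    then show "norm (h w) < 1" using nz[OF w] by (simp add: h_def norm_divide)
  qed (use z \<open>R > 0\<close> in \<open>auto simp: norm_divide\<close>)
  then have "norm (G z / (2 * of_real M - G z)) \<le> norm z / R"
    using \<open>R > 0\<close> by (simp add: h_def norm_divide)
  then have "norm (G z) * R \<le> norm z * norm (2 * of_real M - G z)"
    using nz[OF z] \<open>R > 0\<close> by (simp add: norm_divide field_simps)
  also have "norm (2 * of_real M - G z) \<le> 2 * M + norm (G z)"
    using norm_triangle_ineq4[of "2 * of_real M" "G z"] \<open>M > 0\<close> by (simp add: norm_mult)
  finally have "norm (G z) * R \<le> norm z * (2 * M + norm (G z))" by (simp add: mult_left_mono)
  then show ?thesis using z by (simp add: field_simps)
qed

text \<open>The radius \<open>3 * R\<close> is chosen for these two bounds: each factor is at least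
  \<open>2 * R\<close> on the outer circle and at most \<open>R\<close> at the origin, which is a
  gain of 2 per zero.\<close>

lemma prod_list_linear_bounds:
  fixes as :: "complex list"
  assumes "\<And>a. a \<in> set as \<Longrightarrow> norm a \<le> R" "R > 0"
  shows "norm (\<Prod>a\<leftarrow>as. 0 - a) \<le> R ^ length as"
    and "norm z = 3 * R \<Longrightarrow> (2 * R) ^ length as \<le> norm (\<Prod>a\<leftarrow>as. z - a)"
proof -
  show "norm (\<Prod>a\<leftarrow>as. 0 - a) \<le> R ^ length as"
    using assms by (induction as) (auto simp: norm_mult intro!: mult_mono)
  assume z: "norm z = 3 * R"
  have "2 * R \<le> norm (z - a)" if "norm a \<le> R" for a
    using norm_triangle_ineq2[of z a] z that by linarith
  then show "(2 * R) ^ length as \<le> norm (\<Prod>a\<leftarrow>as. z - a)"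
    using assms by (induction as) (auto simp: norm_mult intro!: mult_mono)
qed

text \<open>The maximum principle for \<open>k\<close> on the disc of radius \<open>3 * R\<close>.
  The result is stated in product form, without division by \<open>f 0\<close>; its factor 2 per
  zero bounds the number of zeros, and for the other estimates it is simply at least 1.\<close>

lemma deflated_bound:
  assumes hol: "k holomorphic_on UNIV" and f: "\<And>z. f z = (\<Prod>a\<leftarrow>as. z - a) * k z"
    and as: "\<And>a. a \<in> set as \<Longrightarrow> norm a \<le> R" and R: "R > 0"
    and M: "\<And>z. norm z = 3 * R \<Longrightarrow> norm (f z) \<le> M" and z: "norm z \<le> 3 * R"
  shows "norm (k z) * (norm (f 0) * 2 ^ length as) \<le> M * norm (k 0)"
proof -
  let ?n = "length as"
  have kb: "norm (k z) \<le> M / (2 * R) ^ ?n"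
  proof (rule maximum_modulus_frontier[where S = "cball 0 (3 * R)" and f = k])
    fix w assume "w \<in> frontier (cball (0::complex) (3 * R))"
    then have w: "norm w = 3 * R" using R by (simp add: frontier_cball)
    have "(2 * R) ^ ?n * norm (k w) \<le> norm (f w)"
      unfolding f norm_mult using prod_list_linear_bounds(2)[of as R w] as R w by (intro mult_right_mono) auto
    then show "norm (k w) \<le> M / (2 * R) ^ ?n" using M[OF w] R by (simp add: field_simps)
  qed (use hol z in \<open>auto intro: holomorphic_on_subset holomorphic_on_imp_continuous_on continuous_on_subset\<close>)
  have "norm (f 0) \<le> R ^ ?n * norm (k 0)"
    unfolding f norm_mult using prod_list_linear_bounds(1)[of as R] as R by (intro mult_right_mono norm_ge_zero) blast
  then have "norm (k z) * (norm (f 0) * 2 ^ ?n) \<le> (M / (2 * R) ^ ?n) * ((R ^ ?n * norm (k 0)) * 2 ^ ?n)"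
  proof (intro mult_mono kb mult_right_mono)
    show "0 \<le> M / (2 * R) ^ ?n" using kb norm_ge_zero order_trans by blast
  qed (use R in auto)
  also have "\<dots> = M * norm (k 0)" using R by (simp add: field_simps power_mult_distrib)
  finally show ?thesis .
qed

text \<open>Zeros are split off one at a time; this ends because, by the maximum principle on the disc
  of radius \<open>3 R\<close>, a function bounded by \<open>M\<close> there with \<open>k\<close> zeros in the disc of radius \<open>R\<close>
  satisfies \<open>2 ^ k * norm (g 0) \<le> M\<close>.\<close>

lemma deflate_zeros:
  assumes hol: "g holomorphic_on UNIV" and g0: "g 0 \<noteq> 0" and R: "R > 0"
  obtains as k where "k holomorphic_on UNIV" "\<And>z. g z = (\<Prod>a\<leftarrow>as. z - a) * k z"
    "\<And>a. a \<in> set as \<Longrightarrow> norm a \<le> R" "\<And>z. norm z \<le> R \<Longrightarrow> k z \<noteq> 0"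
proof -
  \<comment> \<open>\<open>Q n\<close> says that \<open>n\<close> zeros in the closed disc can be
    split off. For the largest such \<open>n\<close>, a further zero of the remaining factor in the
    disc would allow \<open>n + 1\<close>.\<close>
  define Q where "Q n \<longleftrightarrow> (\<exists>as k. length as = n \<and> k holomorphic_on UNIV \<and> (\<forall>z. g z = (\<Prod>a\<leftarrow>as. z - a) * k z) \<and>
     (\<forall>a\<in>set as. norm a \<le> R))" for n
  have "bounded (g ` cball 0 (3 * R))"
    by (intro compact_imp_bounded compact_continuous_image holomorphic_on_imp_continuous_on
        holomorphic_on_subset[OF hol]) auto
  then obtain M where M: "\<And>z. norm z \<le> 3 * R \<Longrightarrow> norm (g z) \<le> M"
    unfolding bounded_iff by (metis image_eqI mem_cball_0)
  obtain N :: nat where N: "M / norm (g 0) < 2 ^ N"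
    using real_arch_pow[of 2] by auto
  have Qb: "n \<le> N" if "Q n" for n
  proof (rule ccontr)
    assume "\<not> n \<le> N"
    obtain as k where ak: "length as = n" "k holomorphic_on UNIV" "\<And>z. g z = (\<Prod>a\<leftarrow>as. z - a) * k z"
      "\<And>a. a\<in>set as \<Longrightarrow> norm a \<le> R" using \<open>Q n\<close> unfolding Q_def by blast
    have "norm (k 0) * (norm (g 0) * 2 ^ n) \<le> M * norm (k 0)"
      using deflated_bound[OF ak(2,3,4) R, of M 0] M R ak(1) by auto
    moreover have "k 0 \<noteq> 0" using ak(3)[of 0] g0 by auto
    ultimately have "2 ^ n \<le> M / norm (g 0)" using g0 by (simp add: field_simps)
    moreover have "(2::real) ^ N \<le> 2 ^ n" using \<open>\<not> n \<le> N\<close> by (intro power_increasing) auto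
    ultimately show False using N by linarith
  qed
  have "Q 0" unfolding Q_def using hol by (intro exI[of _ "[]"] exI[of _ g]) auto
  define n where "n = Max {n. Q n}"
  have fin: "finite {n. Q n}" using Qb by (intro finite_subset[of "{n. Q n}" "{..N}"]) auto
  have "Q n" using Max_in[OF fin] \<open>Q 0\<close> unfolding n_def by blast
  have "\<not> Q (Suc n)" using Max_ge[OF fin, of "Suc n"] unfolding n_def by auto
  obtain as k where ak: "length as = n" "k holomorphic_on UNIV" "\<And>z. g z = (\<Prod>a\<leftarrow>as. z - a) * k z"
    "\<And>a. a\<in>set as \<Longrightarrow> norm a \<le> R" using \<open>Q n\<close> unfolding Q_def by blast
  have "k a \<noteq> 0" if "norm a \<le> R" for a
  proof
    assume ka: "k a = 0"
    define k' where "k' z = (if z = a then deriv k a else (k z - k a) / (z - a))" for z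
    have "k' holomorphic_on UNIV" unfolding k'_def by (rule pole_lemma_open[OF ak(2)]) auto
    moreover have "g z = (\<Prod>a\<leftarrow>a # as. z - a) * k' z" for z
      using ak(3)[of z] ka by (auto simp: k'_def)
    ultimately have "Q (Suc n)" unfolding Q_def using ak that
      by (intro exI[of _ "a # as"] exI[of _ k']) auto
    with \<open>\<not> Q (Suc n)\<close> show False by blast
  qed
  with ak that show ?thesis by blast
qed

text \<open>The bound must not depend on how many zeros lie in the disc. The functions
  \<open>g\<close> and \<open>h * g\<close> are deflated by the same linear factors, so
  \<open>k\<close> and \<open>h * k\<close> are both bounded above; the zero-free \<open>k\<close>
  also has a lower bound on the half disc through its logarithm, and
  \<open>h = (h * k) / k\<close>.\<close>

lemma zero_free_quotient_bound:
  assumes hol: "h holomorphic_on UNIV" "g holomorphic_on UNIV" and g0: "g 0 \<noteq> 0" and h0: "h 0 \<noteq> 0"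
    and R: "R > 0"
    and M: "\<And>z. norm z = 3 * R \<Longrightarrow> norm (h z * g z) \<le> M" "\<And>z. norm z = 3 * R \<Longrightarrow> norm (g z) \<le> N"
    and z: "norm z \<le> R / 2" and N: "N \<ge> norm (g 0)"
  shows "norm (h z) \<le> exp 2 * M * N ^ 2 / norm (g 0) ^ 3"
proof -
  obtain k as where ak: "k holomorphic_on UNIV" "\<And>z. g z = (\<Prod>a\<leftarrow>as. z - a) * k z"
    "\<And>a. a \<in> set as \<Longrightarrow> norm a \<le> R" "\<And>z. norm z \<le> R \<Longrightarrow> k z \<noteq> 0"
    by (rule deflate_zeros[OF hol(2) g0 R]) (rule that; assumption)
  have ng0: "norm (g 0) > 0" using g0 by simp
  \<comment> \<open>The power of 2 that counts the zeros only improves the estimates and is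
    discarded, which removes their number from the result.\<close>
  have drop: "u * c \<le> v" if "u * (c * 2 ^ n) \<le> v" "u \<ge> 0" "c \<ge> 0" for u c v :: real and n :: nat
  proof -
    have "u * c \<le> u * (c * 2 ^ n)" using that by (intro mult_left_mono) (auto simp: mult_le_cancel_left1)
    then show ?thesis using that by linarith
  qed
  have kN: "norm (k w) * norm (g 0) \<le> N * norm (k 0)" if "norm w \<le> 3 * R" for w
  proof (rule drop)
    show "norm (k w) * (norm (g 0) * 2 ^ length as) \<le> N * norm (k 0)"
      by (rule deflated_bound[OF ak(1,2,3) R M(2) that])
  qed auto
  have hM: "norm (h w * k w) * norm (h 0 * g 0) \<le> M * norm (h 0 * k 0)" if "norm w \<le> 3 * R" for w
  proof (rule drop)
    show "norm (h w * k w) * (norm (h 0 * g 0) * 2 ^ length as) \<le> M * norm (h 0 * k 0)"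
    proof (rule deflated_bound[of "\<lambda>z. h z * k z" "\<lambda>z. h z * g z" as R M w])
      show "(\<lambda>z. h z * k z) holomorphic_on UNIV" by (intro holomorphic_intros hol ak)
      show "h z * g z = (\<Prod>a\<leftarrow>as. z - a) * (h z * k z)" for z using ak(2)[of z] by simp
    qed (use ak(3) R M(1) that in auto)
  qed auto
  have k0: "k 0 \<noteq> 0" using ak(4)[of 0] R by auto
  obtain G where G: "G holomorphic_on ball 0 R" "\<And>z. z \<in> ball 0 R \<Longrightarrow> k z = exp (G z)"
  proof (rule contractible_imp_holomorphic_log)
    show "k holomorphic_on ball 0 R" using ak(1) by (rule holomorphic_on_subset) simp
    show "contractible (ball (0::complex) R)" by (intro convex_imp_contractible convex_ball)
    show "k z \<noteq> 0" if "z \<in> ball 0 R" for z using ak(4)[of z] that by simp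
  qed blast
  \<comment> \<open>The summand 1 makes the bound on the real part strict, as Borel--Caratheodory
    requires, and ensures \<open>m \<ge> 1\<close>. It is the source of \<open>exp 2\<close> in the
    conclusion, since the lower bound for \<open>k\<close> loses the factor
    \<open>exp (2 * m)\<close>.\<close>
  define m where "m = ln (N / norm (g 0)) + 1"
  have Npos: "N > 0" using N ng0 by linarith
  have mpos: "m \<ge> 1" unfolding m_def using N ng0 by simp
  have Gb: "norm (G z - G 0) \<le> 2 * m * norm z / (R - norm z)"
  proof (rule borel_caratheodory)
    show "(\<lambda>z. G z - G 0) holomorphic_on ball 0 R" by (intro holomorphic_intros G)
    fix w :: complex assume w: "norm w < R"
    have "norm (k w) = exp (Re (G w))" "norm (k 0) = exp (Re (G 0))" using G(2) w R by auto
    then have "exp (Re (G w - G 0)) = norm (k w) / norm (k 0)" by (simp add: exp_diff)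
    also have "\<dots> \<le> N / norm (g 0)" using kN[of w] w R k0 ng0 by (simp add: field_simps)
    also have "\<dots> = exp (ln (N / norm (g 0)))" using Npos ng0 by simp
    finally show "Re (G w - G 0) < m" unfolding m_def by simp
  qed (use z R in auto)
  also have "\<dots> \<le> 2 * m"
  proof -
    have "norm z \<le> R - norm z" "R - norm z > 0" using z R by auto
    then have "norm z / (R - norm z) \<le> 1" by simp
    then show ?thesis using mpos mult_left_mono[of "norm z / (R - norm z)" 1 "2 * m"] by simp
  qed
  finally have Gb: "norm (G z - G 0) \<le> 2 * m" .
  have zR: "norm z < R" using z R by auto
  have "norm (k 0) = norm (k z) * exp (Re (G 0 - G z))" using G(2)[of z] G(2)[of 0] zR R by (simp add: exp_diff)
  also have "\<dots> \<le> norm (k z) * exp (2 * m)"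
    using Gb abs_Re_le_cmod[of "G z - G 0"] by (intro mult_left_mono) auto
  also have "exp (2 * m) = exp 2 * (N / norm (g 0))\<^sup>2"
    unfolding m_def using Npos ng0 by (simp add: exp_add distrib_left exp_double power2_eq_square exp_of_nat_mult)
  finally have kz: "norm (k 0) \<le> norm (k z) * (exp 2 * (N / norm (g 0))\<^sup>2)" .
  have kzn: "norm (k z) > 0" using ak(4)[of z] zR by auto
  have "norm (h z) * norm (k z) * (norm (h 0) * norm (g 0)) \<le> M * (norm (h 0) * norm (k 0))"
    using hM[of z] zR R by (simp add: norm_mult)
  then have A: "norm (h z) * norm (k z) * norm (g 0) \<le> M * norm (k 0)"
    using h0 by (simp add: field_simps)
  have "M \<ge> 0"
  proof -
    have "norm (h (3 * R) * g (3 * R)) \<le> M" using R by (intro M) auto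
    then show ?thesis using norm_ge_zero order_trans by blast
  qed
  then have "M * norm (k 0) \<le> M * (norm (k z) * (exp 2 * (N / norm (g 0))\<^sup>2))"
    using kz by (intro mult_left_mono)
  with A have "norm (k z) * (norm (h z) * norm (g 0)) \<le> norm (k z) * (M * exp 2 * (N / norm (g 0))\<^sup>2)"
    by (simp add: algebra_simps)
  then have "norm (h z) * norm (g 0) \<le> M * exp 2 * (N / norm (g 0))\<^sup>2"
    using kzn by (simp only: mult_le_cancel_left_pos)
  then show ?thesis using ng0 by (simp add: field_simps power2_eq_square power3_eq_cube)
qed

text \<open>The common zeros in a large disc cancel in \<open>h = (h g) / g\<close>; Borel--Caratheodory bounds the
  zero-free factor of \<open>g\<close> from below, and then the logarithm of \<open>h\<close> is \<open>O(sqrt r)\<close>.\<close>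

lemma order_half_quotient_const:
  assumes hol: "h holomorphic_on UNIV" "g holomorphic_on UNIV" and g0: "g 0 \<noteq> 0"
    and h: "\<And>z. h z \<noteq> 0" and gr: "order_half g" "order_half (\<lambda>z. h z * g z)"
  shows "h z = h 0"
proof -
  obtain A B where g: "A \<ge> 0" "B \<ge> 0" "\<And>z. norm (g z) \<le> A * exp (B * sqrt (norm z))"
    using gr(1) unfolding order_half_def by blast
  obtain C D where f: "C \<ge> 0" "D \<ge> 0" "\<And>z. norm (h z * g z) \<le> C * exp (D * sqrt (norm z))"
    using gr(2) unfolding order_half_def by blast
  have ng0: "norm (g 0) > 0" using g0 by simp
  obtain k where k: "k holomorphic_on UNIV" "\<And>z. h z = exp (k z)"
    using contractible_imp_holomorphic_log[OF hol(1) contractible_UNIV] h by (metis UNIV_I)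
  define a where "a = exp 2 * C * A ^ 2 / norm (g 0) ^ 3"
  have A0: "A \<ge> norm (g 0)" using g(3)[of 0] by simp
  have hb: "norm (h w) \<le> a * exp ((D + 2 * B) * sqrt (3 * R))" if "R > 0" "norm w \<le> R / 2" for R w
  proof -
    have "norm (h w) \<le> exp 2 * (C * exp (D * sqrt (3 * R))) * (A * exp (B * sqrt (3 * R))) ^ 2 / norm (g 0) ^ 3"
    proof (rule zero_free_quotient_bound[OF hol g0 h \<open>R > 0\<close> _ _ that(2)])
      show "norm z = 3 * R \<Longrightarrow> norm (h z * g z) \<le> C * exp (D * sqrt (3 * R))" for z using f(3)[of z] by simp
      show "norm z = 3 * R \<Longrightarrow> norm (g z) \<le> A * exp (B * sqrt (3 * R))" for z using g(3)[of z] by simp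
      have "A * 1 \<le> A * exp (B * sqrt (3 * R))" using g \<open>R > 0\<close> by (intro mult_left_mono) auto
      then show "norm (g 0) \<le> A * exp (B * sqrt (3 * R))" using A0 by linarith
    qed
    also have "\<dots> = a * exp ((D + 2 * B) * sqrt (3 * R))"
      by (simp add: a_def power_mult_distrib exp_add algebra_simps exp_double[symmetric])
    finally show ?thesis .
  qed
  have "a > 0"
  proof -
    have "0 < norm (h 0)" using h by simp
    also have "norm (h 0) \<le> a * exp ((D + 2 * B) * sqrt (3 * 1))" by (rule hb) auto
    finally show ?thesis by (simp add: zero_less_mult_iff)
  qed
  have kre: "Re (k w) \<le> ln a + (D + 2 * B) * sqrt (3 * R)" if "R > 0" "norm w \<le> R / 2" for R w
  proof -
    have "exp (Re (k w)) \<le> exp (ln a + (D + 2 * B) * sqrt (3 * R))"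
      using hb[OF that] k(2)[of w] \<open>a > 0\<close> by (simp add: exp_add)
    then show ?thesis by simp
  qed
  \<comment> \<open>On the disc of radius \<open>r\<close> the real part of \<open>k\<close> is
    \<open>O(sqrt r)\<close>, where \<open>hb\<close> is used with \<open>R = 2 * r\<close> because
    it holds on half the radius. Borel--Caratheodory then bounds the difference by
    \<open>O(sqrt r / r)\<close>.\<close>
  have "norm (k z - k 0) \<le> 0"
  proof (rule tendsto_lowerbound)
    show "((\<lambda>r. 2 * (ln a + (D + 2 * B) * sqrt (3 * (2 * r)) - Re (k 0) + 1) * norm z / (r - norm z)) \<longlongrightarrow> 0) at_top"
      by real_asymp
    show "eventually (\<lambda>r. norm (k z - k 0) \<le> 2 * (ln a + (D + 2 * B) * sqrt (3 * (2 * r)) - Re (k 0) + 1) * norm z / (r - norm z)) at_top"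
      using eventually_gt_at_top[of "norm z"]
    proof eventually_elim
      case (elim r)
      show ?case
      proof (rule borel_caratheodory[where R = r])
        show "(\<lambda>z. k z - k 0) holomorphic_on ball 0 r" by (intro holomorphic_intros holomorphic_on_subset[OF k(1)]) auto
        fix w :: complex assume "norm w < r"
        then have "Re (k w) \<le> ln a + (D + 2 * B) * sqrt (3 * (2 * r))" using kre[of "2 * r" w] norm_ge_zero[of w] by auto
        then show "Re (k w - k 0) < ln a + (D + 2 * B) * sqrt (3 * (2 * r)) - Re (k 0) + 1" by simp
      qed (use elim in auto)
    qed
  qed auto
  then show ?thesis using k(2) by simp
qed

text \<open>With equal orders everywhere, the powers of \<open>w - z\<close> in the local
  factorisations cancel, so \<open>f / g\<close> extends to a zero-free entire function.
  \<open>remove_sings\<close> defines it globally, and the local quotients of the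
  \<open>zor_poly\<close> factors identify it near every point.\<close>

lemma order_half_same_zorder:
  assumes hf: "f holomorphic_on UNIV" and hg: "g holomorphic_on UNIV"
    and nz: "\<exists>z. f z \<noteq> 0" "\<exists>z. g z \<noteq> 0"
    and gr: "order_half f" "order_half g"
    and ord: "\<And>z. zorder f z = zorder g z"
  obtains c where "c \<noteq> 0" "\<And>z. f z = c * g z"
proof -
  define h where "h = remove_sings (\<lambda>z. f z / g z)"
  have loc: "\<exists>r>0. h holomorphic_on ball z r \<and> h z \<noteq> 0 \<and> f z = h z * g z" for z
  proof -
    define n where "n = nat (zorder f z)"
    have nc: "\<exists>w\<in>UNIV. f w \<noteq> 0" "\<exists>w\<in>UNIV. g w \<noteq> 0" using nz by auto
    note ex = conjunct2[OF zorder_exist_zero[OF hf open_UNIV connected_UNIV UNIV_I nc(1), of z]]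
      conjunct2[OF zorder_exist_zero[OF hg open_UNIV connected_UNIV UNIV_I nc(2), of z]]
    obtain r1 where r1: "r1 > 0" "zor_poly f z holomorphic_on cball z r1"
      "\<And>w. w \<in> cball z r1 \<Longrightarrow> f w = zor_poly f z w * (w - z) ^ n \<and> zor_poly f z w \<noteq> 0"
      using ex(1) unfolding n_def by blast
    obtain r2 where r2: "r2 > 0" "zor_poly g z holomorphic_on cball z r2"
      "\<And>w. w \<in> cball z r2 \<Longrightarrow> g w = zor_poly g z w * (w - z) ^ n \<and> zor_poly g z w \<noteq> 0"
      using ex(2) unfolding n_def ord by blast
    define r where "r = min r1 r2"
    have "r > 0" using r1 r2 by (simp add: r_def)
    define q where "q w = zor_poly f z w / zor_poly g z w" for w
    have hq: "q holomorphic_on ball z r" unfolding q_def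
      by (intro holomorphic_intros holomorphic_on_subset[OF r1(2)] holomorphic_on_subset[OF r2(2)])
         (use r2(3) in \<open>auto simp: r_def\<close>)
    have hw: "h w = q w" if w: "w \<in> ball z r" for w
      unfolding h_def
    proof (rule remove_sings_eqI)
      have "q \<midarrow>w\<rightarrow> q w"
        using hq w by (meson continuous_on_eq_continuous_at continuous_within holomorphic_on_imp_continuous_on open_ball)
      \<comment> \<open>The centre \<open>z\<close> is excluded because \<open>f u / g u\<close> may
        be \<open>0 / 0\<close> there; the point \<open>w\<close> is excluded because only a
        punctured limit is taken.\<close>
      moreover have "eventually (\<lambda>u. u \<in> ball z r - {z} - {w}) (at w)"
      proof -
        have "eventually (\<lambda>u. u \<in> ball z r - {z}) (at w)"
        proof (cases "w = z")
          case True
          then show ?thesis using eventually_at_in_open[of "ball z r" z] \<open>r > 0\<close> by simp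
        next
          case False
          then have "eventually (\<lambda>u. u \<in> ball z r - {z}) (nhds w)"
            using w by (intro eventually_nhds_in_open) auto
          then show ?thesis by (simp add: eventually_at_filter eventually_mono)
        qed
        then show ?thesis by (auto simp: eventually_at_filter elim: eventually_mono)
      qed
      then have "eventually (\<lambda>u. q u = f u / g u) (at w)"
      proof eventually_elim
        case (elim u)
        then have "f u = zor_poly f z u * (u - z) ^ n" "g u = zor_poly g z u * (u - z) ^ n"
          using r1(3)[of u] r2(3)[of u] by (auto simp: r_def)
        then show ?case using elim by (simp add: q_def)
      qed
      ultimately show "(\<lambda>u. f u / g u) \<midarrow>w\<rightarrow> q w" by (rule Lim_transform_eventually)
    qed
    have "h holomorphic_on ball z r" by (rule holomorphic_transform[OF hq]) (use hw in auto)
    moreover have "h z = q z" using hw \<open>r > 0\<close> by simp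
    moreover have "q z \<noteq> 0" "f z = q z * g z"
      using r1(3)[of z] r2(3)[of z] r1(1) r2(1) by (auto simp: q_def)
    ultimately show ?thesis using \<open>r > 0\<close> by metis
  qed
  have hh: "h holomorphic_on UNIV"
  proof -
    have "h field_differentiable (at z)" for z
    proof -
      obtain r where "r > 0" "h holomorphic_on ball z r" using loc by blast
      then show ?thesis using holomorphic_on_imp_differentiable_at by (metis centre_in_ball open_ball)
    qed
    then show ?thesis unfolding holomorphic_on_def by (simp add: field_differentiable_at_within)
  qed
  have h0: "h z \<noteq> 0" and fh: "f z = h z * g z" for z using loc by blast+
  \<comment> \<open>The origin may be a zero of \<open>g\<close>, so the quotient theorem is applied
    after translation by a point where \<open>g\<close> does not vanish.\<close>
  obtain z0 where z0: "g z0 \<noteq> 0" using nz by blast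
  have sh: "(\<lambda>z. F (z + z0)) holomorphic_on UNIV" if "F holomorphic_on UNIV" for F
    using holomorphic_on_compose_gen[OF holomorphic_on_add[OF holomorphic_on_ident holomorphic_on_const] that, of z0 UNIV]
    by (simp add: o_def)
  have "h (z - z0 + z0) = h (0 + z0)" for z
    by (rule order_half_quotient_const[where h = "\<lambda>z. h (z + z0)" and g = "\<lambda>z. g (z + z0)"])
       (use sh[OF hh] sh[OF hg] z0 h0 order_half_shift[OF gr(2)] order_half_shift[OF gr(1)] fh in auto)
  then have "f z = h z0 * g z" for z using fh[of z] by simp
  then show ?thesis using that h0 by blast
qed

section \<open>Enumerated zeros and linear factors\<close>

lemma zero_sequence_nonzero:
  assumes "zero_sequence F l"
  shows "\<exists>z. F z \<noteq> 0"
proof (rule ccontr)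
  assume "\<not> (\<exists>z. F z \<noteq> 0)"
  \<comment> \<open>The zero set of the zero function is uncountable and cannot be enumerated by a
    sequence.\<close>
  then have "range l = UNIV" using assms unfolding zero_sequence_def by auto
  moreover have "countable (range l)" by simp
  ultimately show False using uncountable_UNIV_complex by simp
qed

lemma prod_linear_holomorphic: "(\<lambda>w. \<Prod>n\<in>S. w - a n) holomorphic_on A"
  by (intro holomorphic_intros)

lemma prod_linear_nonzero:
  assumes "finite S"
  shows "\<exists>z::complex. (\<Prod>n\<in>S. z - a n) \<noteq> 0"
proof -
  have "infinite (UNIV - a ` S)"
    using assms uncountable_infinite[OF uncountable_UNIV_complex] by simp
  then obtain z where "z \<in> UNIV - a ` S" by (metis ex_in_conv finite.emptyI)
  then show ?thesis using assms by (intro exI[of _ z]) auto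
qed

lemma eventually_entire_nonzero:
  assumes "F holomorphic_on UNIV" "\<exists>z. F z \<noteq> 0"
  shows "eventually (\<lambda>w. F w \<noteq> 0) (at z)"
proof -
  obtain b where "F b \<noteq> 0" using assms by blast
  from non_zero_neighbour_alt[OF assms(1) open_UNIV connected_UNIV UNIV_I UNIV_I this, of z]
  show ?thesis by simp
qed

lemma zorder_prod_linear:
  assumes "finite S"
  shows "zorder (\<lambda>w::complex. \<Prod>n\<in>S. w - a n) z = int (card {n\<in>S. a n = z})"
proof -
  have lin: "zorder (\<lambda>w. w - a n) z = (if a n = z then 1 else 0)" for n
  proof (cases "a n = z")
    case True
    have "zorder (\<lambda>w. w - a n) z = 1"
      by (rule zorder_eqI[where S = UNIV and g = "\<lambda>_. 1"]) (use True in auto)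
    then show ?thesis using True by simp
  next
    case False
    then show ?thesis by (simp add: zorder_eq_0I analytic_intros)
  qed
  have "zorder (\<lambda>w. \<Prod>n\<in>S. w - a n) z = (\<Sum>n\<in>S. zorder (\<lambda>w. w - a n) z)"
    by (rule zorder_prod_analytic)
       (auto intro!: analytic_intros eventually_entire_nonzero prod_linear_holomorphic prod_linear_nonzero assms)
  also have "\<dots> = int (card {n\<in>S. a n = z})"
    unfolding lin using assms by (simp add: sum.If_cases Int_def)
  finally show ?thesis .
qed

lemma zero_sequence_zorder:
  assumes "zero_sequence F l" "F holomorphic_on UNIV"
  shows "finite {n. l n = z}" "zorder F z = int (card {n. l n = z})"
proof -
  have "finite {n. l n = z} \<and> zorder F z = int (card {n. l n = z})"
  proof (cases "F z = 0")
    case True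
    then show ?thesis using assms unfolding zero_sequence_def by metis
  next
    case False
    then have "{n. l n = z} = {}" using assms(1) unfolding zero_sequence_def by auto
    moreover have "zorder F z = 0"
      by (rule zorder_eq_0I) (use assms(2) False in \<open>auto intro: holomorphic_on_imp_analytic_at[OF _ open_UNIV]\<close>)
    ultimately show ?thesis by simp
  qed
  then show "finite {n. l n = z}" "zorder F z = int (card {n. l n = z})" by auto
qed

text \<open>Instead of dividing exceptional zeros out, each function receives the exceptional zeros
  of the other as extra factors. Both products then have the zeros \<open>l n\<close> for all
  \<open>n\<close> and \<open>l' n\<close> for \<open>n \<in> S\<close>, with multiplicities,
  because \<open>l\<close> and \<open>l'\<close> agree off \<open>S\<close>.\<close>

lemma zero_sequences_proportional:
  assumes F: "F holomorphic_on UNIV" "order_half F" "zero_sequence F l"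
    and F': "F' holomorphic_on UNIV" "order_half F'" "zero_sequence F' l'"
    and S: "finite S" and eq: "\<And>n. n \<notin> S \<Longrightarrow> l n = l' n"
  obtains c where "c \<noteq> 0" "\<And>z. F z * (\<Prod>n\<in>S. z - l' n) = c * (F' z * (\<Prod>n\<in>S. z - l n))"
proof -
  have nzm: "\<exists>z. G z * (\<Prod>n\<in>S. z - a n) \<noteq> 0"
    if "G holomorphic_on UNIV" "\<exists>z. G z \<noteq> 0" for G and a :: "nat \<Rightarrow> complex"
  proof -
    have "eventually (\<lambda>w. G w \<noteq> 0 \<and> (\<Prod>n\<in>S. w - a n) \<noteq> 0) (at 0)"
      by (intro eventually_conj eventually_entire_nonzero that prod_linear_holomorphic prod_linear_nonzero S)
    then have "\<exists>w. G w \<noteq> 0 \<and> (\<Prod>n\<in>S. w - a n) \<noteq> 0"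
      using eventually_happens'[OF at_neq_bot] by blast
    then show ?thesis by auto
  qed
  note nz = zero_sequence_nonzero[OF F(3)] zero_sequence_nonzero[OF F'(3)]
  have ord: "zorder (\<lambda>z. G z * (\<Prod>n\<in>S. z - a n)) z = zorder G z + int (card {n\<in>S. a n = z})"
    if "G holomorphic_on UNIV" "\<exists>z. G z \<noteq> 0" for G and a :: "nat \<Rightarrow> complex" and z
    unfolding zorder_prod_linear[OF S, symmetric]
  proof (rule zorder_times_analytic)
    show "\<forall>\<^sub>F z in at z. G z * (\<Prod>n\<in>S. z - a n) \<noteq> 0"
      by (intro eventually_entire_nonzero nzm that holomorphic_intros)
  qed (use that in \<open>auto intro!: holomorphic_on_imp_analytic_at[OF _ open_UNIV] holomorphic_intros\<close>)
  have split: "card {n. k n = z} = card {n\<in>S. k n = z} + card {n. n \<notin> S \<and> k n = z}"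
    if "finite {n. k n = z}" for k and z :: complex
    by (subst card_Un_disjoint[symmetric])
       (use that in \<open>auto intro!: arg_cong[where f = card] elim: finite_subset[rotated]\<close>)
  have "{n. n \<notin> S \<and> l n = z} = {n. n \<notin> S \<and> l' n = z}" for z using eq by auto
  then have ord2: "zorder (\<lambda>z. F z * (\<Prod>n\<in>S. z - l' n)) z = zorder (\<lambda>z. F' z * (\<Prod>n\<in>S. z - l n)) z" for z
    unfolding ord[OF F(1) nz(1)] ord[OF F'(1) nz(2)] zero_sequence_zorder(2)[OF F(3,1)] zero_sequence_zorder(2)[OF F'(3,1)]
    using split[OF zero_sequence_zorder(1)[OF F(3,1)], of z] split[OF zero_sequence_zorder(1)[OF F'(3,1)], of z]
    by simp
  show ?thesis
  proof (rule order_half_same_zorder[of "\<lambda>z. F z * (\<Prod>n\<in>S. z - l' n)" "\<lambda>z. F' z * (\<Prod>n\<in>S. z - l n)"])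
    show "(\<lambda>z. F z * (\<Prod>n\<in>S. z - l' n)) holomorphic_on UNIV" "(\<lambda>z. F' z * (\<Prod>n\<in>S. z - l n)) holomorphic_on UNIV"
      by (intro holomorphic_intros F F')+
    show "order_half (\<lambda>z. F z * (\<Prod>n\<in>S. z - l' n))" "order_half (\<lambda>z. F' z * (\<Prod>n\<in>S. z - l n))"
      by (intro order_half_mult order_half_prod_linear F F')+
    show "\<exists>z. F z * (\<Prod>n\<in>S. z - l' n) \<noteq> 0" "\<exists>z. F' z * (\<Prod>n\<in>S. z - l n) \<noteq> 0"
      by (intro nzm F F' nz)+
    show "zorder (\<lambda>z. F z * (\<Prod>n\<in>S. z - l' n)) z = zorder (\<lambda>z. F' z * (\<Prod>n\<in>S. z - l n)) z" for z
      by (rule ord2)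
  qed (rule that)
qed

lemma poly_eq_0_if_tendsto:
  fixes p :: "complex poly"
  assumes "((\<lambda>x::real. poly p (- of_real x)) \<longlongrightarrow> 0) at_top"
  shows "p = 0"
proof (cases "degree p > 0")
  case True
  have "filterlim (\<lambda>x::real. - complex_of_real x) at_infinity at_top"
    by (rule filterlim_norm_at_top_imp_at_infinity) (simp add: filterlim_abs_real)
  then have "filterlim (\<lambda>x::real. poly p (- complex_of_real x)) at_infinity at_top"
    using filterlim_compose[OF filterlim_poly_at_infinity[OF True]] by blast
  then show ?thesis using assms not_tendsto_and_filterlim_at_infinity[OF trivial_limit_at_top_linorder] by blast
next
  case False
  then obtain c where "p = [:c:]" by (metis degree_eq_zeroE neq0_conv)
  then show ?thesis using assms tendsto_const_iff[of "at_top::real filter" c 0] by simp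
qed

section \<open>Dependence on the spectral parameter\<close>

lemma abs_int_diff_const:
  fixes q :: "real \<Rightarrow> complex"
  assumes "q absolutely_integrable_on {a..b}"
  shows "(\<lambda>x. q x - l) absolutely_integrable_on {a..b}"
  by (rule set_integral_diff(1)[OF assms absolutely_integrable_continuous_real[OF continuous_on_const]])

text \<open>The constant is chosen before the parameter and the solution, so the bound is uniform on
  discs of the spectral parameter.\<close>

lemma sol_locally_bounded:
  assumes q: "q absolutely_integrable_on {a..b}" and ab: "a \<le> b"
  shows "\<exists>K\<ge>0. \<forall>l y dy. norm l \<le> r \<longrightarrow> sol (\<lambda>x. q x - l) a b y dy \<longrightarrow>
     (\<forall>x\<in>{a..b}. norm (y x) + norm (dy x) \<le> (norm (y a) + norm (dy a)) * K)"
proof (intro exI conjI allI impI ballI)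
  let ?K = "exp (integral {a..b} (\<lambda>t. 1 + (norm (q t) + r)))"
  show "?K \<ge> 0" by simp
  fix l y dy x assume l: "norm l \<le> r" and y: "sol (\<lambda>x. q x - l) a b y dy" and x: "x \<in> {a..b}"
  have "integral {a..b} (\<lambda>t. 1 + norm (q t - l)) \<le> integral {a..b} (\<lambda>t. 1 + (norm (q t) + r))"
  proof (rule integral_le)
    show "(\<lambda>t. 1 + norm (q t - l)) integrable_on {a..b}"
      by (intro integrable_add abs_integrable_imp_norm abs_int_diff_const[OF q]) auto
    show "(\<lambda>t. 1 + (norm (q t) + r)) integrable_on {a..b}"
      by (intro integrable_add abs_integrable_imp_norm q) auto
    show "1 + norm (q t - l) \<le> 1 + (norm (q t) + r)" for t
      using norm_triangle_ineq4[of "q t" l] l by linarith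
  qed
  then have "(norm (y a) + norm (dy a)) * exp (integral {a..b} (\<lambda>t. 1 + norm (q t - l)))
      \<le> (norm (y a) + norm (dy a)) * ?K" by (intro mult_left_mono) auto
  with sol_bound[OF y abs_int_diff_const[OF q] x]
  show "norm (y x) + norm (dy x) \<le> (norm (y a) + norm (dy a)) * ?K" by linarith
qed

text \<open>The Wronskian of \<open>y0\<close> and \<open>z\<close> is constant; subtracting it
  leaves on the boundary only the increments of \<open>y\<close> and \<open>dy\<close> in the
  parameter. The Cauchy data of \<open>z\<close> at \<open>t\<close> then select which increment is
  seen.\<close>

lemma sol_lagrange_param:
  assumes y: "sol (\<lambda>x. q x - l) a b y dy" and y0: "sol (\<lambda>x. q x - l0) a b y0 dy0"
    and z: "sol (\<lambda>x. q x - l0) a b z dz" and eq: "y a = y0 a" "dy a = dy0 a" and t: "t \<in> {a..b}"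
  shows "((\<lambda>x. (l - l0) * (y x * z x)) has_integral ((y t - y0 t) * dz t - (dy t - dy0 t) * z t)) {a..t}"
proof -
  have "((\<lambda>x. ((q x - l0) - (q x - l)) * y x * z x) has_integral
     (y t * dz t - dy t * z t - (y a * dz a - dy a * z a))) {a..t}"
    using ac_deriv_onD(2)[OF sol_lagrange[OF y z], of a t] t by auto
  moreover have "y t * dz t - dy t * z t - (y a * dz a - dy a * z a) = (y t - y0 t) * dz t - (dy t - dy0 t) * z t"
  proof -
    have "y0 t * dz t - dy0 t * z t = y a * dz a - dy a * z a"
      using sol_wronskian[OF y0 z, of t a] t eq by auto
    then have "y t * dz t - dy t * z t - (y a * dz a - dy a * z a)
        = y t * dz t - dy t * z t - (y0 t * dz t - dy0 t * z t)" by simp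
    then show ?thesis by (simp add: algebra_simps)
  qed
  ultimately show ?thesis by (simp add: mult.assoc)
qed

text \<open>For each \<open>t\<close> the increment at \<open>t\<close> is \<open>l - l0\<close>
  times an integral of \<open>y l\<close> against the solution at \<open>l0\<close> with data
  \<open>(0, 1)\<close> at \<open>t\<close>. That solution depends on \<open>t\<close>, but it is a
  combination of one fixed fundamental system, so its bound \<open>2 * M * M\<close> does
  not.\<close>

lemma sol_param_lipschitz:
  assumes q: "q absolutely_integrable_on {a..b}" and ab: "a \<le> b"
    and y: "\<And>l. sol (\<lambda>x. q x - l) a b (y l) (dy l)"
    and eq: "\<And>l. y l a = ya" "\<And>l. dy l a = dya"
  shows "\<exists>C\<ge>0. \<forall>l x. norm (l - l0) \<le> 1 \<longrightarrow> x \<in> {a..b} \<longrightarrow> norm (y l x - y l0 x) \<le> C * norm (l - l0)"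
proof -
  obtain K where K: "K \<ge> 0" "\<And>l x. norm l \<le> norm l0 + 1 \<Longrightarrow> x \<in> {a..b} \<Longrightarrow>
      norm (y l x) + norm (dy l x) \<le> (norm ya + norm dya) * K"
    using sol_locally_bounded[OF q ab, of "norm l0 + 1"] y eq by metis
  define L where "L = (norm ya + norm dya) * K"
  have L0: "L \<ge> 0" using K by (simp add: L_def)
  obtain c dc where c: "sol (\<lambda>x. q x - l0) a b c dc" "c a = 1" "dc a = 0"
    using sol_exists[OF abs_int_diff_const[OF q] ab] by blast
  obtain s ds where s: "sol (\<lambda>x. q x - l0) a b s ds" "s a = 0" "ds a = 1"
    using sol_exists[OF abs_int_diff_const[OF q] ab] by blast
  obtain M where M: "M \<ge> 0" "\<And>x. x \<in> {a..b} \<Longrightarrow> norm (c x) \<le> M" "\<And>x. x \<in> {a..b} \<Longrightarrow> norm (s x) \<le> M"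
  proof -
    obtain M where "M \<ge> 0" and M: "\<And>y dy x. sol (\<lambda>x. q x - l0) a b y dy \<Longrightarrow> x \<in> {a..b} \<Longrightarrow>
       norm (y x) + norm (dy x) \<le> (norm (y a) + norm (dy a)) * M"
      using sol_locally_bounded[OF q ab, of "norm l0"] by blast
    have "norm (c x) \<le> M" "norm (s x) \<le> M" if "x \<in> {a..b}" for x
      using M[OF c(1) that] M[OF s(1) that] c s norm_ge_zero[of "dc x"] norm_ge_zero[of "ds x"]
      by (simp_all, linarith+)
    with \<open>M \<ge> 0\<close> that show ?thesis by blast
  qed
  have W: "c t * ds t - dc t * s t = 1" if "t \<in> {a..b}" for t
    using sol_wronskian[OF c(1) s(1), of t a] c s that ab by auto
  show ?thesis
  proof (intro exI conjI allI impI)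
    show "0 \<le> (b - a) * (L * (2 * M * M))" using ab L0 M by simp
    fix l t assume l: "norm (l - l0) \<le> 1" and t: "t \<in> {a..b}"
    define z dz where "z x = c t * s x + (- s t) * c x" and "dz x = c t * ds x + (- s t) * dc x" for x
    have z: "sol (\<lambda>x. q x - l0) a b z dz"
      unfolding z_def[abs_def] dz_def[abs_def] by (rule sol_lincomb[OF s(1) c(1)])
    have zt: "z t = 0" "dz t = 1" using W[OF t] by (auto simp: z_def dz_def algebra_simps)
    have I: "((\<lambda>x. (l - l0) * (y l x * z x)) has_integral (y l t - y l0 t)) {a..t}"
      using sol_lagrange_param[OF y[of l] y[of l0] z _ _ t] zt eq by simp
    have "norm (y l t - y l0 t) \<le> integral {a..t} (\<lambda>x. norm (l - l0) * (L * (2 * M * M)))"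
      unfolding integral_unique[OF I, symmetric]
    proof (rule integral_norm_bound_integral)
      show "(\<lambda>x. (l - l0) * (y l x * z x)) integrable_on {a..t}" using I by blast
      fix x assume "x \<in> {a..t}"
      then have x: "x \<in> {a..b}" using t by auto
      have "norm l \<le> norm l0 + 1" using l norm_triangle_sub[of l l0] by linarith
      then have "norm (y l x) \<le> L" using K(2)[of l x] x norm_ge_zero[of "dy l x"] unfolding L_def by linarith
      moreover have "norm (z x) \<le> 2 * M * M"
      proof -
        have "norm (z x) \<le> norm (c t) * norm (s x) + norm (s t) * norm (c x)"
          unfolding z_def by (metis norm_minus_cancel norm_mult norm_triangle_ineq)
        also have "\<dots> \<le> M * M + M * M" by (intro add_mono mult_mono M x t) auto
        finally show ?thesis by simp
      qed
      ultimately show "norm ((l - l0) * (y l x * z x)) \<le> norm (l - l0) * (L * (2 * M * M))"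
        unfolding norm_mult using L0 by (intro mult_left_mono mult_mono) auto
    qed auto
    also have "\<dots> = (t - a) * (norm (l - l0) * (L * (2 * M * M)))" using t by simp
    also have "\<dots> \<le> (b - a) * (norm (l - l0) * (L * (2 * M * M)))"
      using t L0 M by (intro mult_right_mono) auto
    finally show "norm (y l t - y l0 t) \<le> (b - a) * (L * (2 * M * M)) * norm (l - l0)"
      by (simp add: algebra_simps)
  qed
qed

text \<open>By Lagrange's identity the difference quotient in the parameter is the integral of
  \<open>y l * z\<close>, which converges for \<open>l\<close> tending to \<open>l0\<close> by the
  Lipschitz bound. Hence the derivative exists, without expanding solutions in power series of the
  parameter. Data \<open>(0, 1)\<close> for \<open>z\<close> at \<open>b\<close> give the derivative
  of \<open>y\<close>, data \<open>(-1, 0)\<close> that of \<open>dy\<close>.\<close>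

lemma sol_param_holomorphic:
  assumes q: "q absolutely_integrable_on {a..b}" and ab: "a \<le> b"
    and y: "\<And>l. sol (\<lambda>x. q x - l) a b (y l) (dy l)"
    and eq: "\<And>l. y l a = ya" "\<And>l. dy l a = dya"
  shows "(\<lambda>l. y l b) holomorphic_on UNIV" "(\<lambda>l. dy l b) holomorphic_on UNIV"
proof -
  have key: "\<exists>D. ((\<lambda>l. ((y l b - y l0 b) * dz b - (dy l b - dy l0 b) * z b) / (l - l0)) \<longlongrightarrow> D) (at l0)"
    if z: "sol (\<lambda>x. q x - l0) a b z dz" for z dz l0
  proof -
    obtain C where C: "C \<ge> 0" "\<And>l x. norm (l - l0) \<le> 1 \<Longrightarrow> x \<in> {a..b} \<Longrightarrow> norm (y l x - y l0 x) \<le> C * norm (l - l0)"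
      using sol_param_lipschitz[OF q ab y eq, of l0] by blast
    have "bounded (z ` {a..b})"
      by (intro compact_imp_bounded compact_continuous_image sol_continuous[OF z]) auto
    then obtain M where M: "\<And>x. x \<in> {a..b} \<Longrightarrow> norm (z x) \<le> M"
      unfolding bounded_iff by (metis image_eqI)
    have "M \<ge> 0" using order_trans[OF norm_ge_zero M[of a]] ab by simp
    have I: "(\<lambda>x. y l x * z x) integrable_on {a..b}" for l
      by (intro integrable_continuous_real continuous_intros sol_continuous[OF z] sol_continuous[OF y])
    define \<Phi> where "\<Phi> l = integral {a..b} (\<lambda>x. y l x * z x)" for l
    have eqn: "((y l b - y l0 b) * dz b - (dy l b - dy l0 b) * z b) = (l - l0) * \<Phi> l" for l
    proof -
      have "((\<lambda>x. (l - l0) * (y l x * z x)) has_integral ((y l b - y l0 b) * dz b - (dy l b - dy l0 b) * z b)) {a..b}"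
        using sol_lagrange_param[OF y[of l] y[of l0] z, of b] eq ab by simp
      from integral_unique[OF this] show ?thesis unfolding \<Phi>_def by simp
    qed
    have "norm (\<Phi> l - \<Phi> l0) \<le> (b - a) * (C * M) * norm (l - l0)" if l: "norm (l - l0) \<le> 1" for l
    proof -
      have "\<Phi> l - \<Phi> l0 = integral {a..b} (\<lambda>x. y l x * z x - y l0 x * z x)"
        unfolding \<Phi>_def by (rule Henstock_Kurzweil_Integration.integral_diff[symmetric]) (rule I)+
      also have "norm \<dots> \<le> integral {a..b} (\<lambda>x. C * norm (l - l0) * M)"
      proof (rule integral_norm_bound_integral)
        show "(\<lambda>x. y l x * z x - y l0 x * z x) integrable_on {a..b}" by (intro integrable_diff I)
        fix x assume x: "x \<in> {a..b}"
        have "norm ((y l x - y l0 x) * z x) \<le> (C * norm (l - l0)) * M"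
          unfolding norm_mult using C(2)[OF l x] M[OF x] C(1) by (intro mult_mono) auto
        then show "norm (y l x * z x - y l0 x * z x) \<le> C * norm (l - l0) * M"
          by (simp add: algebra_simps)
      qed auto
      finally show ?thesis using ab by (simp add: algebra_simps)
    qed
    then have "eventually (\<lambda>l. norm (\<Phi> l - \<Phi> l0) \<le> (b - a) * (C * M) * norm (l - l0)) (at l0)"
      by (auto simp: eventually_at dist_norm intro!: exI[of _ 1])
    moreover have "((\<lambda>l. (b - a) * (C * M) * norm (l - l0)) \<longlongrightarrow> (b - a) * (C * M) * norm (l0 - l0)) (at l0)"
      by (intro tendsto_intros)
    ultimately have "((\<lambda>l. \<Phi> l - \<Phi> l0) \<longlongrightarrow> 0) (at l0)"
      by - (rule Lim_null_comparison[where g = "\<lambda>l. (b - a) * (C * M) * norm (l - l0)"], simp_all)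
    then have "(\<Phi> \<longlongrightarrow> \<Phi> l0) (at l0)" by (rule LIM_zero_cancel)
    then have "((\<lambda>l. ((y l b - y l0 b) * dz b - (dy l b - dy l0 b) * z b) / (l - l0)) \<longlongrightarrow> \<Phi> l0) (at l0)"
      by (rule Lim_transform_eventually) (simp add: eqn eventually_at_filter)
    then show ?thesis by blast
  qed
  have "\<exists>D. ((\<lambda>l. y l b) has_field_derivative D) (at l0)" for l0
  proof -
    obtain z dz where z: "sol (\<lambda>x. q x - l0) a b z dz" "z b = 0" "dz b = 1"
      using sol_exists_right[OF abs_int_diff_const[OF q] ab] by blast
    from key[OF z(1)] z show ?thesis by (simp add: has_field_derivative_iff)
  qed
  then show "(\<lambda>l. y l b) holomorphic_on UNIV"
    unfolding holomorphic_on_open[OF open_UNIV] by blast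
  have "\<exists>D. ((\<lambda>l. dy l b) has_field_derivative D) (at l0)" for l0
  proof -
    obtain z dz where z: "sol (\<lambda>x. q x - l0) a b z dz" "z b = -1" "dz b = 0"
      using sol_exists_right[OF abs_int_diff_const[OF q] ab] by blast
    from key[OF z(1)] z show ?thesis by (simp add: has_field_derivative_iff)
  qed
  then show "(\<lambda>l. dy l b) holomorphic_on UNIV"
    unfolding holomorphic_on_open[OF open_UNIV] by blast
qed

text \<open>For \<open>l = - k\<^sup>2\<close> the combinations \<open>dy + k y\<close> and \<open>dy - k y\<close> decouple up to a perturbation
  of size \<open>norm q / k\<close>; Gronwall's inequality is applied after removing the factor \<open>exp (k x)\<close>.\<close>

lemma exp_linear_ac_deriv:
  "ac_deriv_on {a..b} (\<lambda>t. exp (c * of_real (t - s))) (\<lambda>t. c * exp (c * of_real (t - s)))"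
proof (rule ac_deriv_on_C1)
  fix x
  have "((\<lambda>z. exp (c * (z - of_real s))) has_field_derivative c * exp (c * (of_real x - of_real s))) (at (of_real x))"
    by (auto intro!: derivative_eq_intros)
  from has_vector_derivative_real_field[OF this, of "{a..b}"]
  show "((\<lambda>t. exp (c * of_real (t - s))) has_vector_derivative c * exp (c * of_real (x - s))) (at x within {a..b})"
    by simp
qed (intro continuous_intros)

lemma sol_exp_estimates:
  assumes y: "sol (\<lambda>x. q x - l) a b y dy" and l: "l = - (k\<^sup>2)"
    and q: "q absolutely_integrable_on {a..b}" and Q: "integral {a..b} (\<lambda>t. norm (q t)) \<le> Q"
    and k: "Q \<le> norm k" "k \<noteq> 0" "0 \<le> Re k" and x: "x \<in> {a..b}"
  defines "N \<equiv> norm (dy a + k * y a) + norm (dy a - k * y a)"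
  shows "norm (dy x + k * y x) + norm (dy x - k * y x) \<le> exp (Re k * (x - a)) * (3 * N)"
    and "norm (dy x + k * y x - exp (k * of_real (x - a)) * (dy a + k * y a)) \<le> exp (Re k * (x - a)) * (2 * Q / norm k * N)"
    and "norm (dy x - k * y x - exp (- k * of_real (x - a)) * (dy a - k * y a)) \<le> exp (Re k * (x - a)) * (2 * Q / norm k * N)"
proof -
  note cy = sol_continuous[OF y]
  define u v where "u t = exp (- k * of_real (t - a))" and "v t = exp (k * of_real (t - a))" for t :: real
  have uv: "u t * v t = 1" for t by (simp add: u_def v_def exp_add[symmetric])
  have nu: "norm (u t) = exp (- Re k * (t - a))" "norm (v t) = exp (Re k * (t - a))" for t
    by (simp_all add: u_def v_def)
  have u: "ac_deriv_on {a..b} u (\<lambda>t. - k * u t)"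
    unfolding u_def[abs_def] by (rule exp_linear_ac_deriv)
  have v: "ac_deriv_on {a..b} v (\<lambda>t. k * v t)"
    unfolding v_def[abs_def] by (rule exp_linear_ac_deriv)
  define A B where "A t = dy t + k * y t" and "B t = dy t + (- k) * y t" for t
  have acA: "ac_deriv_on {a..b} A (\<lambda>t. (q t - l) * y t + k * dy t)"
    unfolding A_def[abs_def] by (intro ac_deriv_on_add ac_deriv_on_cmult sol_ac[OF y])
  have acB: "ac_deriv_on {a..b} B (\<lambda>t. (q t - l) * y t + (- k) * dy t)"
    unfolding B_def[abs_def] by (intro ac_deriv_on_add ac_deriv_on_cmult sol_ac[OF y])
  have acU: "ac_deriv_on {a..b} (\<lambda>t. u t * A t) (\<lambda>t. u t * (q t * y t))"
    by (rule ac_deriv_on_cong[OF ac_deriv_on_mult[OF u acA]])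
       (auto simp: A_def l power2_eq_square algebra_simps)
  have acV: "ac_deriv_on {a..b} (\<lambda>t. v t * B t) (\<lambda>t. v t * (q t * y t))"
    by (rule ac_deriv_on_cong[OF ac_deriv_on_mult[OF v acB]])
       (auto simp: B_def l power2_eq_square algebra_simps)
  \<comment> \<open>Both components are measured after division by the growth of the larger one,
    \<open>exp (Re k * (t - a))\<close>; since \<open>A - B = 2 * k * y\<close>, this also controls
    \<open>y\<close> with a gain of \<open>1 / norm k\<close>.\<close>
  define n where "n t = norm (u t) * (norm (A t) + norm (B t))" for t
  have cA: "continuous_on {a..b} A" and cB: "continuous_on {a..b} B"
    unfolding A_def[abs_def] B_def[abs_def] by (intro continuous_intros cy)+
  have cu: "continuous_on {a..b} u" unfolding u_def[abs_def] by (intro continuous_intros)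
  have n0: "n t \<ge> 0" for t by (simp add: n_def)
  have cn: "continuous_on {a..b} n" unfolding n_def[abs_def] by (intro continuous_intros cA cB cu)
  have Neq: "N = norm (A a) + norm (B a)" by (simp add: N_def A_def B_def)
  have ny: "norm (u t) * norm (y t) \<le> n t / (2 * norm k)" for t
  proof -
    have "2 * k * y t = A t - B t" by (simp add: A_def B_def algebra_simps)
    then have "2 * norm k * norm (y t) \<le> norm (A t) + norm (B t)"
      by (metis norm_mult norm_numeral norm_triangle_ineq4)
    then have "norm (y t) \<le> (norm (A t) + norm (B t)) / (2 * norm k)"
      using k by (simp add: field_simps)
    then have "norm (u t) * norm (y t) \<le> norm (u t) * ((norm (A t) + norm (B t)) / (2 * norm k))"
      by (intro mult_left_mono) auto
    then show ?thesis by (simp add: n_def)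
  qed
  have qn: "(\<lambda>t. norm (q t) / norm k * n t) integrable_on {s..t}" if "a \<le> s" "t \<le> b" for s t
  proof -
    have "(\<lambda>t. q t * of_real (n t)) absolutely_integrable_on {a..b}"
      by (rule abs_int_mult_continuous[OF q]) (intro continuous_intros cn)
    then have "(\<lambda>t. norm (q t * of_real (n t))) integrable_on {a..b}" by (rule abs_integrable_imp_norm)
    then have "(\<lambda>t. (1 / norm k) * norm (q t * of_real (n t))) integrable_on {a..b}"
      by (rule integrable_on_mult_right)
    then have "(\<lambda>t. norm (q t) / norm k * n t) integrable_on {a..b}"
      by (rule integrable_eq) (use n0 in \<open>simp add: norm_mult\<close>)
    then show ?thesis by (rule integrable_on_subinterval) (use that in auto)
  qed
  have qn2: "(\<lambda>t. norm (q t) * (n t / (2 * norm k))) integrable_on {s..t}" if "a \<le> s" "t \<le> b" for s t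
    using integrable_on_mult_right[OF qn[OF that], of "1/2"] by (simp add: field_simps)
  have EA: "norm (u t * A t - A a) \<le> integral {a..t} (\<lambda>t. norm (q t) * (n t / (2 * norm k)))" if t: "t \<in> {a..b}" for t
  proof -
    have "u t * A t - A a = integral {a..t} (\<lambda>t. u t * (q t * y t))"
      using ac_deriv_onD(4)[OF acU, of a t] t by (simp add: u_def)
    also have "norm \<dots> \<le> integral {a..t} (\<lambda>t. norm (q t) * (n t / (2 * norm k)))"
    proof (rule integral_norm_bound_integral)
      show "(\<lambda>t. u t * (q t * y t)) integrable_on {a..t}"
        using ac_deriv_onD(3)[OF acU, of a t] t by auto
      show "norm (u s * (q s * y s)) \<le> norm (q s) * (n s / (2 * norm k))" for s
        using mult_left_mono[OF ny[of s] norm_ge_zero[of "q s"]] by (simp add: norm_mult mult_ac)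
    qed (use qn2 t in auto)
    finally show ?thesis .
  qed
  \<comment> \<open>The integrating factor of \<open>B\<close> is \<open>v\<close>, but the common
    weight is \<open>u\<close>. Multiplying by \<open>u t\<close> twice restores it, and the kernel
    is harmless because \<open>s \<le> t\<close> and \<open>Re k \<ge> 0\<close> make
    \<open>norm (u t)^2 * norm (v s)\<close> at most \<open>norm (u s)\<close>.\<close>
  have EB: "norm (u t * B t - u t * u t * B a) \<le> integral {a..t} (\<lambda>t. norm (q t) * (n t / (2 * norm k)))" if t: "t \<in> {a..b}" for t
  proof -
    have I: "(\<lambda>t. v t * (q t * y t)) integrable_on {a..t}"
      using ac_deriv_onD(3)[OF acV, of a t] t by auto
    have "v t * B t - B a = integral {a..t} (\<lambda>t. v t * (q t * y t))"
      using ac_deriv_onD(4)[OF acV, of a t] t by (simp add: v_def)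
    then have "u t * u t * (v t * B t - B a) = integral {a..t} (\<lambda>s. u t * u t * (v s * (q s * y s)))"
      by simp
    moreover have "u t * u t * (v t * B t - B a) = u t * (u t * v t) * B t - u t * u t * B a"
      by (simp add: algebra_simps)
    ultimately have "u t * B t - u t * u t * B a = integral {a..t} (\<lambda>s. u t * u t * (v s * (q s * y s)))"
      by (simp add: uv)
    also have "norm \<dots> \<le> integral {a..t} (\<lambda>t. norm (q t) * (n t / (2 * norm k)))"
    proof (rule integral_norm_bound_integral)
      show "(\<lambda>s. u t * u t * (v s * (q s * y s))) integrable_on {a..t}"
        using I by (rule integrable_on_mult_right)
      fix s assume s: "s \<in> {a..t}"
      have "norm (u t) * norm (u t) * norm (v s) \<le> norm (u s)"
      proof -
        have "Re k * s \<le> Re k * t" using s k by (intro mult_left_mono) auto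
        then show ?thesis unfolding nu by (simp add: exp_add[symmetric] algebra_simps)
      qed
      then have "norm (u t) * norm (u t) * norm (v s) * (norm (q s) * norm (y s)) \<le> norm (u s) * (norm (q s) * norm (y s))"
        by (intro mult_right_mono) auto
      also have "\<dots> \<le> norm (q s) * (n s / (2 * norm k))"
        using mult_left_mono[OF ny[of s] norm_ge_zero[of "q s"]] by (simp add: mult_ac)
      finally show "norm (u t * u t * (v s * (q s * y s))) \<le> norm (q s) * (n s / (2 * norm k))"
        by (simp add: norm_mult mult_ac)
    qed (use qn2 t in auto)
    finally show ?thesis .
  qed
  have gi: "(\<lambda>t. norm (q t) / norm k) integrable_on {a..b}"
    using integrable_on_mult_right[OF abs_integrable_imp_norm[OF q], of "1 / norm k"] by simp
  \<comment> \<open>Here \<open>Q \<le> norm k\<close> enters: Gronwall's exponent stays below 1,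
    and \<open>exp 1 \<le> 3\<close> explains the 3 in the first estimate.\<close>
  have gb: "integral {a..t} (\<lambda>t. norm (q t) / norm k) \<le> 1" if t: "t \<in> {a..b}" for t
  proof -
    have "integral {a..t} (\<lambda>t. norm (q t) / norm k) \<le> integral {a..b} (\<lambda>t. norm (q t) / norm k)"
      by (rule integral_subset_le) (use t gi in \<open>auto intro: integrable_on_subinterval[OF gi]\<close>)
    also have "\<dots> = integral {a..b} (\<lambda>t. norm (q t)) / norm k" by simp
    also have "\<dots> \<le> 1" using Q k by (simp add: divide_le_eq)
    finally show ?thesis .
  qed
  have N0: "N \<ge> 0" by (simp add: N_def)
  have nb: "n t \<le> N * 3" if t: "t \<in> {a..b}" for t
  proof -
    have "n t \<le> N * exp (integral {a..t} (\<lambda>t. norm (q t) / norm k))"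
    proof (rule gronwall[OF gi _ cn _ _ N0 t])
      show "(\<lambda>t. norm (q t) / norm k * n t) integrable_on {a..b}" by (rule qn) auto
      fix t assume t: "t \<in> {a..b}"
      have "norm (u t) \<le> 1" unfolding nu using k t by (simp add: mult_nonneg_nonneg)
      then have "norm (u t) * norm (u t) * norm (B a) \<le> 1 * 1 * norm (B a)"
        by (intro mult_right_mono mult_mono) auto
      then have 1: "norm (u t * u t * B a) \<le> norm (B a)" by (simp add: norm_mult)
      have "n t = norm (u t * A t) + norm (u t * B t)" by (simp add: n_def norm_mult distrib_left)
      also have "\<dots> \<le> (norm (A a) + integral {a..t} (\<lambda>t. norm (q t) * (n t / (2 * norm k))))
         + (norm (B a) + integral {a..t} (\<lambda>t. norm (q t) * (n t / (2 * norm k))))"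
        using EA[OF t] EB[OF t] 1 norm_triangle_sub[of "u t * A t" "A a"] norm_triangle_sub[of "u t * B t" "u t * u t * B a"]
        by linarith
      also have "\<dots> = N + integral {a..t} (\<lambda>t. 2 * (norm (q t) * (n t / (2 * norm k))))"
        by (simp add: Neq)
      also have "(\<lambda>t. 2 * (norm (q t) * (n t / (2 * norm k)))) = (\<lambda>t. norm (q t) / norm k * n t)"
        by (simp add: fun_eq_iff)
      finally show "n t \<le> N + integral {a..t} (\<lambda>t. norm (q t) / norm k * n t)" .
    qed auto
    also have "\<dots> \<le> N * 3"
    proof (rule mult_left_mono[OF _ N0])
      have "exp (integral {a..t} (\<lambda>t. norm (q t) / norm k)) \<le> exp 1" using gb[OF t] by simp
      also have "exp 1 \<le> (3::real)" by (rule exp_le)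
      finally show "exp (integral {a..t} (\<lambda>t. norm (q t) / norm k)) \<le> 3" .
    qed
    finally show ?thesis .
  qed
  \<comment> \<open>The bound \<open>n t \<le> N * 3\<close> gives the constant 3/2, which is
    rounded up to 2.\<close>
  have IB: "integral {a..x} (\<lambda>t. norm (q t) * (n t / (2 * norm k))) \<le> 2 * Q / norm k * N"
  proof -
    have "integral {a..x} (\<lambda>t. norm (q t) * (n t / (2 * norm k))) \<le> integral {a..x} (\<lambda>t. (N * 3 / (2 * norm k)) * norm (q t))"
    proof (rule integral_le)
      show "(\<lambda>t. norm (q t) * (n t / (2 * norm k))) integrable_on {a..x}" by (rule qn2) (use x in auto)
      show "(\<lambda>t. (N * 3 / (2 * norm k)) * norm (q t)) integrable_on {a..x}"
        by (intro integrable_on_mult_right integrable_on_subinterval[OF abs_integrable_imp_norm[OF q]]) (use x in auto)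
      fix t assume "t \<in> {a..x}"
      then have "n t \<le> N * 3" using x by (intro nb) auto
      then have "norm (q t) * (n t / (2 * norm k)) \<le> norm (q t) * (N * 3 / (2 * norm k))"
        by (intro mult_left_mono divide_right_mono) auto
      then show "norm (q t) * (n t / (2 * norm k)) \<le> (N * 3 / (2 * norm k)) * norm (q t)" by (simp add: mult_ac)
    qed
    also have "\<dots> = (N * 3 / (2 * norm k)) * integral {a..x} (\<lambda>t. norm (q t))" by simp
    also have "integral {a..x} (\<lambda>t. norm (q t)) \<le> integral {a..b} (\<lambda>t. norm (q t))"
      by (rule integral_subset_le) (use x abs_integrable_imp_norm[OF q] in
          \<open>auto intro: integrable_on_subinterval[OF abs_integrable_imp_norm[OF q]]\<close>)
    finally have 1: "integral {a..x} (\<lambda>t. norm (q t) * (n t / (2 * norm k))) \<le> (N * 3 / (2 * norm k)) * Q"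
      using N0 k Q by (smt (verit, best) divide_nonneg_nonneg mult_left_mono norm_ge_zero)
    have "Q \<ge> 0" using Q integral_nonneg[OF abs_integrable_imp_norm[OF q]] by (smt (verit) norm_ge_zero)
    then have "(N * 3 / (2 * norm k)) * Q \<le> 2 * Q / norm k * N"
      using N0 k by (simp add: field_simps mult_nonneg_nonneg)
    with 1 show ?thesis by linarith
  qed
  have vx: "v x * u x = 1" using uv[of x] by (simp add: mult.commute)
  have "A x - v x * A a = v x * (u x * A x - A a)" using vx by (simp add: algebra_simps)
  then have "norm (A x - v x * A a) = norm (v x) * norm (u x * A x - A a)" by (simp add: norm_mult)
  also have "\<dots> \<le> norm (v x) * (2 * Q / norm k * N)"
    using EA[OF x] IB by (intro mult_left_mono) auto
  finally show "norm (dy x + k * y x - exp (k * of_real (x - a)) * (dy a + k * y a)) \<le> exp (Re k * (x - a)) * (2 * Q / norm k * N)"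
    unfolding nu by (simp add: A_def v_def)
  have "v x * (u x * B x - u x * u x * B a) = (v x * u x) * B x - (v x * u x) * u x * B a" by (simp add: algebra_simps)
  then have "B x - u x * B a = v x * (u x * B x - u x * u x * B a)" using vx by simp
  then have "norm (B x - u x * B a) = norm (v x) * norm (u x * B x - u x * u x * B a)" by (simp add: norm_mult)
  also have "\<dots> \<le> norm (v x) * (2 * Q / norm k * N)"
    using EB[OF x] IB by (intro mult_left_mono) auto
  finally show "norm (dy x - k * y x - exp (- k * of_real (x - a)) * (dy a - k * y a)) \<le> exp (Re k * (x - a)) * (2 * Q / norm k * N)"
    unfolding nu by (simp add: B_def u_def)
  have "norm (A x) + norm (B x) = norm (v x * u x) * (norm (A x) + norm (B x))" by (simp add: vx)
  also have "\<dots> = norm (v x) * n x" by (simp add: n_def norm_mult)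
  also have "\<dots> \<le> norm (v x) * (N * 3)" using nb[OF x] by (intro mult_left_mono) auto
  finally show "norm (dy x + k * y x) + norm (dy x - k * y x) \<le> exp (Re k * (x - a)) * (3 * N)"
    unfolding nu by (simp add: A_def B_def mult_ac)
qed

lemma norm_plus_minus_bounds:
  fixes u v :: complex
  shows "2 * norm u \<le> norm (u + v) + norm (u - v)" "2 * norm v \<le> norm (u + v) + norm (u - v)"
    "norm (u + v) + norm (u - v) \<le> 2 * (norm u + norm v)"
proof -
  have "2 * u = (u + v) + (u - v)" "2 * v = (u + v) - (u - v)" by auto
  then have "norm (2 * u) \<le> norm (u + v) + norm (u - v)" "norm (2 * v) \<le> norm (u + v) + norm (u - v)"
    by (metis norm_triangle_ineq, metis norm_triangle_ineq4)
  then show "2 * norm u \<le> norm (u + v) + norm (u - v)" "2 * norm v \<le> norm (u + v) + norm (u - v)"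
    by (auto simp: norm_mult)
  show "norm (u + v) + norm (u - v) \<le> 2 * (norm u + norm v)"
    using add_mono[OF norm_triangle_ineq[of u v] norm_triangle_ineq4[of u v]] by simp
qed

text \<open>For \<open>norm l \<le> r\<close> the locally uniform bound suffices. Beyond that,
  \<open>norm k = sqrt (norm l)\<close> exceeds both 1 and the norm of the potential, and the
  exponential estimate applies; passing from \<open>k * y\<close> to \<open>y\<close> at the left
  end costs a factor \<open>sqrt (norm l)\<close>, which goes into the additional 1 in the exponent
  \<open>b - a + 1\<close>.\<close>

lemma sol_growth:
  assumes q: "q absolutely_integrable_on {a..b}" and ab: "a \<le> b"
  shows "\<exists>A\<ge>0. \<exists>B\<ge>0. \<forall>l y dy. sol (\<lambda>x. q x - l) a b y dy \<longrightarrow>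
     norm (y b) + norm (dy b) \<le> (norm (y a) + norm (dy a)) * (A * exp (B * sqrt (norm l)))"
proof -
  define Q where "Q = integral {a..b} (\<lambda>t. norm (q t))"
  define r where "r = (\<bar>Q\<bar> + 1)\<^sup>2"
  obtain K where K: "K \<ge> 0" "\<And>l y dy x. norm l \<le> r \<Longrightarrow> sol (\<lambda>x. q x - l) a b y dy \<Longrightarrow> x \<in> {a..b} \<Longrightarrow>
     norm (y x) + norm (dy x) \<le> (norm (y a) + norm (dy a)) * K"
    using sol_locally_bounded[OF q ab, of r] by blast
  show ?thesis
  proof (rule exI[of _ "K + 6"], intro conjI, goal_cases)
    case 2
    show ?case
    proof (rule exI[of _ "b - a + 1"], intro conjI allI impI, goal_cases)
      case (2 l y dy)
      define s where "s = sqrt (norm l)"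
      have "s \<ge> 0" by (simp add: s_def)
      show ?case
      proof (cases "norm l \<le> r")
        case True
        have "K * 1 \<le> (K + 6) * exp ((b - a + 1) * s)"
          using K ab \<open>s \<ge> 0\<close> by (intro mult_mono) auto
        then have "(norm (y a) + norm (dy a)) * K \<le> (norm (y a) + norm (dy a)) * ((K + 6) * exp ((b - a + 1) * s))"
          by (intro mult_left_mono) auto
        with K(2)[OF True 2, of b] ab show ?thesis by (simp add: s_def)
      next
        case False
        \<comment> \<open>The principal root has nonnegative real part, as the exponential estimates
          require.\<close>
        define k where "k = csqrt (- l)"
        have k2: "l = - (k\<^sup>2)" by (simp add: k_def)
        then have ns: "norm k = s" by (metis norm_minus_cancel norm_power real_sqrt_abs abs_norm_cancel s_def)
        have "(\<bar>Q\<bar> + 1)\<^sup>2 < s\<^sup>2" using False by (simp add: r_def s_def)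
        then have s: "s > \<bar>Q\<bar> + 1" using \<open>s \<ge> 0\<close> by (rule power_less_imp_less_base)
        have "Re k \<ge> 0" unfolding k_def using csqrt_principal[of "-l"] by auto
        have "norm (dy b + k * y b) + norm (dy b - k * y b) \<le> exp (Re k * (b - a)) * (3 * (norm (dy a + k * y a) + norm (dy a - k * y a)))"
          by (rule sol_exp_estimates(1)[OF 2 k2 q]) (use s ns \<open>Re k \<ge> 0\<close> ab in \<open>auto simp: Q_def\<close>)
        also have "\<dots> \<le> exp (s * (b - a)) * (3 * (2 * (norm (dy a) + s * norm (y a))))"
        proof (intro mult_mono)
          show "exp (Re k * (b - a)) \<le> exp (s * (b - a))"
            using complex_Re_le_cmod[of k] ns ab by (auto intro: mult_right_mono)
          show "norm (dy a + k * y a) + norm (dy a - k * y a) \<le> 2 * (norm (dy a) + s * norm (y a))"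
            using norm_plus_minus_bounds(3)[of "dy a" "k * y a"] ns by (simp add: norm_mult)
        qed auto
        also have "\<dots> \<le> exp (s * (b - a)) * (6 * (exp s * (norm (y a) + norm (dy a))))"
        proof -
          have "s \<le> exp s" "1 \<le> exp s" using exp_ge_add_one_self[of s] \<open>s \<ge> 0\<close> by linarith+
          then have "norm (dy a) + s * norm (y a) \<le> exp s * norm (dy a) + exp s * norm (y a)"
            by (intro add_mono mult_right_mono) (auto simp: mult_le_cancel_right1)
          then have "6 * (norm (dy a) + s * norm (y a)) \<le> 6 * (exp s * (norm (y a) + norm (dy a)))"
            by (simp add: distrib_left)
          from mult_left_mono[OF this, of "exp (s * (b - a))"] show ?thesis by (simp add: mult.assoc)
        qed
        also have "\<dots> = (norm (y a) + norm (dy a)) * (6 * exp ((b - a + 1) * s))"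
        proof -
          have "exp ((b - a + 1) * s) = exp (s * (b - a)) * exp s"
            by (simp add: exp_add[symmetric] algebra_simps)
          then show ?thesis by simp
        qed
        also have "\<dots> \<le> (norm (y a) + norm (dy a)) * ((K + 6) * exp ((b - a + 1) * s))"
          using K by (intro mult_left_mono mult_right_mono) auto
        finally have 1: "norm (dy b + k * y b) + norm (dy b - k * y b) \<le> (norm (y a) + norm (dy a)) * ((K + 6) * exp ((b - a + 1) * s))" .
        have "1 \<le> s" using s abs_ge_zero[of Q] by linarith
        then have "norm (y b) \<le> norm (k * y b)" using ns by (simp add: norm_mult mult_le_cancel_right1)
        then have "norm (y b) + norm (dy b) \<le> norm (dy b + k * y b) + norm (dy b - k * y b)"
          using norm_plus_minus_bounds(1,2)[where u = "dy b" and v = "k * y b"] by linarith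
        with 1 show ?thesis by (simp add: s_def)
      qed
    qed (use ab in auto)
  qed (use K in auto)
qed

lemma sol_order_half:
  assumes q: "q absolutely_integrable_on {a..b}" and ab: "a \<le> b"
    and y: "\<And>l. sol (\<lambda>x. q x - l) a b (y l) (dy l)"
    and eq: "order_half (\<lambda>l. y l a)" "order_half (\<lambda>l. dy l a)"
  shows "order_half (\<lambda>l. y l b)" "order_half (\<lambda>l. dy l b)"
proof -
  obtain A B where AB: "A \<ge> 0" "\<And>l. norm (y l b) + norm (dy l b) \<le> (norm (y l a) + norm (dy l a)) * (A * exp (B * sqrt (norm l)))"
    using sol_growth[OF q ab] y by metis
  obtain C D where C: "C \<ge> 0" "D \<ge> 0" "\<And>l. norm (y l a) \<le> C * exp (D * sqrt (norm l))"
    using eq(1) unfolding order_half_def by blast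
  obtain E F where E: "E \<ge> 0" "F \<ge> 0" "\<And>l. norm (dy l a) \<le> E * exp (F * sqrt (norm l))"
    using eq(2) unfolding order_half_def by blast
  have main: "norm (y l b) + norm (dy l b) \<le> ((C + E) * A) * exp ((D + F + B) * sqrt (norm l))" for l
  proof -
    let ?s = "sqrt (norm l)"
    have "C * exp (D * ?s) \<le> C * exp ((D + F) * ?s)" "E * exp (F * ?s) \<le> E * exp ((D + F) * ?s)"
      using C E by (auto intro!: mult_left_mono mult_right_mono)
    then have "norm (y l a) + norm (dy l a) \<le> (C + E) * exp ((D + F) * ?s)"
      using C(3)[of l] E(3)[of l] by (simp add: algebra_simps)
    then have "(norm (y l a) + norm (dy l a)) * (A * exp (B * ?s)) \<le> ((C + E) * exp ((D + F) * ?s)) * (A * exp (B * ?s))"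
      using AB(1) by (intro mult_right_mono) auto
    also have "\<dots> = ((C + E) * A) * exp ((D + F + B) * ?s)" by (simp add: algebra_simps exp_add)
    finally show ?thesis using AB(2)[of l] by linarith
  qed
  show "order_half (\<lambda>l. y l b)" "order_half (\<lambda>l. dy l b)"
    by (rule order_halfI; rule order_trans[OF _ main]; simp)+
qed

section \<open>Solutions with a jump\<close>

text \<open>A solution with the jump at \<open>d\<close> is kept as two solutions on closed intervals, \<open>y\<close> on \<open>[a, d]\<close>
  and \<open>z\<close> on \<open>[d, \<pi>]\<close>, so that both one-sided values at \<open>d\<close> are available.\<close>

definition jsol :: "(real \<Rightarrow> complex) \<Rightarrow> real \<Rightarrow> complex \<Rightarrow> real \<Rightarrow> complex \<Rightarrow> real \<Rightarrow>
    (real \<Rightarrow> complex) \<Rightarrow> (real \<Rightarrow> complex) \<Rightarrow> (real \<Rightarrow> complex) \<Rightarrow> (real \<Rightarrow> complex) \<Rightarrow> bool" where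
  "jsol q \<beta> \<gamma> d l a y dy z dz \<longleftrightarrow>
     sol (\<lambda>x. q x - l) a d y dy \<and> sol (\<lambda>x. q x - l) d pi z dz \<and>
     z d = of_real \<beta> * y d \<and> dz d = of_real (inverse \<beta>) * dy d + \<gamma> * y d"

lemma jsol_exists:
  assumes q: "q absolutely_integrable_on {0..pi}" and a: "0 \<le> a" "a \<le> d" "d \<le> pi"
  shows "\<exists>y dy z dz. jsol q \<beta> \<gamma> d l a y dy z dz \<and> y a = y0 \<and> dy a = y1"
proof -
  have q1: "(\<lambda>x. q x - l) absolutely_integrable_on {a..d}" "(\<lambda>x. q x - l) absolutely_integrable_on {d..pi}"
    by (rule absolutely_integrable_on_subinterval[OF abs_int_diff_const[OF q]]; use a in auto)+
  obtain y dy where y: "sol (\<lambda>x. q x - l) a d y dy" "y a = y0" "dy a = y1"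
    using sol_exists[OF q1(1) a(2)] by blast
  obtain z dz where "sol (\<lambda>x. q x - l) d pi z dz" "z d = of_real \<beta> * y d"
      "dz d = of_real (inverse \<beta>) * dy d + \<gamma> * y d"
    using sol_exists[OF q1(2) a(3)] by blast
  with y show ?thesis unfolding jsol_def by blast
qed

lemma jsol_exists_right:
  assumes q: "q absolutely_integrable_on {0..pi}" and d: "0 \<le> d" "d \<le> pi" and \<beta>: "\<beta> \<noteq> 0"
  shows "\<exists>y dy z dz. jsol q \<beta> \<gamma> d l 0 y dy z dz \<and> z pi = z0 \<and> dz pi = z1"
proof -
  have q1: "(\<lambda>x. q x - l) absolutely_integrable_on {0..d}" "(\<lambda>x. q x - l) absolutely_integrable_on {d..pi}"
    by (rule absolutely_integrable_on_subinterval[OF abs_int_diff_const[OF q]]; use d in auto)+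
  obtain z dz where z: "sol (\<lambda>x. q x - l) d pi z dz" "z pi = z0" "dz pi = z1"
    using sol_exists_right[OF q1(2) d(2)] by blast
  obtain y dy where y: "sol (\<lambda>x. q x - l) 0 d y dy" "y d = z d / of_real \<beta>"
      "dy d = of_real \<beta> * (dz d - \<gamma> * (z d / of_real \<beta>))"
    using sol_exists_right[OF q1(1) d(1)] by blast
  have zd: "z d = of_real \<beta> * y d" using y \<beta> by simp
  have "dy d = of_real \<beta> * (dz d - \<gamma> * y d)" using y by simp
  then have "dz d = of_real (inverse \<beta>) * dy d + \<gamma> * y d" using \<beta> by (simp add: mult.assoc[symmetric])
  with y z zd show ?thesis unfolding jsol_def by blast
qed

text \<open>The jump acts on Cauchy data by a matrix of determinant
  \<open>\<beta> * inverse \<beta> = 1\<close>, in which \<open>\<gamma>\<close> is off the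
  diagonal, so the Wronskian passes through \<open>d\<close> unchanged.\<close>

lemma jsol_wronskian:
  assumes y: "jsol q \<beta> \<gamma> d l a y dy z dz" and u: "jsol q \<beta> \<gamma> d l c u du v dv"
    and x: "a \<le> x" "c \<le> x" "x \<le> d" and t: "d \<le> t" "t \<le> pi" and \<beta>: "\<beta> \<noteq> 0"
  shows "y x * du x - dy x * u x = z t * dv t - dz t * v t"
proof -
  have "sol (\<lambda>x. q x - l) x d y dy" "sol (\<lambda>x. q x - l) x d u du"
    using y u x unfolding jsol_def by (auto intro: sol_subset)
  from sol_wronskian[OF this, of x d] x
  have "y x * du x - dy x * u x = y d * du d - dy d * u d" by auto
  also have "\<dots> = (of_real \<beta> * of_real (inverse \<beta>)) * (y d * du d - dy d * u d)"
    using \<beta> by (simp flip: of_real_mult)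
  also have "\<dots> = z d * dv d - dz d * v d"
    using y u unfolding jsol_def by (simp add: algebra_simps)
  also have "\<dots> = z t * dv t - dz t * v t"
    using sol_wronskian[of "\<lambda>x. q x - l" d pi z dz v dv d t] y u t unfolding jsol_def by auto
  finally show ?thesis .
qed

section \<open>From the half-open formulation of phi to solutions on closed intervals\<close>

lemma tendsto_at_left_sol:
  assumes "sol P a b y dy" "a < b"
  shows "(y \<longlongrightarrow> y b) (at_left b)" "(dy \<longlongrightarrow> dy b) (at_left b)"
  using sol_continuous[OF assms(1)] assms(2)
  by (auto simp: continuous_on_def at_within_Icc_at_left dest!: bspec[of _ _ b])

lemma tendsto_at_right_sol:
  assumes "sol P a b y dy" "a < b"
  shows "(y \<longlongrightarrow> y a) (at_right a)" "(dy \<longlongrightarrow> dy a) (at_right a)"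
  using sol_continuous[OF assms(1)] assms(2)
  by (auto simp: continuous_on_def at_within_Icc_at_right dest!: bspec[of _ _ a])

lemma sol_imp_sl_solution:
  assumes s: "sol (\<lambda>x. q x - l) a b y dy" and I: "I \<subseteq> {a..b}" "is_interval I"
    and eq: "\<And>x. x \<in> I \<Longrightarrow> u x = y x" "\<And>x. x \<in> I \<Longrightarrow> du x = dy x"
  shows "sl_solution q l I u du"
  unfolding sl_solution_def
proof (intro conjI ballI exI)
  fix x assume x: "x \<in> I"
  have "(y has_vector_derivative dy x) (at x within I)"
    using s x I unfolding sol_def by (meson has_vector_derivative_within_subset subsetD)
  then show "(u has_vector_derivative du x) (at x within I)"
    using has_vector_derivative_transform[OF x, of u y "dy x"] eq x by simp
next
  show "ac_deriv_on I du (\<lambda>x. (q x - l) * u x)"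
    by (rule ac_deriv_on_cong[OF ac_deriv_on_subset[OF sol_ac(2)[OF s] I(1)] I(2)]) (use eq in auto)
  show "AE x in lebesgue. x \<in> I \<longrightarrow> - ((q x - l) * u x) + q x * u x = l * u x"
    by (simp add: algebra_simps)
qed

text \<open>The density \<open>ddy\<close> of \<open>dy\<close> agrees with
  \<open>(q - l) * y\<close> only off a null set, which integrals do not see; so it may be replaced
  by that expression.\<close>

lemma sl_solution_imp_sol:
  assumes s: "sl_solution q l I y dy" and I: "{a..b} \<subseteq> I"
  shows "sol (\<lambda>x. q x - l) a b y dy"
proof -
  obtain ddy where ac: "ac_deriv_on I dy ddy" and ae: "AE x in lebesgue. x \<in> I \<longrightarrow> - ddy x + q x * y x = l * y x"
    using s unfolding sl_solution_def by blast
  from ae obtain N where N: "N \<in> null_sets lebesgue" "{x. \<not> (x \<in> I \<longrightarrow> - ddy x + q x * y x = l * y x)} \<subseteq> N"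
    unfolding eventually_ae_filter by auto
  have neg: "negligible N" using N(1) by (simp add: negligible_iff_null_sets)
  have dd: "(q x - l) * y x = ddy x" if "x \<in> {a..b} - N" for x
  proof -
    have "- ddy x + q x * y x = l * y x" using that N(2) I by blast
    then show ?thesis by (simp add: algebra_simps)
  qed
  show ?thesis unfolding sol_def
  proof (intro conjI ballI)
    fix x assume "x \<in> {a..b}"
    then show "(y has_vector_derivative dy x) (at x within {a..b})"
      using s I unfolding sl_solution_def by (meson has_vector_derivative_within_subset subsetD)
  next
    show "ac_deriv_on {a..b} dy (\<lambda>x. (q x - l) * y x)"
      unfolding ac_deriv_on_def
    proof (intro ballI impI conjI)
      fix s t assume st: "s \<in> {a..b}" "t \<in> {a..b}" "s \<le> t"
      then have *: "ddy absolutely_integrable_on {s..t}" "dy t - dy s = integral {s..t} ddy"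
        using ac I unfolding ac_deriv_on_def by blast+
      have e: "(q x - l) * y x = ddy x" if "x \<in> {s..t} - N" for x
        using dd[of x] that st by auto
      show "(\<lambda>x. (q x - l) * y x) absolutely_integrable_on {s..t}"
        by (rule absolutely_integrable_spike[OF *(1) neg e])
      show "dy t - dy s = integral {s..t} (\<lambda>x. (q x - l) * y x)"
        unfolding *(2) by (rule integral_spike[OF neg e])
    qed
  qed
qed

lemma jsol_is_phi:
  assumes j: "jsol q \<beta> \<gamma> d l 0 Y dY Z dZ" "Y 0 = 1" "dY 0 = h" and d: "0 < d" "d < pi"
  shows "is_phi q h \<beta> \<gamma> d l (\<lambda>x. if x < d then Y x else Z x) (\<lambda>x. if x < d then dY x else dZ x)"
proof -
  have sL: "sol (\<lambda>x. q x - l) 0 d Y dY" and sR: "sol (\<lambda>x. q x - l) d pi Z dZ"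
    and J: "Z d = of_real \<beta> * Y d" "dZ d = of_real (inverse \<beta>) * dY d + \<gamma> * Y d"
    using j unfolding jsol_def by auto
  have evL: "eventually (\<lambda>x. x < d) (at_left d)" and evR: "eventually (\<lambda>x. \<not> x < d) (at_right d)"
    by (auto simp: eventually_at_filter)
  have L: "((\<lambda>x. if x < d then f x else g x) \<longlongrightarrow> c) (at_left d)" if "(f \<longlongrightarrow> c) (at_left d)"
    for f g :: "real \<Rightarrow> complex" and c
    by (rule Lim_transform_eventually[OF that]) (use evL in \<open>auto elim: eventually_mono\<close>)
  have R: "((\<lambda>x. if x < d then f x else g x) \<longlongrightarrow> c) (at_right d)" if "(g \<longlongrightarrow> c) (at_right d)"
    for f g :: "real \<Rightarrow> complex" and c
    by (rule Lim_transform_eventually[OF that]) (use evR in \<open>auto elim: eventually_mono\<close>)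
  show ?thesis
    unfolding is_phi_def
  proof (intro conjI)
    show "sl_solution q l {0..<d} (\<lambda>x. if x < d then Y x else Z x) (\<lambda>x. if x < d then dY x else dZ x)"
      by (rule sol_imp_sl_solution[OF sL]) (auto simp: is_interval_co)
    show "sl_solution q l {d<..pi} (\<lambda>x. if x < d then Y x else Z x) (\<lambda>x. if x < d then dY x else dZ x)"
      by (rule sol_imp_sl_solution[OF sR]) (auto simp: is_interval_oc)
    show "jump_cond \<beta> \<gamma> d (\<lambda>x. if x < d then Y x else Z x) (\<lambda>x. if x < d then dY x else dZ x)"
      unfolding jump_cond_def J[symmetric]
      using tendsto_at_left_sol[OF sL d(1)] tendsto_at_right_sol[OF sR d(2)] J
      by (intro exI[of _ "Y d"] exI[of _ "dY d"] conjI L R) simp_all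
  qed (use j d in auto)
qed

text \<open>On the right, \<open>is_phi\<close> gives a solution only on the half-open interval,
  with data at \<open>d\<close> in the form of limits. The a priori bound is therefore applied to
  the difference from a point \<open>c > d\<close> on, with a constant independent of
  \<open>c\<close>, and \<open>c\<close> tends to \<open>d\<close>.\<close>

lemma is_phi_unique:
  assumes q: "q absolutely_integrable_on {0..pi}" and d: "0 < d" "d < pi"
    and phi: "is_phi q h \<beta> \<gamma> d l y dy"
    and j: "jsol q \<beta> \<gamma> d l 0 Y dY Z dZ" "Y 0 = 1" "dY 0 = h" and x: "d < x" "x \<le> pi"
  shows "y x = Z x" "dy x = dZ x"
proof -
  have ql: "(\<lambda>x. q x - l) absolutely_integrable_on {0..pi}" by (rule abs_int_diff_const[OF q])
  have sL: "sol (\<lambda>x. q x - l) 0 d Y dY" and sR: "sol (\<lambda>x. q x - l) d pi Z dZ"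
    and J: "Z d = of_real \<beta> * Y d" "dZ d = of_real (inverse \<beta>) * dY d + \<gamma> * Y d"
    using j unfolding jsol_def by auto
  have pL: "sl_solution q l {0..<d} y dy" and pR: "sl_solution q l {d<..pi} y dy"
    and pJ: "jump_cond \<beta> \<gamma> d y dy" and p0: "y 0 = 1" "dy 0 = h"
    using phi unfolding is_phi_def by auto
  have L: "y c = Y c \<and> dy c = dY c" if c: "0 < c" "c < d" for c
  proof -
    have s1: "sol (\<lambda>x. q x - l) 0 c y dy" by (rule sl_solution_imp_sol[OF pL]) (use c in auto)
    have s2: "sol (\<lambda>x. q x - l) 0 c Y dY" by (rule sol_subset[OF sL]) (use c in auto)
    have "(\<lambda>x. q x - l) absolutely_integrable_on {0..c}"
      by (rule absolutely_integrable_on_subinterval[OF ql]) (use c d in auto)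
    from sol_unique[OF s1 s2 this, of c] show ?thesis using p0 j c by auto
  qed
  have ev: "eventually (\<lambda>x. 0 < x \<and> x < d) (at_left d)"
    using d eventually_at_left[of 0 d] by (auto intro!: exI[of _ 0])
  have lim: "(y \<longlongrightarrow> Y d) (at_left d)" "(dy \<longlongrightarrow> dY d) (at_left d)"
    using tendsto_at_left_sol[OF sL d(1)] ev L
    by (auto elim!: Lim_transform_eventually eventually_mono)
  obtain u v where uv: "(y \<longlongrightarrow> u) (at_left d)" "(dy \<longlongrightarrow> v) (at_left d)"
     "(y \<longlongrightarrow> of_real \<beta> * u) (at_right d)" "(dy \<longlongrightarrow> of_real (inverse \<beta>) * v + \<gamma> * u) (at_right d)"
    using pJ unfolding jump_cond_def by blast
  have "u = Y d" "v = dY d"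
    using tendsto_unique[OF trivial_limit_at_left_real uv(1) lim(1)]
      tendsto_unique[OF trivial_limit_at_left_real uv(2) lim(2)] by auto
  with uv J have yR: "(y \<longlongrightarrow> Z d) (at_right d)" "(dy \<longlongrightarrow> dZ d) (at_right d)" by auto
  define K where "K = exp (integral {d..pi} (\<lambda>t. 1 + norm (q t - l)))"
  have gi: "(\<lambda>t. 1 + norm (q t - l)) integrable_on {0..pi}"
    by (intro integrable_add abs_integrable_imp_norm ql) auto
  have B: "norm (y x - Z x) + norm (dy x - dZ x) \<le> (norm (y c - Z c) + norm (dy c - dZ c)) * K"
    if c: "d < c" "c < x" for c
  proof -
    have s1: "sol (\<lambda>x. q x - l) c pi y dy" by (rule sl_solution_imp_sol[OF pR]) (use c in auto)
    have s2: "sol (\<lambda>x. q x - l) c pi Z dZ" by (rule sol_subset[OF sR]) (use c in auto)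
    have s: "sol (\<lambda>x. q x - l) c pi (\<lambda>x. 1 * y x + (-1) * Z x) (\<lambda>x. 1 * dy x + (-1) * dZ x)"
      by (rule sol_lincomb[OF s1 s2])
    have qc: "(\<lambda>x. q x - l) absolutely_integrable_on {c..pi}"
      by (rule absolutely_integrable_on_subinterval[OF ql]) (use c d in auto)
    have "norm (y x - Z x) + norm (dy x - dZ x) \<le> (norm (y c - Z c) + norm (dy c - dZ c)) * exp (integral {c..pi} (\<lambda>t. 1 + norm (q t - l)))"
      using sol_bound[OF s qc, of x] c x by simp
    also have "\<dots> \<le> (norm (y c - Z c) + norm (dy c - dZ c)) * K"
    proof -
      have "integral {c..pi} (\<lambda>t. 1 + norm (q t - l)) \<le> integral {d..pi} (\<lambda>t. 1 + norm (q t - l))"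
        by (rule integral_subset_le) (use c x d in \<open>auto intro: integrable_on_subinterval[OF gi]\<close>)
      then show ?thesis unfolding K_def by (intro mult_left_mono) auto
    qed
    finally show ?thesis .
  qed
  have "norm (y x - Z x) + norm (dy x - dZ x) \<le> 0"
  proof (rule tendsto_lowerbound)
    have "((\<lambda>c. (norm (y c - Z c) + norm (dy c - dZ c)) * K) \<longlongrightarrow> (norm (Z d - Z d) + norm (dZ d - dZ d)) * K) (at_right d)"
      by (intro tendsto_intros yR tendsto_at_right_sol[OF sR d(2)])
    then show "((\<lambda>c. (norm (y c - Z c) + norm (dy c - dZ c)) * K) \<longlongrightarrow> 0) (at_right d)" by simp
    show "eventually (\<lambda>c. norm (y x - Z x) + norm (dy x - dZ x) \<le> (norm (y c - Z c) + norm (dy c - dZ c)) * K) (at_right d)"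
      using eventually_at_right_less[of d] eventually_at_right[of d x] x(1) B
      by (auto simp: eventually_at_right_field intro!: exI[of _ x])
  qed (rule trivial_limit_at_right_real)
  then have "norm (y x - Z x) = 0" "norm (dy x - dZ x) = 0" by (smt (verit) norm_ge_zero)+
  then show "y x = Z x" "dy x = dZ x" by auto
qed

text \<open>This discharges the choice operator in \<open>phi_pair\<close>: existence makes the
  chosen pair a solution, and uniqueness identifies its end values with those of any
  \<open>jsol\<close> family.\<close>

lemma phi_family:
  assumes q: "q absolutely_integrable_on {0..pi}" and d: "0 < d" "d < pi"
  obtains Y dY Z dZ where "\<And>l. jsol q \<beta> \<gamma> d l 0 (Y l) (dY l) (Z l) (dZ l)"
    "\<And>l. Y l 0 = 1" "\<And>l. dY l 0 = h"
    "\<And>l. phi q h \<beta> \<gamma> d pi l = Z l pi" "\<And>l. dphi q h \<beta> \<gamma> d pi l = dZ l pi"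
proof -
  have "\<forall>l. \<exists>y dy z dz. jsol q \<beta> \<gamma> d l 0 y dy z dz \<and> y 0 = 1 \<and> dy 0 = h"
    using jsol_exists[OF q, of 0 d] d by auto
  then obtain Y dY Z dZ where j: "\<And>l. jsol q \<beta> \<gamma> d l 0 (Y l) (dY l) (Z l) (dZ l)"
    "\<And>l. Y l 0 = 1" "\<And>l. dY l 0 = h" by metis
  have "phi q h \<beta> \<gamma> d pi l = Z l pi \<and> dphi q h \<beta> \<gamma> d pi l = dZ l pi" for l
  proof -
    have "case phi_pair q h \<beta> \<gamma> d l of (y, dy) \<Rightarrow> is_phi q h \<beta> \<gamma> d l y dy"
      unfolding phi_pair_def
      using someI[where P = "\<lambda>(y, dy). is_phi q h \<beta> \<gamma> d l y dy" and
          x = "(\<lambda>x. if x < d then Y l x else Z l x, \<lambda>x. if x < d then dY l x else dZ l x)"]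
        jsol_is_phi[OF j d] by simp
    then have p: "is_phi q h \<beta> \<gamma> d l (fst (phi_pair q h \<beta> \<gamma> d l)) (snd (phi_pair q h \<beta> \<gamma> d l))"
      by (simp add: case_prod_beta)
    show ?thesis unfolding phi_def dphi_def
      using is_phi_unique[OF q d p j d(2) order_refl] by simp
  qed
  then show ?thesis using that[OF j] by blast
qed

text \<open>Holomorphy was shown for Cauchy data independent of the parameter, but the data at
  \<open>d\<close> depend on it. On \<open>[d, pi]\<close> the solution is therefore expanded in the
  fundamental system with constant data at \<open>d\<close>, with coefficients that are entire by
  the result on \<open>[a, d]\<close>.\<close>

lemma jsol_entire:
  assumes q: "q absolutely_integrable_on {0..pi}" and a: "0 \<le> a" "a \<le> d" "d \<le> pi"
    and j: "\<And>l. jsol q \<beta> \<gamma> d l a (Y l) (dY l) (Z l) (dZ l)"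
    and eq: "\<And>l. Y l a = y0" "\<And>l. dY l a = y1"
  shows "(\<lambda>l. Z l pi) holomorphic_on UNIV" "(\<lambda>l. dZ l pi) holomorphic_on UNIV"
    "order_half (\<lambda>l. Z l pi)" "order_half (\<lambda>l. dZ l pi)"
proof -
  have qL: "q absolutely_integrable_on {a..d}" and qR: "q absolutely_integrable_on {d..pi}"
    by (rule absolutely_integrable_on_subinterval[OF q]; use a in auto)+
  have sL: "\<And>l. sol (\<lambda>x. q x - l) a d (Y l) (dY l)" and sR: "\<And>l. sol (\<lambda>x. q x - l) d pi (Z l) (dZ l)"
    and J: "\<And>l. Z l d = of_real \<beta> * Y l d" "\<And>l. dZ l d = of_real (inverse \<beta>) * dY l d + \<gamma> * Y l d"
    using j unfolding jsol_def by auto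
  have "\<forall>l. \<exists>y dy. sol (\<lambda>x. q x - l) d pi y dy \<and> y d = 1 \<and> dy d = 0"
    using sol_exists[OF abs_int_diff_const[OF qR] a(3)] by blast
  then obtain c dc where c: "\<And>l. sol (\<lambda>x. q x - l) d pi (c l) (dc l)" "\<And>l. c l d = 1" "\<And>l. dc l d = 0"
    by metis
  have "\<forall>l. \<exists>y dy. sol (\<lambda>x. q x - l) d pi y dy \<and> y d = 0 \<and> dy d = 1"
    using sol_exists[OF abs_int_diff_const[OF qR] a(3)] by blast
  then obtain s ds where s: "\<And>l. sol (\<lambda>x. q x - l) d pi (s l) (ds l)" "\<And>l. s l d = 0" "\<And>l. ds l d = 1"
    by metis
  have Z: "Z l pi = Z l d * c l pi + dZ l d * s l pi" "dZ l pi = Z l d * dc l pi + dZ l d * ds l pi" for l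
    using sol_unique[OF sR sol_lincomb[OF c(1) s(1)] abs_int_diff_const[OF qR], of l "Z l d" "dZ l d" pi] c s a by auto
  have h: "(\<lambda>l. Y l d) holomorphic_on UNIV" "(\<lambda>l. dY l d) holomorphic_on UNIV"
    by (rule sol_param_holomorphic[OF qL a(2) sL eq])+
  have hc: "(\<lambda>l. c l pi) holomorphic_on UNIV" "(\<lambda>l. dc l pi) holomorphic_on UNIV"
    by (rule sol_param_holomorphic[OF qR a(3) c])+
  have hs: "(\<lambda>l. s l pi) holomorphic_on UNIV" "(\<lambda>l. ds l pi) holomorphic_on UNIV"
    by (rule sol_param_holomorphic[OF qR a(3) s])+
  show "(\<lambda>l. Z l pi) holomorphic_on UNIV" "(\<lambda>l. dZ l pi) holomorphic_on UNIV"
    unfolding Z J by (intro holomorphic_intros h hc hs)+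
  have o: "order_half (\<lambda>l. Y l d)" "order_half (\<lambda>l. dY l d)"
    by (rule sol_order_half[OF qL a(2) sL]; simp add: eq order_half_const)+
  have oJ: "order_half (\<lambda>l. Z l d)" "order_half (\<lambda>l. dZ l d)"
    unfolding J by (intro order_half_add order_half_cmult o)+
  show "order_half (\<lambda>l. Z l pi)" "order_half (\<lambda>l. dZ l pi)"
    by (rule sol_order_half[OF qR a(3) sR oJ])+
qed

lemma jump_norm_bound:
  fixes y dy z dz k \<gamma> :: complex
  assumes z: "z = of_real \<beta> * y" "dz = of_real (inverse \<beta>) * dy + \<gamma> * y" and \<beta>: "\<beta> > 0" and k: "norm k \<ge> 1"
  shows "norm (dz + k * z) + norm (dz - k * z) \<le> (inverse \<beta> + norm \<gamma> + \<beta>) * (norm (dy + k * y) + norm (dy - k * y))"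
proof -
  let ?n = "norm (dy + k * y) + norm (dy - k * y)"
  have n: "2 * norm dy \<le> ?n" "2 * norm (k * y) \<le> ?n"
    using norm_plus_minus_bounds(1,2)[where u = dy and v = "k * y"] by auto
  have "norm y \<le> norm (k * y)" using k by (simp add: norm_mult mult_le_cancel_right1)
  have "norm (dz + k * z) + norm (dz - k * z) \<le> 2 * (norm dz + norm (k * z))"
    by (rule norm_plus_minus_bounds(3))
  also have "norm dz \<le> inverse \<beta> * norm dy + norm \<gamma> * norm y"
    unfolding z using \<beta> by (intro norm_triangle_le) (simp add: norm_mult norm_inverse)
  also have "norm (k * z) = \<beta> * norm (k * y)" unfolding z using \<beta> by (simp add: norm_mult)
  also have "2 * (inverse \<beta> * norm dy + norm \<gamma> * norm y + \<beta> * norm (k * y))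
     = inverse \<beta> * (2 * norm dy) + norm \<gamma> * (2 * norm y) + \<beta> * (2 * norm (k * y))" by (simp add: algebra_simps)
  also have "\<dots> \<le> inverse \<beta> * ?n + norm \<gamma> * ?n + \<beta> * ?n"
    using n \<open>norm y \<le> norm (k * y)\<close> \<beta> by (intro add_mono mult_left_mono) auto
  finally show ?thesis by (simp add: algebra_simps)
qed

lemma integral_norm_le:
  fixes q :: "real \<Rightarrow> complex"
  assumes q: "q absolutely_integrable_on {0..pi}" and a: "0 \<le> a" "b \<le> pi"
  shows "integral {a..b} (\<lambda>t. norm (q t)) \<le> integral {0..pi} (\<lambda>t. norm (q t))"
  by (rule integral_subset_le)
     (use a abs_integrable_imp_norm[OF q] in \<open>auto intro: integrable_on_subinterval[OF abs_integrable_imp_norm[OF q]]\<close>)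

text \<open>The factor 9 is 3 from the exponential estimate on each side of \<open>d\<close>; the
  jump contributes the bracket.\<close>

lemma jsol_upper:
  assumes q: "q absolutely_integrable_on {0..pi}" and d: "0 \<le> d" "d \<le> pi" and \<beta>: "\<beta> > 0"
    and j: "jsol q \<beta> \<gamma> d (- (k\<^sup>2)) a y dy z dz" and a: "0 \<le> a" "a \<le> d"
    and k: "norm k \<ge> 1" "norm k \<ge> integral {0..pi} (\<lambda>t. norm (q t))" "Re k \<ge> 0" and x: "x \<in> {d..pi}"
  shows "norm (dz x + k * z x) + norm (dz x - k * z x) \<le>
     (9 * (inverse \<beta> + norm \<gamma> + \<beta>)) * exp (Re k * (x - a)) * (norm (dy a + k * y a) + norm (dy a - k * y a))"
proof -
  let ?J = "inverse \<beta> + norm \<gamma> + \<beta>"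
  let ?N = "norm (dy a + k * y a) + norm (dy a - k * y a)"
  have J: "?J \<ge> 0" using \<beta> by simp
  have qL: "q absolutely_integrable_on {a..d}" and qR: "q absolutely_integrable_on {d..pi}"
    by (rule absolutely_integrable_on_subinterval[OF q]; use a d in auto)+
  have sL: "sol (\<lambda>x. q x - (- (k\<^sup>2))) a d y dy" and sR: "sol (\<lambda>x. q x - (- (k\<^sup>2))) d pi z dz"
    and zd: "z d = of_real \<beta> * y d" "dz d = of_real (inverse \<beta>) * dy d + \<gamma> * y d"
    using j unfolding jsol_def by auto
  have k0: "k \<noteq> 0" using k by auto
  have "norm (dz x + k * z x) + norm (dz x - k * z x) \<le> exp (Re k * (x - d)) * (3 * (norm (dz d + k * z d) + norm (dz d - k * z d)))"
    by (rule sol_exp_estimates(1)[OF sR refl qR integral_norm_le[OF q] k(2) k0 k(3) x]) (use a d in auto)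
  also have "\<dots> \<le> exp (Re k * (x - d)) * (3 * (?J * (norm (dy d + k * y d) + norm (dy d - k * y d))))"
    by (intro mult_left_mono jump_norm_bound[OF zd \<beta> k(1)]) auto
  also have "\<dots> \<le> exp (Re k * (x - d)) * (3 * (?J * (exp (Re k * (d - a)) * (3 * ?N))))"
    by (intro mult_left_mono sol_exp_estimates(1)[OF sL refl qL integral_norm_le[OF q] k(2) k0 k(3)]) (use a d J in auto)
  also have "\<dots> = (9 * ?J) * (exp (Re k * (x - d)) * exp (Re k * (d - a))) * ?N"
  proof -
    have "e1 * (3 * (J * (e2 * (3 * n)))) = (9 * J) * (e1 * e2) * n" for e1 e2 J n :: real by simp
    then show ?thesis .
  qed
  also have "exp (Re k * (x - d)) * exp (Re k * (d - a)) = exp (Re k * (x - a))"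
    by (simp add: exp_add[symmetric] algebra_simps)
  finally show ?thesis .
qed

section \<open>Asymptotics in a sector and the vanishing Wronskian\<close>

text \<open>Everything is measured relative to the end value \<open>Z pi\<close>: the logarithmic
  derivative at \<open>pi\<close> is close to \<open>k\<close>, and the solution decays from
  \<open>pi\<close> to the left like \<open>exp (- Re k * (pi - x))\<close>. The derivative is
  recorded only on \<open>[d, pi]\<close>, where Wronskians of the two problems are
  compared.\<close>

definition phi_est :: "real \<Rightarrow> real \<Rightarrow> real \<Rightarrow> complex \<Rightarrow>
    (real \<Rightarrow> complex) \<Rightarrow> (real \<Rightarrow> complex) \<Rightarrow> (real \<Rightarrow> complex) \<Rightarrow> (real \<Rightarrow> complex) \<Rightarrow> bool" where
  "phi_est d C \<epsilon> k Y dY Z dZ \<longleftrightarrow> Z pi \<noteq> 0 \<and> norm (dZ pi - k * Z pi) \<le> \<epsilon> * norm k * norm (Z pi) \<and>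
     (\<forall>x\<in>{0..d}. norm (Y x) \<le> C * exp (- Re k * (pi - x)) * norm (Z pi)) \<and>
     (\<forall>x\<in>{d..pi}. norm (Z x) \<le> C * exp (- Re k * (pi - x)) * norm (Z pi) \<and>
        norm (dZ x) \<le> C * norm k * exp (- Re k * (pi - x)) * norm (Z pi))"

text \<open>The component \<open>dY + k * Y\<close> starts with size comparable to
  \<open>norm k\<close>, grows exponentially, survives the jump and dominates
  \<open>dY - k * Y\<close> up to \<open>pi\<close>. The sector condition gives
  \<open>exp (- 2 * Re k * x) \<le> exp (- norm k * x)\<close>, so the decaying exponential is
  negligible for large \<open>norm k\<close>. The constant \<open>C\<close> is fixed before
  \<open>\<epsilon>\<close>; only the radius depends on \<open>\<epsilon>\<close>.\<close>

lemma phi_asymp: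
  assumes q: "q absolutely_integrable_on {0..pi}" and d: "0 < d" "d < pi" and \<beta>: "\<beta> > 0"
  shows "\<exists>C>0. \<forall>\<epsilon>>0. \<exists>R\<ge>1. \<forall>k Y dY Z dZ. R \<le> norm k \<longrightarrow> norm k \<le> 2 * Re k \<longrightarrow>
     jsol q \<beta> \<gamma> d (- (k\<^sup>2)) 0 Y dY Z dZ \<longrightarrow> Y 0 = 1 \<longrightarrow> dY 0 = h \<longrightarrow>
     phi_est d C \<epsilon> k Y dY Z dZ"
proof -
  have sc: "s * (2 * u) \<le> s * (2 * v) \<Longrightarrow> 1 \<le> s \<Longrightarrow> u \<le> v" for s u v :: real
    by (simp add: mult_le_cancel_left)
  define Q where "Q = integral {0..pi} (\<lambda>t. norm (q t))"
  have Q0: "Q \<ge> 0" unfolding Q_def by (intro integral_nonneg abs_integrable_imp_norm q) auto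
  define J where "J = inverse \<beta> + norm \<gamma> + \<beta>"
  have J0: "J > 0" unfolding J_def using \<beta> by (intro add_nonneg_pos add_nonneg_nonneg) auto
  \<comment> \<open>In the variables \<open>dY + k * Y\<close> and \<open>dY - k * Y\<close> the
    jump matrix has, up to \<open>\<gamma> / (2 * k)\<close>, diagonal entry \<open>p0\<close> and
    off-diagonal entry \<open>r0\<close>.\<close>
  define p0 r0 where "p0 = (inverse \<beta> + \<beta>) / 2" and "r0 = (inverse \<beta> - \<beta>) / 2"
  have "inverse \<beta> > 0" using \<beta> by simp
  then have p0: "p0 > 0" "\<bar>r0\<bar> \<le> p0"
    using \<beta> by (auto simp: p0_def r0_def add_pos_pos abs_le_iff field_simps)
  \<comment> \<open>The data after the jump are at most \<open>9 * J * E\<close>, while the growing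
    component is at least \<open>p0 * E / 2\<close>; \<open>J'\<close> is the quotient of the
    two.\<close>
  define J' where "J' = 18 * J / p0"
  have J': "J' > 0" using J0 p0 by (simp add: J'_def)
  define C where "C = 36 / p0 + 6 * J'"
  have C0: "C > 0" using p0 J' by (simp add: C_def add_pos_pos)
  have qL: "q absolutely_integrable_on {0..d}" and qR: "q absolutely_integrable_on {d..pi}"
    by (rule absolutely_integrable_on_subinterval[OF q]; use d in auto)+
  have QL: "integral {0..d} (\<lambda>t. norm (q t)) \<le> Q" and QR: "integral {d..pi} (\<lambda>t. norm (q t)) \<le> Q"
    unfolding Q_def by (rule integral_norm_le[OF q]; use d in auto)+
  show ?thesis
  proof (rule exI[of _ C], rule conjI[OF C0], intro allI impI)
    fix \<epsilon> :: real assume \<epsilon>: "\<epsilon> > 0"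
    \<comment> \<open>The three quantities made small are the relative errors at \<open>d\<close>
      and at \<open>pi\<close> and the contribution of \<open>\<gamma>\<close> to the jump.\<close>
    have l1: "((\<lambda>s. 2 * exp (- s * d) + 6 * Q / s) \<longlongrightarrow> 0) at_top" using d by real_asymp
    have l2: "((\<lambda>s. J' * (exp (- s * (pi - d)) + 2 * Q / s)) \<longlongrightarrow> 0) at_top"
    proof -
      have "pi - d > 0" using d by simp
      then show ?thesis by real_asymp
    qed
    have l3: "((\<lambda>s. norm \<gamma> / (2 * s)) \<longlongrightarrow> 0) at_top" by real_asymp
    have "eventually (\<lambda>s. 2 * exp (- s * d) + 6 * Q / s < 1/8 \<and>
        J' * (exp (- s * (pi - d)) + 2 * Q / s) < min (1/4) (\<epsilon>/4) \<and> norm \<gamma> / (2 * s) < p0/4 \<and>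
        s \<ge> 1 \<and> s \<ge> Q \<and> s \<ge> 3 * norm h) at_top"
      by (intro eventually_conj order_tendstoD(2)[OF l1] order_tendstoD(2)[OF l2] order_tendstoD(2)[OF l3] eventually_ge_at_top)
         (use \<epsilon> p0 in auto)
    then obtain R0 where R0: "\<And>s. s \<ge> R0 \<Longrightarrow> 2 * exp (- s * d) + 6 * Q / s < 1/8 \<and>
        J' * (exp (- s * (pi - d)) + 2 * Q / s) < min (1/4) (\<epsilon>/4) \<and> norm \<gamma> / (2 * s) < p0/4 \<and>
        s \<ge> 1 \<and> s \<ge> Q \<and> s \<ge> 3 * norm h"
      unfolding eventually_at_top_linorder by blast
    show "\<exists>R\<ge>1. \<forall>k Y dY Z dZ. R \<le> norm k \<longrightarrow> norm k \<le> 2 * Re k \<longrightarrow>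
     jsol q \<beta> \<gamma> d (- (k\<^sup>2)) 0 Y dY Z dZ \<longrightarrow> Y 0 = 1 \<longrightarrow> dY 0 = h \<longrightarrow>
     phi_est d C \<epsilon> k Y dY Z dZ"
    proof (rule exI[of _ "max 1 R0"], rule conjI[OF max.cobounded1], intro allI impI)
      fix k Y dY Z dZ
      assume kR: "max 1 R0 \<le> norm k" and kre: "norm k \<le> 2 * Re k"
        and j: "jsol q \<beta> \<gamma> d (- (k\<^sup>2)) 0 Y dY Z dZ" and ini: "Y 0 = 1" "dY 0 = h"
      define s where "s = norm k"
      define \<rho> where "\<rho> = Re k"
      define \<delta>1 where "\<delta>1 = 2 * exp (- s * d) + 6 * Q / s"
      define \<delta>2 where "\<delta>2 = J' * (exp (- s * (pi - d)) + 2 * Q / s)"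
      have S: "\<delta>1 < 1/8" "\<delta>2 < 1/4" "\<delta>2 < \<epsilon>/4" "norm \<gamma> / (2 * s) < p0/4" "s \<ge> 1" "s \<ge> Q" "s \<ge> 3 * norm h"
        using R0[of s] kR by (auto simp: s_def \<delta>1_def \<delta>2_def)
      have \<rho>: "s \<le> 2 * \<rho>" "\<rho> > 0" using kre S by (auto simp: s_def \<rho>_def)
      have k0: "k \<noteq> 0" using S by (auto simp: s_def)
      have kQ: "Q \<le> norm k" "0 \<le> Re k" using S \<rho> by (auto simp: s_def \<rho>_def)
      have \<delta>20: "\<delta>2 \<ge> 0" unfolding \<delta>2_def using J' Q0 S by (intro mult_nonneg_nonneg add_nonneg_nonneg) auto
      have sL: "sol (\<lambda>x. q x - (- (k\<^sup>2))) 0 d Y dY" and sR: "sol (\<lambda>x. q x - (- (k\<^sup>2))) d pi Z dZ"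
        and zd: "Z d = of_real \<beta> * Y d" "dZ d = of_real (inverse \<beta>) * dY d + \<gamma> * Y d"
        using j unfolding jsol_def by auto
      note estL = sol_exp_estimates[OF sL refl qL QL kQ(1) k0 kQ(2), unfolded ini mult_1_right]
      note estR = sol_exp_estimates[OF sR refl qR QR kQ(1) k0 kQ(2)]
      define A where "A = norm (h + k)"
      have A1: "A \<ge> 2 * s / 3" using norm_diff_ineq[of k h] S by (simp add: A_def s_def add.commute)
      have A0: "A > 0" using A1 S by linarith
      have B1: "norm (h - k) \<le> 2 * A" using norm_triangle_ineq4[of h k] A1 S by (simp add: s_def)
      have N0: "norm (h + k) + norm (h - k) \<le> 3 * A" using B1 by (simp add: A_def)
      define E where "E = exp (\<rho> * d) * A"
      have E0: "E > 0" using A0 by (simp add: E_def)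
      define a b where "a = dY d + k * Y d" and "b = dY d - k * Y d"
      have dd: "d \<in> {0..d}" "d \<in> {d..pi}" "pi \<in> {d..pi}" using d by auto
      have ab: "norm a + norm b \<le> 9 * E"
      proof -
        have "norm a + norm b \<le> exp (\<rho> * d) * (3 * (norm (h + k) + norm (h - k)))"
          using estL(1)[OF dd(1)] by (simp add: a_def b_def \<rho>_def)
        also have "\<dots> \<le> exp (\<rho> * d) * (3 * (3 * A))" using N0 by (intro mult_left_mono) auto
        finally show ?thesis by (simp add: E_def)
      qed
      have err: "exp (\<rho> * d) * (2 * Q / s * (norm (h + k) + norm (h - k))) \<le> E * (6 * Q / s)"
      proof -
        have "exp (\<rho> * d) * (2 * Q / s * (norm (h + k) + norm (h - k))) \<le> exp (\<rho> * d) * (2 * Q / s * (3 * A))"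
          using N0 Q0 S by (intro mult_left_mono) auto
        then show ?thesis by (simp add: E_def field_simps)
      qed
      have a1: "norm a \<ge> E * (7/8)"
      proof -
        have "norm (a - exp (k * of_real d) * (h + k)) \<le> E * (6 * Q / s)"
          using estL(2)[OF dd(1)] err by (simp add: a_def \<rho>_def s_def)
        moreover have "norm (exp (k * of_real d) * (h + k)) = E" by (simp add: norm_mult E_def A_def \<rho>_def)
        ultimately have "norm a \<ge> E - E * (6 * Q / s)"
          using norm_triangle_sub[of "exp (k * of_real d) * (h + k)" a] by (simp add: norm_minus_commute)
        moreover have "6 * Q / s \<le> 1/8" using S(1) exp_ge_zero[of "- s * d"] unfolding \<delta>1_def by linarith
        then have "E * (6 * Q / s) \<le> E * (1/8)" using E0 by (intro mult_left_mono) auto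
        ultimately show ?thesis by linarith
      qed
      have b1: "norm b \<le> E * (1/8)"
      proof -
        have "norm (b - exp (- k * of_real d) * (h - k)) \<le> E * (6 * Q / s)"
          using estL(3)[OF dd(1)] err by (simp add: b_def \<rho>_def s_def)
        moreover have "norm (exp (- k * of_real d) * (h - k)) \<le> E * (2 * exp (- s * d))"
        proof -
          have "norm (exp (- k * of_real d) * (h - k)) = exp (- \<rho> * d) * norm (h - k)" by (simp add: norm_mult \<rho>_def)
          also have "\<dots> \<le> exp (- \<rho> * d) * (2 * A)" using B1 by (intro mult_left_mono) auto
          also have "\<dots> = E * (2 * exp (- (2 * \<rho>) * d))" by (simp add: E_def exp_add[symmetric] algebra_simps)
          also have "\<dots> \<le> E * (2 * exp (- s * d))" using E0 d \<rho> by (intro mult_left_mono) auto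
          finally show ?thesis .
        qed
        ultimately have "norm b \<le> E * \<delta>1"
          using norm_triangle_sub[of b "exp (- k * of_real d) * (h - k)"] by (simp add: \<delta>1_def distrib_left)
        also have "\<dots> \<le> E * (1/8)" using E0 S by (intro mult_left_mono) auto
        finally show ?thesis .
      qed
      define a' b' where "a' = dZ d + k * Z d" and "b' = dZ d - k * Z d"
      have a'eq: "a' = (of_real p0 + \<gamma> / (2 * k)) * a + (of_real r0 - \<gamma> / (2 * k)) * b"
      proof -
        define U V g where "U = complex_of_real (inverse \<beta>) / 2" and "V = complex_of_real \<beta> / 2" and "g = \<gamma> / (2 * k)"
        have "of_real (inverse \<beta>) * dY d = U * (a + b)" "\<gamma> * Y d = g * (a - b)" "k * (of_real \<beta> * Y d) = V * (a - b)"
          using k0 by (auto simp: a_def b_def U_def V_def g_def)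
        then have "a' = U * (a + b) + g * (a - b) + V * (a - b)" unfolding a'_def zd by simp
        moreover have "complex_of_real p0 = U + V" "complex_of_real r0 = U - V"
          by (auto simp: p0_def r0_def U_def V_def add_divide_distrib diff_divide_distrib)
        ultimately show ?thesis unfolding g_def[symmetric] by (simp only:) (simp add: algebra_simps)
      qed
      \<comment> \<open>With this, the growing component after the jump is at least
        \<open>3/4 * 7/8 - 5/4 * 1/8 = 1/2\<close> times \<open>p0 * E\<close>.\<close>
      have gk: "norm (\<gamma> / (2 * k)) \<le> p0 / 4" using S by (simp add: norm_divide norm_mult s_def)
      have a'1: "norm a' \<ge> p0 * E / 2"
      proof -
        have P: "norm (of_real p0 + \<gamma> / (2 * k)) \<ge> 3/4 * p0"
          using norm_diff_ineq[of "of_real p0" "\<gamma> / (2 * k)"] gk p0 by (simp del: norm_divide)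
        have R: "norm (of_real r0 - \<gamma> / (2 * k)) \<le> 5/4 * p0"
          using norm_triangle_ineq4[of "of_real r0" "\<gamma> / (2 * k)"] gk p0 by (simp del: norm_divide)
        have "norm a' \<ge> norm ((of_real p0 + \<gamma> / (2 * k)) * a) - norm ((of_real r0 - \<gamma> / (2 * k)) * b)"
          unfolding a'eq by (rule norm_diff_ineq)
        moreover have "norm ((of_real p0 + \<gamma> / (2 * k)) * a) \<ge> (3/4 * p0) * (E * (7/8))"
          unfolding norm_mult using P a1 p0 E0 by (intro mult_mono) auto
        moreover have "norm ((of_real r0 - \<gamma> / (2 * k)) * b) \<le> (5/4 * p0) * (E * (1/8))"
          unfolding norm_mult using R b1 p0 E0 by (intro mult_mono) auto
        ultimately show ?thesis by (simp add: field_simps)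
      qed
      define n where "n = norm a'"
      have "0 < p0 * E / 2" using p0 E0 by simp
      then have n0: "n > 0" unfolding n_def using a'1 by (rule less_le_trans)
      have N1: "norm a' + norm b' \<le> J' * n"
      proof -
        have "norm a' + norm b' \<le> J * (norm a + norm b)"
          unfolding a'_def b'_def a_def b_def J_def using S
          by (intro jump_norm_bound[OF zd \<beta>]) (simp add: s_def)
        also have "\<dots> \<le> J * (9 * E)" using ab J0 by (intro mult_left_mono) auto
        also have "\<dots> = J' * (p0 * E / 2)" using p0 by (simp add: J'_def)
        also have "\<dots> \<le> J' * n" unfolding n_def using a'1 J' by (intro mult_left_mono) auto
        finally show ?thesis .
      qed
      define F where "F = exp (\<rho> * (pi - d)) * n"
      have F0: "F > 0" using n0 by (simp add: F_def)
      have err2: "exp (\<rho> * (pi - d)) * (2 * Q / s * (norm a' + norm b')) \<le> F * (J' * (2 * Q / s))"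
      proof -
        have "exp (\<rho> * (pi - d)) * (2 * Q / s * (norm a' + norm b')) \<le> exp (\<rho> * (pi - d)) * (2 * Q / s * (J' * n))"
          using N1 Q0 S by (intro mult_left_mono) auto
        then show ?thesis by (simp add: F_def mult_ac)
      qed
      define ap bp where "ap = dZ pi + k * Z pi" and "bp = dZ pi - k * Z pi"
      have le2: "J' * (2 * Q / s) \<le> \<delta>2" unfolding \<delta>2_def using J' by (intro mult_left_mono) auto
      have ap1: "norm ap \<ge> F - F * \<delta>2"
      proof -
        have "norm (ap - exp (k * of_real (pi - d)) * a') \<le> F * (J' * (2 * Q / s))"
          using estR(2)[OF dd(3)] err2 by (simp add: ap_def a'_def b'_def \<rho>_def s_def)
        also have "\<dots> \<le> F * \<delta>2" using le2 F0 by (intro mult_left_mono) auto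
        finally have "norm (ap - exp (k * of_real (pi - d)) * a') \<le> F * \<delta>2" .
        moreover have "norm (exp (k * of_real (pi - d)) * a') = F"
          by (simp add: norm_mult F_def n_def \<rho>_def)
        ultimately show ?thesis
          using norm_triangle_sub[of "exp (k * of_real (pi - d)) * a'" ap] by (simp add: norm_minus_commute)
      qed
      have bp1: "norm bp \<le> F * \<delta>2"
      proof -
        have "norm (bp - exp (- k * of_real (pi - d)) * b') \<le> F * (J' * (2 * Q / s))"
          using estR(3)[OF dd(3)] err2 by (simp add: bp_def a'_def b'_def \<rho>_def s_def)
        moreover have "norm (exp (- k * of_real (pi - d)) * b') \<le> F * (J' * exp (- s * (pi - d)))"
        proof -
          have "norm b' \<le> J' * n" using N1 norm_ge_zero[of a'] by linarith
          then have "exp (- \<rho> * (pi - d)) * norm b' \<le> exp (- \<rho> * (pi - d)) * (J' * n)" by (intro mult_left_mono) auto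
          also have "\<dots> = F * (J' * exp (- (2 * \<rho>) * (pi - d)))"
          proof -
            have "exp (- \<rho> * (pi - d)) = exp (\<rho> * (pi - d)) * exp (- (2 * \<rho>) * (pi - d))"
              by (simp add: exp_add[symmetric])
            then show ?thesis by (simp add: F_def)
          qed
          also have "\<dots> \<le> F * (J' * exp (- s * (pi - d)))"
            using F0 d \<rho> J' by (intro mult_left_mono) auto
          finally show ?thesis by (simp add: norm_mult \<rho>_def)
        qed
        ultimately show ?thesis
          using norm_triangle_sub[of bp "exp (- k * of_real (pi - d)) * b'"] by (simp add: \<delta>2_def distrib_left)
      qed
      \<comment> \<open>As \<open>2 * k * Z pi = ap - bp\<close> and each error is at most a quarter
        of \<open>F\<close>, at least half of \<open>F\<close> remains. In particular
        \<open>Z pi\<close> does not vanish.\<close>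
      have FZ: "F \<le> 4 * s * norm (Z pi)"
      proof -
        have "F * \<delta>2 \<le> F * (1/4)" using S F0 by (intro mult_left_mono) auto
        moreover have "2 * k * Z pi = ap - bp" by (simp add: ap_def bp_def)
        then have "2 * s * norm (Z pi) = norm (ap - bp)" by (metis norm_mult norm_numeral s_def)
        ultimately show ?thesis using norm_triangle_ineq2[of ap bp] ap1 bp1 by simp
      qed
      show "phi_est d C \<epsilon> k Y dY Z dZ"
        unfolding phi_est_def
      proof (intro conjI ballI)
        show "Z pi \<noteq> 0" using FZ F0 by auto
        have "norm bp \<le> F * (\<epsilon>/4)" using bp1 F0 S(3) mult_left_mono[of \<delta>2 "\<epsilon>/4" F] by linarith
        also have "\<dots> \<le> (4 * s * norm (Z pi)) * (\<epsilon>/4)" using FZ \<epsilon> by (intro mult_right_mono) auto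
        finally show "norm (dZ pi - k * Z pi) \<le> \<epsilon> * norm k * norm (Z pi)" by (simp add: bp_def s_def mult_ac)
      next
        fix x assume x: "x \<in> {0..d}"
        have "2 * (s * norm (Y x)) \<le> norm (dY x + k * Y x) + norm (dY x - k * Y x)"
          using norm_plus_minus_bounds(2)[where u = "dY x" and v = "k * Y x"] by (simp add: norm_mult s_def)
        also have "\<dots> \<le> exp (\<rho> * x) * (3 * (norm (h + k) + norm (h - k)))"
          using estL(1)[OF x] by (simp add: \<rho>_def)
        also have "\<dots> \<le> exp (\<rho> * x) * (3 * (3 * A))" using N0 by (intro mult_left_mono) auto
        also have "A = exp (- \<rho> * d) * E" by (simp add: E_def exp_minus)
        also have "exp (\<rho> * x) * (3 * (3 * (exp (- \<rho> * d) * E))) = 18 / p0 * (exp (\<rho> * x) * exp (- \<rho> * d)) * (p0 * E / 2)"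
          using p0 by simp
        also have "\<dots> \<le> 18 / p0 * (exp (\<rho> * x) * exp (- \<rho> * d)) * n"
          unfolding n_def using a'1 p0 by (intro mult_left_mono) auto
        also have "n = exp (- \<rho> * (pi - d)) * F" by (simp add: F_def exp_minus)
        also have "18 / p0 * (exp (\<rho> * x) * exp (- \<rho> * d)) * (exp (- \<rho> * (pi - d)) * F) = 18 / p0 * exp (- \<rho> * (pi - x)) * F"
          by (simp add: exp_add[symmetric] algebra_simps)
        also have "\<dots> \<le> 18 / p0 * exp (- \<rho> * (pi - x)) * (4 * s * norm (Z pi))"
          using FZ p0 by (intro mult_left_mono) auto
        finally have "s * (2 * norm (Y x)) \<le> s * (2 * (36 / p0 * exp (- \<rho> * (pi - x)) * norm (Z pi)))"
          by (simp add: mult_ac)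
        then have "norm (Y x) \<le> 36 / p0 * exp (- \<rho> * (pi - x)) * norm (Z pi)"
          using S(5) by (rule sc)
        also have "\<dots> \<le> C * exp (- \<rho> * (pi - x)) * norm (Z pi)"
          unfolding C_def using J' by (intro mult_right_mono) auto
        finally show "norm (Y x) \<le> C * exp (- Re k * (pi - x)) * norm (Z pi)" by (simp add: \<rho>_def)
      next
        fix x assume x: "x \<in> {d..pi}"
        have "norm (dZ x + k * Z x) + norm (dZ x - k * Z x) \<le> exp (\<rho> * (x - d)) * (3 * (norm a' + norm b'))"
          using estR(1)[OF x] by (simp add: \<rho>_def a'_def b'_def)
        also have "\<dots> \<le> exp (\<rho> * (x - d)) * (3 * (J' * n))" using N1 by (intro mult_left_mono) auto
        also have "n = exp (- \<rho> * (pi - d)) * F" by (simp add: F_def exp_minus)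
        also have "exp (\<rho> * (x - d)) * (3 * (J' * (exp (- \<rho> * (pi - d)) * F))) = 3 * J' * exp (- \<rho> * (pi - x)) * F"
          by (simp add: exp_add[symmetric] algebra_simps)
        also have "\<dots> \<le> 3 * J' * exp (- \<rho> * (pi - x)) * (4 * s * norm (Z pi))"
          using FZ J' by (intro mult_left_mono) auto
        finally have M: "norm (dZ x + k * Z x) + norm (dZ x - k * Z x) \<le> s * (2 * (6 * J' * exp (- \<rho> * (pi - x)) * norm (Z pi)))"
          by (simp add: mult_ac)
        have CC: "6 * J' * exp (- \<rho> * (pi - x)) * norm (Z pi) \<le> C * exp (- \<rho> * (pi - x)) * norm (Z pi)"
          unfolding C_def using p0 by (intro mult_right_mono) auto
        have "s * (2 * norm (Z x)) = 2 * norm (k * Z x)" by (simp add: norm_mult s_def)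
        also have "\<dots> \<le> norm (dZ x + k * Z x) + norm (dZ x - k * Z x)"
          by (rule norm_plus_minus_bounds(2))
        also note M
        finally have "s * (2 * norm (Z x)) \<le> s * (2 * (6 * J' * exp (- \<rho> * (pi - x)) * norm (Z pi)))" .
        then have "norm (Z x) \<le> 6 * J' * exp (- \<rho> * (pi - x)) * norm (Z pi)"
          using S(5) by (rule sc)
        from order_trans[OF this CC] show "norm (Z x) \<le> C * exp (- Re k * (pi - x)) * norm (Z pi)"
          unfolding \<rho>_def .
        have half: "w \<le> s * y" if "2 * w \<le> s * (2 * y)" for w y using that by simp
        have "2 * norm (dZ x) \<le> s * (2 * (6 * J' * exp (- \<rho> * (pi - x)) * norm (Z pi)))"
          using order_trans[OF norm_plus_minus_bounds(1) M] .
        then have "norm (dZ x) \<le> s * (6 * J' * exp (- \<rho> * (pi - x)) * norm (Z pi))" by (rule half)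
        also have "\<dots> \<le> s * (C * exp (- \<rho> * (pi - x)) * norm (Z pi))" using CC S by (intro mult_left_mono) auto
        finally show "norm (dZ x) \<le> C * norm k * exp (- Re k * (pi - x)) * norm (Z pi)"
          by (simp add: \<rho>_def s_def mult_ac)
      qed
    qed
  qed
qed

text \<open>Because \<open>f g' = g f'\<close>, the entire function \<open>F = s ds' - ds s'\<close> satisfies
  \<open>F f f' = s f u' - s' f' u\<close>, which makes it \<open>O(1/k)\<close> on the two imaginary half axes.\<close>

lemma wronskian_vanish:
  fixes s ds s' ds' f g f' g' u u' :: "complex \<Rightarrow> complex"
  assumes hol: "s holomorphic_on UNIV" "ds holomorphic_on UNIV" "s' holomorphic_on UNIV" "ds' holomorphic_on UNIV"
    and ord: "order_half s" "order_half ds" "order_half s'" "order_half ds'"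
    and W: "\<And>l. f l * ds l - g l * s l = u l" "\<And>l. f' l * ds' l - g' l * s' l = u' l"
    and bd: "\<And>k. R \<le> norm k \<Longrightarrow> norm k \<le> 2 * Re k \<Longrightarrow>
       f (- (k\<^sup>2)) * g' (- (k\<^sup>2)) = g (- (k\<^sup>2)) * f' (- (k\<^sup>2)) \<and> f (- (k\<^sup>2)) \<noteq> 0 \<and> f' (- (k\<^sup>2)) \<noteq> 0 \<and>
       norm (s (- (k\<^sup>2))) * norm (u' (- (k\<^sup>2))) \<le> M / norm k * norm (f' (- (k\<^sup>2))) \<and>
       norm (s' (- (k\<^sup>2))) * norm (u (- (k\<^sup>2))) \<le> M / norm k * norm (f (- (k\<^sup>2)))"
  shows "s l * ds' l - ds l * s' l = 0"
proof -
  define F where "F l = s l * ds' l - ds l * s' l" for l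
  have FB: "norm (F (- (k\<^sup>2))) \<le> 2 * M / norm k" if k: "R \<le> norm k" "norm k \<le> 2 * Re k" for k
  proof -
    define l where "l = - (k\<^sup>2)"
    have b: "f l * g' l = g l * f' l" "f l \<noteq> 0" "f' l \<noteq> 0"
       "norm (s l) * norm (u' l) \<le> M / norm k * norm (f' l)" "norm (s' l) * norm (u l) \<le> M / norm k * norm (f l)"
      using bd[OF k] by (auto simp: l_def)
    have "F l * (f l * f' l) = s l * f l * (f' l * ds' l - g' l * s' l) - s' l * f' l * (f l * ds l - g l * s l)
       + s l * s' l * (f l * g' l - g l * f' l)"
      by (simp add: F_def algebra_simps)
    also have "\<dots> = s l * f l * u' l - s' l * f' l * u l" using b(1) by (simp add: W)
    finally have "norm (F l) * (norm (f l) * norm (f' l)) = norm (s l * f l * u' l - s' l * f' l * u l)"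
      by (metis norm_mult)
    also have "\<dots> \<le> norm (s l * f l * u' l) + norm (s' l * f' l * u l)" by (rule norm_triangle_ineq4)
    also have "\<dots> = (norm (s l) * norm (u' l)) * norm (f l) + (norm (s' l) * norm (u l)) * norm (f' l)"
      by (simp add: norm_mult mult_ac)
    also have "\<dots> \<le> (M / norm k * norm (f' l)) * norm (f l) + (M / norm k * norm (f l)) * norm (f' l)"
      using b by (intro add_mono mult_right_mono) auto
    also have "\<dots> = (2 * M / norm k) * (norm (f l) * norm (f' l))" by (simp add: field_simps)
    finally have "norm (F l) \<le> 2 * M / norm k"
      by (rule mult_right_le_imp_le) (use b(2,3) in simp)
    then show ?thesis by (simp add: l_def)
  qed
  \<comment> \<open>With \<open>e\<close> equal to \<open>1 - \<i>\<close> or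
    \<open>1 + \<i>\<close>, the point \<open>k = sqrt (t / 2) * e\<close> has norm
    \<open>sqrt t\<close> and real part \<open>sqrt (t / 2)\<close>, so it lies in the sector, and
    \<open>- k^2\<close> is \<open>\<i> * t\<close> or \<open>- \<i> * t\<close>.\<close>
  have lim: "((\<lambda>t. F (- ((of_real (sqrt (t / 2)) * e)\<^sup>2))) \<longlongrightarrow> 0) at_top"
    if e: "norm e = sqrt 2" "Re e = 1" for e
  proof (rule Lim_null_comparison[where g = "\<lambda>t. 2 * M / sqrt t"])
    show "((\<lambda>t. 2 * M / sqrt t) \<longlongrightarrow> 0) at_top" by real_asymp
    show "eventually (\<lambda>t. norm (F (- ((of_real (sqrt (t / 2)) * e)\<^sup>2))) \<le> 2 * M / sqrt t) at_top"
      using eventually_ge_at_top[of "max 1 (R\<^sup>2)"]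
    proof eventually_elim
      case (elim t)
      define k where "k = of_real (sqrt (t / 2)) * e"
      have nk: "norm k = sqrt t" unfolding k_def norm_mult norm_of_real using elim e by (simp add: real_sqrt_divide)
      have "R \<le> sqrt t" using elim by (simp add: real_le_rsqrt)
      moreover have "sqrt t \<le> 2 * Re k"
      proof (rule real_le_lsqrt)
        have "(2 * Re k)\<^sup>2 = 2 * t" using e elim by (simp add: k_def power_mult_distrib)
        then show "t \<le> (2 * Re k)\<^sup>2" using elim by simp
        show "0 \<le> 2 * Re k" using e elim by (simp add: k_def)
      qed
      ultimately show ?case using FB[of k] nk by (simp add: k_def)
    qed
  qed
  have ev: "eventually (\<lambda>t::real. t \<ge> 0) at_top" by (rule eventually_ge_at_top)
  have "F l = 0"
  proof (rule order_half_eq_0[of F])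
    show "F holomorphic_on UNIV" unfolding F_def[abs_def] by (intro holomorphic_intros hol)
    show "order_half F" unfolding F_def[abs_def] by (intro order_half_diff order_half_mult ord)
    show "((\<lambda>t. F (\<i> * of_real t)) \<longlongrightarrow> 0) at_top"
    proof (rule Lim_transform_eventually[OF lim[of "1 - \<i>"]])
      show "eventually (\<lambda>t. F (- ((of_real (sqrt (t / 2)) * (1 - \<i>))\<^sup>2)) = F (\<i> * of_real t)) at_top"
        using ev
      proof eventually_elim
        case (elim t)
        have "(complex_of_real (sqrt (t / 2)))\<^sup>2 = of_real (t / 2)" using elim by (simp flip: of_real_power)
        moreover have "(1 - \<i>)\<^sup>2 = - 2 * \<i>" by (simp add: power2_eq_square algebra_simps)
        ultimately show ?case by (simp add: power_mult_distrib mult_ac)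
      qed
    qed (simp_all add: cmod_def)
    show "((\<lambda>t. F (\<i> * of_real (- t))) \<longlongrightarrow> 0) at_top"
    proof (rule Lim_transform_eventually[OF lim[of "1 + \<i>"]])
      show "eventually (\<lambda>t. F (- ((of_real (sqrt (t / 2)) * (1 + \<i>))\<^sup>2)) = F (\<i> * of_real (- t))) at_top"
        using ev
      proof eventually_elim
        case (elim t)
        have "(complex_of_real (sqrt (t / 2)))\<^sup>2 = of_real (t / 2)" using elim by (simp flip: of_real_power)
        moreover have "(1 + \<i>)\<^sup>2 = 2 * \<i>" by (simp add: power2_eq_square algebra_simps)
        ultimately show ?case by (simp add: power_mult_distrib mult_ac)
      qed
    qed (simp_all add: cmod_def)
  qed
  then show ?thesis by (simp add: F_def)
qed

definition phi_fam :: "(real \<Rightarrow> complex) \<Rightarrow> complex \<Rightarrow> real \<Rightarrow> complex \<Rightarrow> real \<Rightarrow>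
    (complex \<Rightarrow> real \<Rightarrow> complex) \<Rightarrow> (complex \<Rightarrow> real \<Rightarrow> complex) \<Rightarrow>
    (complex \<Rightarrow> real \<Rightarrow> complex) \<Rightarrow> (complex \<Rightarrow> real \<Rightarrow> complex) \<Rightarrow> bool" where
  "phi_fam q h \<beta> \<gamma> d Y dY Z dZ \<longleftrightarrow>
     (\<forall>l. jsol q \<beta> \<gamma> d l 0 (Y l) (dY l) (Z l) (dZ l) \<and> Y l 0 = 1 \<and> dY l 0 = h)"

lemma phi_fam_asymp:
  assumes q: "q absolutely_integrable_on {0..pi}" and d: "0 < d" "d < pi" and \<beta>: "\<beta> > 0"
    and P: "phi_fam q h \<beta> \<gamma> d Y dY Z dZ"
  shows "\<exists>C>0. \<forall>\<epsilon>>0. \<exists>R\<ge>1. \<forall>k. R \<le> norm k \<longrightarrow> norm k \<le> 2 * Re k \<longrightarrow>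
     phi_est d C \<epsilon> k (Y (- (k\<^sup>2))) (dY (- (k\<^sup>2))) (Z (- (k\<^sup>2))) (dZ (- (k\<^sup>2)))"
  using phi_asymp[OF q d \<beta>, of \<gamma> h] P unfolding phi_fam_def by metis

text \<open>The expression with \<open>k * 0\<close> is what the exponential estimates produce for
  Cauchy data \<open>(0, 1)\<close>; its value is 2, and the gain is the factor
  \<open>1 / norm k\<close>.\<close>

lemma unit_slope_bound:
  fixes k :: complex
  assumes "norm (dz + k * z) + norm (dz - k * z) \<le> M * e * (norm (1 + k * 0) + norm (1 - k * 0))" "k \<noteq> 0"
  shows "norm z \<le> M * e / norm k"
proof -
  have "2 * norm (k * z) \<le> M * e * 2"
    using assms(1) norm_plus_minus_bounds(2)[where u = dz and v = "k * z"] by simp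
  then show ?thesis using assms(2) by (simp add: norm_mult field_simps)
qed

lemma decay_product:
  fixes u s f :: complex
  assumes "norm s \<le> M * exp (r * t) / n" "norm u \<le> C * exp (- r * t) * norm f" "n > 0" "M \<ge> 0" "C \<ge> 0"
  shows "norm s * norm u \<le> (M * C) / n * norm f"
proof -
  have "norm s * norm u \<le> (M * exp (r * t) / n) * (C * exp (- r * t) * norm f)"
    using assms by (intro mult_mono) auto
  also have "\<dots> = (exp (r * t) * exp (- r * t)) * ((M * C) / n * norm f)" by simp
  also have "exp (r * t) * exp (- r * t) = 1" by (simp add: exp_add[symmetric])
  finally show ?thesis by simp
qed

text \<open>The Wronskian of \<open>Z l\<close> with \<open>s l\<close> equals \<open>Z l a\<close>.
  At \<open>pi\<close>, \<open>s\<close> is at most of order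
  \<open>exp (Re k * (pi - a)) / norm k\<close>, and \<open>Z l a / Z l pi\<close> decays by the
  same exponential, so the product is \<open>O(1 / norm k)\<close>. The relation \<open>rel\<close>
  is needed only for large \<open>norm l\<close>, since only the behaviour on the rays is
  used.\<close>

lemma wronskian_vanish_right:
  assumes q: "q absolutely_integrable_on {0..pi}" "q' absolutely_integrable_on {0..pi}"
    and d: "0 < d" "d < pi" and \<beta>: "\<beta> > 0" "\<beta>' > 0"
    and P: "phi_fam q h \<beta> \<gamma> d Y dY Z dZ" and P': "phi_fam q' h' \<beta>' \<gamma>' d Y' dY' Z' dZ'"
    and rel: "\<And>l. R \<le> norm l \<Longrightarrow> Z l pi * dZ' l pi = dZ l pi * Z' l pi"
    and a: "d \<le> a" "a \<le> pi"
    and s: "\<And>l. sol (\<lambda>x. q x - l) a pi (s l) (ds l)" "\<And>l. s l a = 0" "\<And>l. ds l a = 1"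
    and s': "\<And>l. sol (\<lambda>x. q' x - l) a pi (s' l) (ds' l)" "\<And>l. s' l a = 0" "\<And>l. ds' l a = 1"
  shows "s l pi * ds' l pi - ds l pi * s' l pi = 0"
proof -
  have qa: "q absolutely_integrable_on {a..pi}" "q' absolutely_integrable_on {a..pi}"
    by (rule absolutely_integrable_on_subinterval[OF q(1)] absolutely_integrable_on_subinterval[OF q(2)]; use a d in auto)+
  obtain C where C: "C > 0" "\<forall>\<epsilon>>0. \<exists>R\<ge>1. \<forall>k. R \<le> norm k \<longrightarrow> norm k \<le> 2 * Re k \<longrightarrow>
     phi_est d C \<epsilon> k (Y (- (k\<^sup>2))) (dY (- (k\<^sup>2))) (Z (- (k\<^sup>2))) (dZ (- (k\<^sup>2)))"
    using phi_fam_asymp[OF q(1) d \<beta>(1) P] by blast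
  obtain R1 where R1: "R1 \<ge> 1" "\<And>k. R1 \<le> norm k \<Longrightarrow> norm k \<le> 2 * Re k \<Longrightarrow>
     phi_est d C 1 k (Y (- (k\<^sup>2))) (dY (- (k\<^sup>2))) (Z (- (k\<^sup>2))) (dZ (- (k\<^sup>2)))"
    using spec[OF C(2), of 1] zero_less_one by blast
  obtain C' where C': "C' > 0" "\<forall>\<epsilon>>0. \<exists>R\<ge>1. \<forall>k. R \<le> norm k \<longrightarrow> norm k \<le> 2 * Re k \<longrightarrow>
     phi_est d C' \<epsilon> k (Y' (- (k\<^sup>2))) (dY' (- (k\<^sup>2))) (Z' (- (k\<^sup>2))) (dZ' (- (k\<^sup>2)))"
    using phi_fam_asymp[OF q(2) d \<beta>(2) P'] by blast
  obtain R2 where R2: "R2 \<ge> 1" "\<And>k. R2 \<le> norm k \<Longrightarrow> norm k \<le> 2 * Re k \<Longrightarrow>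
     phi_est d C' 1 k (Y' (- (k\<^sup>2))) (dY' (- (k\<^sup>2))) (Z' (- (k\<^sup>2))) (dZ' (- (k\<^sup>2)))"
    using spec[OF C'(2), of 1] zero_less_one by blast
  have Zs: "sol (\<lambda>x. q x - l) a pi (Z l) (dZ l)" "sol (\<lambda>x. q' x - l) a pi (Z' l) (dZ' l)" for l
    using P P' a unfolding phi_fam_def jsol_def by (auto intro: sol_subset)
  define Q where "Q = integral {0..pi} (\<lambda>t. norm (q t))"
  define Q' where "Q' = integral {0..pi} (\<lambda>t. norm (q' t))"
  define M where "M = 3 * C + 3 * C'"
  show ?thesis
  proof (rule wronskian_vanish[where f = "\<lambda>l. Z l pi" and g = "\<lambda>l. dZ l pi" and f' = "\<lambda>l. Z' l pi" and g' = "\<lambda>l. dZ' l pi"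
        and s = "\<lambda>l. s l pi" and ds = "\<lambda>l. ds l pi" and s' = "\<lambda>l. s' l pi" and ds' = "\<lambda>l. ds' l pi"
        and u = "\<lambda>l. Z l a" and u' = "\<lambda>l. Z' l a" and R = "R1 + R2 + \<bar>Q\<bar> + \<bar>Q'\<bar> + \<bar>R\<bar>" and M = M])
    show "(\<lambda>l. s l pi) holomorphic_on UNIV" "(\<lambda>l. ds l pi) holomorphic_on UNIV"
      by (rule sol_param_holomorphic[OF qa(1) a(2) s])+
    show "(\<lambda>l. s' l pi) holomorphic_on UNIV" "(\<lambda>l. ds' l pi) holomorphic_on UNIV"
      by (rule sol_param_holomorphic[OF qa(2) a(2) s'])+
    show "order_half (\<lambda>l. s l pi)" "order_half (\<lambda>l. ds l pi)"
      by (rule sol_order_half[OF qa(1) a(2) s(1)]; simp add: s order_half_const)+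
    show "order_half (\<lambda>l. s' l pi)" "order_half (\<lambda>l. ds' l pi)"
      by (rule sol_order_half[OF qa(2) a(2) s'(1)]; simp add: s' order_half_const)+
    show "Z l pi * ds l pi - dZ l pi * s l pi = Z l a" for l
      using sol_wronskian[OF Zs(1) s(1), of pi a l] a s by simp
    show "Z' l pi * ds' l pi - dZ' l pi * s' l pi = Z' l a" for l
      using sol_wronskian[OF Zs(2) s'(1), of pi a l] a s' by simp
    fix k assume k: "R1 + R2 + \<bar>Q\<bar> + \<bar>Q'\<bar> + \<bar>R\<bar> \<le> norm k" "norm k \<le> 2 * Re k"
    define l where "l = - (k\<^sup>2)"
    have k1: "norm k \<ge> R1" "norm k \<ge> R2" "norm k \<ge> 1" "norm k \<ge> Q" "norm k \<ge> Q'" "norm k \<ge> R"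
      using k R1(1) R2(1) by linarith+
    then have k0: "k \<noteq> 0" "Re k \<ge> 0" using k(2) by auto
    have "norm k \<le> norm k * norm k" using k1(3) by (simp add: mult_le_cancel_left1)
    then have "R \<le> norm l" using k1(6) by (simp add: l_def norm_power power2_eq_square norm_mult)
    then have r: "Z l pi * dZ' l pi = dZ l pi * Z' l pi" by (rule rel)
    have aa: "a \<in> {d..pi}" using a by simp
    have z: "Z l pi \<noteq> 0" "norm (Z l a) \<le> C * exp (- Re k * (pi - a)) * norm (Z l pi)"
      "Z' l pi \<noteq> 0" "norm (Z' l a) \<le> C' * exp (- Re k * (pi - a)) * norm (Z' l pi)"
      using R1(2)[OF k1(1) k(2)] R2(2)[OF k1(2) k(2)] aa by (auto simp: l_def phi_est_def)
    have "norm (ds l pi + k * s l pi) + norm (ds l pi - k * s l pi) \<le> exp (Re k * (pi - a)) * (3 * (norm (1 + k * 0) + norm (1 - k * 0)))"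
      using sol_exp_estimates(1)[OF s(1)[of l] l_def qa(1) integral_norm_le[OF q(1)] k1(4)[unfolded Q_def] k0, of pi] a d s
      by simp
    then have sb: "norm (s l pi) \<le> 3 * exp (Re k * (pi - a)) / norm k"
      by (intro unit_slope_bound[where dz = "ds l pi"]) (use k0 in auto)
    have "norm (ds' l pi + k * s' l pi) + norm (ds' l pi - k * s' l pi) \<le> exp (Re k * (pi - a)) * (3 * (norm (1 + k * 0) + norm (1 - k * 0)))"
      using sol_exp_estimates(1)[OF s'(1)[of l] l_def qa(2) integral_norm_le[OF q(2)] k1(5)[unfolded Q'_def] k0, of pi] a d s'
      by simp
    then have sb': "norm (s' l pi) \<le> 3 * exp (Re k * (pi - a)) / norm k"
      by (intro unit_slope_bound[where dz = "ds' l pi"]) (use k0 in auto)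
    have nk: "norm k > 0" using k0 by simp
    have "norm (s l pi) * norm (Z' l a) \<le> (3 * C') / norm k * norm (Z' l pi)"
      by (rule decay_product[OF sb z(4) nk]) (use C'(1) in auto)
    also have "\<dots> \<le> M / norm k * norm (Z' l pi)"
      using C(1) C'(1) nk by (intro mult_right_mono divide_right_mono) (auto simp: M_def)
    finally have 1: "norm (s l pi) * norm (Z' l a) \<le> M / norm k * norm (Z' l pi)" .
    have "norm (s' l pi) * norm (Z l a) \<le> (3 * C) / norm k * norm (Z l pi)"
      by (rule decay_product[OF sb' z(2) nk]) (use C(1) in auto)
    also have "\<dots> \<le> M / norm k * norm (Z l pi)"
      using C(1) C'(1) nk by (intro mult_right_mono divide_right_mono) (auto simp: M_def)
    finally have 2: "norm (s' l pi) * norm (Z l a) \<le> M / norm k * norm (Z l pi)" .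
    show "Z (- (k\<^sup>2)) pi * dZ' (- (k\<^sup>2)) pi = dZ (- (k\<^sup>2)) pi * Z' (- (k\<^sup>2)) pi \<and>
      Z (- (k\<^sup>2)) pi \<noteq> 0 \<and> Z' (- (k\<^sup>2)) pi \<noteq> 0 \<and>
      norm (s (- (k\<^sup>2)) pi) * norm (Z' (- (k\<^sup>2)) a) \<le> M / norm k * norm (Z' (- (k\<^sup>2)) pi) \<and>
      norm (s' (- (k\<^sup>2)) pi) * norm (Z (- (k\<^sup>2)) a) \<le> M / norm k * norm (Z (- (k\<^sup>2)) pi)"
      using r z 1 2 by (simp add: l_def)
  qed
qed

text \<open>The same balance for a starting point to the left of \<open>d\<close>: the solution
  started there is carried through the jump, which costs only a constant factor, and the Wronskian
  is evaluated as \<open>Y l a\<close>.\<close>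

lemma wronskian_vanish_left:
  assumes q: "q absolutely_integrable_on {0..pi}" "q' absolutely_integrable_on {0..pi}"
    and d: "0 < d" "d < pi" and \<beta>: "\<beta> > 0" "\<beta>' > 0"
    and P: "phi_fam q h \<beta> \<gamma> d Y dY Z dZ" and P': "phi_fam q' h' \<beta>' \<gamma>' d Y' dY' Z' dZ'"
    and rel: "\<And>l. R \<le> norm l \<Longrightarrow> Z l pi * dZ' l pi = dZ l pi * Z' l pi"
    and a: "0 \<le> a" "a \<le> d"
    and s: "\<And>l. jsol q \<beta> \<gamma> d l a (s l) (ds l) (S l) (dS l)" "\<And>l. s l a = 0" "\<And>l. ds l a = 1"
    and s': "\<And>l. jsol q' \<beta>' \<gamma>' d l a (s' l) (ds' l) (S' l) (dS' l)" "\<And>l. s' l a = 0" "\<And>l. ds' l a = 1"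
  shows "S l pi * dS' l pi - dS l pi * S' l pi = 0"
proof -
  obtain C where C: "C > 0" "\<forall>\<epsilon>>0. \<exists>R\<ge>1. \<forall>k. R \<le> norm k \<longrightarrow> norm k \<le> 2 * Re k \<longrightarrow>
     phi_est d C \<epsilon> k (Y (- (k\<^sup>2))) (dY (- (k\<^sup>2))) (Z (- (k\<^sup>2))) (dZ (- (k\<^sup>2)))"
    using phi_fam_asymp[OF q(1) d \<beta>(1) P] by blast
  obtain R1 where R1: "R1 \<ge> 1" "\<And>k. R1 \<le> norm k \<Longrightarrow> norm k \<le> 2 * Re k \<Longrightarrow>
     phi_est d C 1 k (Y (- (k\<^sup>2))) (dY (- (k\<^sup>2))) (Z (- (k\<^sup>2))) (dZ (- (k\<^sup>2)))"
    using spec[OF C(2), of 1] zero_less_one by blast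
  obtain C' where C': "C' > 0" "\<forall>\<epsilon>>0. \<exists>R\<ge>1. \<forall>k. R \<le> norm k \<longrightarrow> norm k \<le> 2 * Re k \<longrightarrow>
     phi_est d C' \<epsilon> k (Y' (- (k\<^sup>2))) (dY' (- (k\<^sup>2))) (Z' (- (k\<^sup>2))) (dZ' (- (k\<^sup>2)))"
    using phi_fam_asymp[OF q(2) d \<beta>(2) P'] by blast
  obtain R2 where R2: "R2 \<ge> 1" "\<And>k. R2 \<le> norm k \<Longrightarrow> norm k \<le> 2 * Re k \<Longrightarrow>
     phi_est d C' 1 k (Y' (- (k\<^sup>2))) (dY' (- (k\<^sup>2))) (Z' (- (k\<^sup>2))) (dZ' (- (k\<^sup>2)))"
    using spec[OF C'(2), of 1] zero_less_one by blast
  have Zs: "jsol q \<beta> \<gamma> d l 0 (Y l) (dY l) (Z l) (dZ l)" "jsol q' \<beta>' \<gamma>' d l 0 (Y' l) (dY' l) (Z' l) (dZ' l)" for l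
    using P P' unfolding phi_fam_def by auto
  define Q where "Q = integral {0..pi} (\<lambda>t. norm (q t))"
  define Q' where "Q' = integral {0..pi} (\<lambda>t. norm (q' t))"
  define J J' where "J = 9 * (inverse \<beta> + norm \<gamma> + \<beta>)" and "J' = 9 * (inverse \<beta>' + norm \<gamma>' + \<beta>')"
  have J0: "J \<ge> 0" "J' \<ge> 0" using \<beta> by (auto simp: J_def J'_def)
  define M where "M = J' * C + J * C'"
  have d': "0 \<le> d" "d \<le> pi" using d by auto
  show ?thesis
  proof (rule wronskian_vanish[where f = "\<lambda>l. Z l pi" and g = "\<lambda>l. dZ l pi" and f' = "\<lambda>l. Z' l pi" and g' = "\<lambda>l. dZ' l pi"
        and s = "\<lambda>l. S l pi" and ds = "\<lambda>l. dS l pi" and s' = "\<lambda>l. S' l pi" and ds' = "\<lambda>l. dS' l pi"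
        and u = "\<lambda>l. Y l a" and u' = "\<lambda>l. Y' l a" and R = "R1 + R2 + \<bar>Q\<bar> + \<bar>Q'\<bar> + \<bar>R\<bar>" and M = M])
    show "(\<lambda>l. S l pi) holomorphic_on UNIV" "(\<lambda>l. dS l pi) holomorphic_on UNIV"
       "order_half (\<lambda>l. S l pi)" "order_half (\<lambda>l. dS l pi)"
      by (rule jsol_entire[OF q(1) a d'(2) s])+
    show "(\<lambda>l. S' l pi) holomorphic_on UNIV" "(\<lambda>l. dS' l pi) holomorphic_on UNIV"
       "order_half (\<lambda>l. S' l pi)" "order_half (\<lambda>l. dS' l pi)"
      by (rule jsol_entire[OF q(2) a d'(2) s'])+
    show "Z l pi * dS l pi - dZ l pi * S l pi = Y l a" for l
      using jsol_wronskian[OF Zs(1) s(1), of a pi l] a s d \<beta> by simp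
    show "Z' l pi * dS' l pi - dZ' l pi * S' l pi = Y' l a" for l
      using jsol_wronskian[OF Zs(2) s'(1), of a pi l] a s' d \<beta> by simp
    fix k assume k: "R1 + R2 + \<bar>Q\<bar> + \<bar>Q'\<bar> + \<bar>R\<bar> \<le> norm k" "norm k \<le> 2 * Re k"
    define l where "l = - (k\<^sup>2)"
    have k1: "norm k \<ge> R1" "norm k \<ge> R2" "norm k \<ge> 1" "norm k \<ge> Q" "norm k \<ge> Q'" "norm k \<ge> R"
      using k R1(1) R2(1) by linarith+
    then have k0: "k \<noteq> 0" "Re k \<ge> 0" using k(2) by auto
    have "norm k \<le> norm k * norm k" using k1(3) by (simp add: mult_le_cancel_left1)
    then have "R \<le> norm l" using k1(6) by (simp add: l_def norm_power power2_eq_square norm_mult)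
    then have r: "Z l pi * dZ' l pi = dZ l pi * Z' l pi" by (rule rel)
    have aa: "a \<in> {0..d}" using a by simp
    have z: "Z l pi \<noteq> 0" "norm (Y l a) \<le> C * exp (- Re k * (pi - a)) * norm (Z l pi)"
      "Z' l pi \<noteq> 0" "norm (Y' l a) \<le> C' * exp (- Re k * (pi - a)) * norm (Z' l pi)"
      using R1(2)[OF k1(1) k(2)] R2(2)[OF k1(2) k(2)] aa by (auto simp: l_def phi_est_def)
    have "norm (dS l pi + k * S l pi) + norm (dS l pi - k * S l pi) \<le> J * exp (Re k * (pi - a)) * (norm (1 + k * 0) + norm (1 - k * 0))"
      using jsol_upper[OF q(1) d' \<beta>(1) s(1)[of "- (k\<^sup>2)"] a k1(3) k1(4)[unfolded Q_def] k0(2), of pi] d s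
      by (simp add: l_def J_def)
    then have sb: "norm (S l pi) \<le> J * exp (Re k * (pi - a)) / norm k"
      using k0(1) by (rule unit_slope_bound)
    have "norm (dS' l pi + k * S' l pi) + norm (dS' l pi - k * S' l pi) \<le> J' * exp (Re k * (pi - a)) * (norm (1 + k * 0) + norm (1 - k * 0))"
      using jsol_upper[OF q(2) d' \<beta>(2) s'(1)[of "- (k\<^sup>2)"] a k1(3) k1(5)[unfolded Q'_def] k0(2), of pi] d s'
      by (simp add: l_def J'_def)
    then have sb': "norm (S' l pi) \<le> J' * exp (Re k * (pi - a)) / norm k"
      using k0(1) by (rule unit_slope_bound)
    have nk: "norm k > 0" using k0 by simp
    have "norm (S l pi) * norm (Y' l a) \<le> (J * C') / norm k * norm (Z' l pi)"
      by (rule decay_product[OF sb z(4) nk J0(1)]) (use C'(1) in auto)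
    also have "\<dots> \<le> M / norm k * norm (Z' l pi)"
      using C(1) C'(1) nk J0 by (intro mult_right_mono divide_right_mono) (auto simp: M_def)
    finally have 1: "norm (S l pi) * norm (Y' l a) \<le> M / norm k * norm (Z' l pi)" .
    have "norm (S' l pi) * norm (Y l a) \<le> (J' * C) / norm k * norm (Z l pi)"
      by (rule decay_product[OF sb' z(2) nk J0(2)]) (use C(1) in auto)
    also have "\<dots> \<le> M / norm k * norm (Z l pi)"
      using C(1) C'(1) nk J0 by (intro mult_right_mono divide_right_mono) (auto simp: M_def)
    finally have 2: "norm (S' l pi) * norm (Y l a) \<le> M / norm k * norm (Z l pi)" .
    show "Z (- (k\<^sup>2)) pi * dZ' (- (k\<^sup>2)) pi = dZ (- (k\<^sup>2)) pi * Z' (- (k\<^sup>2)) pi \<and>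
      Z (- (k\<^sup>2)) pi \<noteq> 0 \<and> Z' (- (k\<^sup>2)) pi \<noteq> 0 \<and>
      norm (S (- (k\<^sup>2)) pi) * norm (Y' (- (k\<^sup>2)) a) \<le> M / norm k * norm (Z' (- (k\<^sup>2)) pi) \<and>
      norm (S' (- (k\<^sup>2)) pi) * norm (Y (- (k\<^sup>2)) a) \<le> M / norm k * norm (Z (- (k\<^sup>2)) pi)"
      using r z 1 2 by (simp add: l_def)
  qed
qed

section \<open>Recovering the potential\<close>

text \<open>After extension by 0 the integrals over all half-lines \<open>{..c}\<close> vanish.
  These form an intersection-stable generator of the Borel sets, so the integral vanishes over every
  Borel set, and over every Lebesgue set because that differs from a Borel set by a null
  set.\<close>

lemma AE_eq_0_if_integrals_eq_0:
  fixes f :: "real \<Rightarrow> complex"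
  assumes f: "f absolutely_integrable_on {a..b}"
    and z: "\<And>x. x \<in> {a..b} \<Longrightarrow> (f has_integral 0) {a..x}"
  shows "AE x in lebesgue. x \<in> {a..b} \<longrightarrow> f x = 0"
proof -
  define g where "g x = indicator {a..b} x *\<^sub>R f x" for x
  have g: "integrable lebesgue g" using f unfolding g_def[abs_def] set_integrable_def .
  have gA: "set_integrable lebesgue A g" if "A \<in> sets lebesgue" for A
    unfolding set_integrable_def using integrable_mult_indicator[OF that g] .
  have sb: "sets borel = sigma_sets UNIV (range (\<lambda>a::real. {..a}))"
    by (subst borel_eq_atMost) (simp add: sets_measure_of)
  have sl: "A \<in> sets lebesgue" if "A \<in> sigma_sets UNIV (range (\<lambda>a::real. {..a}))" for A
    using that unfolding sb[symmetric] by (metis sets_completionI_sets sets_lborel)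
  have borelA: "set_lebesgue_integral lebesgue A g = 0" if "A \<in> sets borel" for A
  proof -
    have sig: "A \<in> sigma_sets UNIV (range (\<lambda>a::real. {..a}))"
      using that unfolding sb .
    have ist: "Int_stable (range (\<lambda>a::real. {..a}))"
      unfolding Int_stable_def by auto
    have po: "range (\<lambda>a::real. {..a}) \<subseteq> Pow UNIV" by simp
    from ist po sig show ?thesis
    proof (induction rule: sigma_sets_induct_disjoint)
      case (basic A)
      then obtain c where A: "A = {..c}" by auto
      have eq: "set_lebesgue_integral lebesgue A g = set_lebesgue_integral lebesgue (A \<inter> {a..b}) f"
        unfolding set_lebesgue_integral_def g_def
        by (intro Bochner_Integration.integral_cong) (auto simp: indicator_def)
      show ?case
      proof (cases "a \<le> min c b")
        case True
        then have "A \<inter> {a..b} = {a..min c b}" unfolding A by auto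
        moreover have "f absolutely_integrable_on {a..min c b}"
          by (rule absolutely_integrable_on_subinterval[OF f]) auto
        moreover have "integral {a..min c b} f = 0" using z[of "min c b"] True by (auto intro: integral_unique)
        ultimately show ?thesis unfolding eq by (simp add: set_lebesgue_integral_eq_integral(2))
      next
        case False
        then have "A \<inter> {a..b} = {}" unfolding A by auto
        then show ?thesis unfolding eq by (simp add: set_lebesgue_integral_def)
      qed
    next
      case empty
      then show ?case by (simp add: set_lebesgue_integral_def)
    next
      case (compl A)
      have A: "A \<in> sets lebesgue"
        using compl(1) by (rule sl)
      have "set_lebesgue_integral lebesgue (A \<union> (UNIV - A)) g =
          set_lebesgue_integral lebesgue A g + set_lebesgue_integral lebesgue (UNIV - A) g"
      proof (rule set_integral_Un)
        have "UNIV - A \<in> sets lebesgue" using sets.compl_sets[OF A] by simp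
        then show "set_integrable lebesgue (UNIV - A) g" by (rule gA)
        show "set_integrable lebesgue A g" using A by (rule gA)
      qed auto
      moreover have "set_lebesgue_integral lebesgue UNIV g = 0"
      proof -
        have "set_lebesgue_integral lebesgue UNIV g = set_lebesgue_integral lebesgue {a..b} f"
          unfolding set_lebesgue_integral_def g_def by simp
        also have "\<dots> = integral {a..b} f" by (rule set_lebesgue_integral_eq_integral(2)[OF f])
        also have "\<dots> = 0" using z[of b] by (cases "a \<le> b") (auto intro: integral_unique)
        finally show ?thesis .
      qed
      ultimately show ?case using compl(2) by simp
    next
      case (union A)
      have A: "A i \<in> sets lebesgue" for i
        using union(2) by (intro sl) auto
      have "set_lebesgue_integral lebesgue (\<Union>i. A i) g = (\<Sum>i. set_lebesgue_integral lebesgue (A i) g)"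
        by (rule lebesgue_integral_countable_add)
           (use A gA union(1) in \<open>auto simp: disjoint_family_on_def\<close>)
      then show ?case using union(3) by simp
    qed
  qed
  have "AE x in lebesgue. g x = 0"
  proof (rule sigma_finite_measure.density_zero[OF _ g])
    show "sigma_finite_measure (lebesgue :: real measure)"
    proof
      obtain A where A: "countable A" "A \<subseteq> sets (lborel :: real measure)" "\<Union>A = space lborel" "\<forall>a\<in>A. emeasure lborel a \<noteq> \<infinity>"
        using lborel.sigma_finite_countable by blast
      then show "\<exists>A. countable A \<and> A \<subseteq> sets (lebesgue :: real measure) \<and> \<Union>A = space lebesgue \<and> (\<forall>a\<in>A. emeasure lebesgue a \<noteq> \<infinity>)"
        by (intro exI[of _ A]) (auto intro: sets_completionI_sets simp: subset_iff)
    qed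
  next
    fix A :: "real set" assume "A \<in> sets lebesgue"
    then obtain S N N' where SN: "A = S \<union> N" "N \<subseteq> N'" "N' \<in> null_sets lborel" "S \<in> sets lborel"
      by (rule sets_completionE)
    have S: "S \<in> sets lebesgue" using SN(4) by (rule sets_completionI_sets)
    have "set_lebesgue_integral lebesgue A g = set_lebesgue_integral lebesgue S g"
    proof (rule set_integral_null_delta[OF g \<open>A \<in> sets lebesgue\<close> S])
      have "(A - S) \<union> (S - A) \<subseteq> N'" using SN by auto
      then show "(A - S) \<union> (S - A) \<in> null_sets lebesgue"
        using SN(3) null_sets_completionI null_sets_completion_subset by blast
    qed
    then show "set_lebesgue_integral lebesgue A g = 0" using borelA SN(4) by simp
  qed
  then show ?thesis by eventually_elim (auto simp: g_def)
qed

text \<open>The factor \<open>\<mu> = C' dS - S' dC\<close> between the parallel rows \<open>(C, S)\<close> and \<open>(C', S')\<close> satisfies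
  \<open>\<mu>\<^sup>2 = 1\<close>, as the derivative of \<open>S' C - S C' = 0\<close> shows; by continuity it is constant.\<close>

lemma parallel_fundamental_systems:
  assumes ab: "a < b" and P: "P absolutely_integrable_on {a..b}" and P': "P' absolutely_integrable_on {a..b}"
    and C: "sol P a b C dC" and S: "sol P a b S dS" and C': "sol P' a b C' dC'" and S': "sol P' a b S' dS'"
    and W: "\<And>x. x \<in> {a..b} \<Longrightarrow> C x * dS x - dC x * S x = 1"
    and W': "\<And>x. x \<in> {a..b} \<Longrightarrow> C' x * dS' x - dC' x * S' x = 1"
    and F: "\<And>x. x \<in> {a..b} \<Longrightarrow> S' x * C x - S x * C' x = 0"
  shows "\<exists>\<mu>. \<mu>\<^sup>2 = 1 \<and> (\<forall>x\<in>{a..b}. C' x = \<mu> * C x \<and> S' x = \<mu> * S x \<and> dC' x = \<mu> * dC x \<and> dS' x = \<mu> * dS x)"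
    and "AE x in lebesgue. x \<in> {a..b} \<longrightarrow> P x = P' x"
proof -
  define \<mu> where "\<mu> x = C' x * dS x - S' x * dC x" for x
  have par: "C' x = \<mu> x * C x" "S' x = \<mu> x * S x" if x: "x \<in> {a..b}" for x
  proof -
    have "\<mu> x * C x - C' x * (C x * dS x - dC x * S x) = - dC x * (S' x * C x - S x * C' x)"
      by (simp add: \<mu>_def algebra_simps)
    then show "C' x = \<mu> x * C x" using W[OF x] F[OF x] by simp
    have "\<mu> x * S x - S' x * (C x * dS x - dC x * S x) = - dS x * (S' x * C x - S x * C' x)"
      by (simp add: \<mu>_def algebra_simps)
    then show "S' x = \<mu> x * S x" using W[OF x] F[OF x] by simp
  qed
  have dF: "dS' x * C x + S' x * dC x - (dS x * C' x + S x * dC' x) = 0" if x: "x \<in> {a..b}" for x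
  proof (rule vector_derivative_unique_within_closed_interval[OF ab])
    show "x \<in> cbox a b" using x by simp
    have D: "(C has_vector_derivative dC x) (at x within {a..b})" "(S has_vector_derivative dS x) (at x within {a..b})"
      "(C' has_vector_derivative dC' x) (at x within {a..b})" "(S' has_vector_derivative dS' x) (at x within {a..b})"
      using C S C' S' x unfolding sol_def by auto
    have "((\<lambda>x. S' x * C x - S x * C' x) has_vector_derivative
        (S' x * dC x + dS' x * C x - (S x * dC' x + dS x * C' x))) (at x within {a..b})"
      by (intro has_vector_derivative_diff has_vector_derivative_mult D)
    then show "((\<lambda>x. S' x * C x - S x * C' x) has_vector_derivative
        (dS' x * C x + S' x * dC x - (dS x * C' x + S x * dC' x))) (at x within cbox a b)"
      by (simp add: add.commute)
    have "((\<lambda>x. 0) has_vector_derivative 0) (at x within {a..b})" by simp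
    then have "((\<lambda>x. S' x * C x - S x * C' x) has_vector_derivative 0) (at x within {a..b})"
      using has_vector_derivative_transform[OF x, of "\<lambda>x. S' x * C x - S x * C' x" "\<lambda>x. 0" 0] F by simp
    then show "((\<lambda>x. S' x * C x - S x * C' x) has_vector_derivative 0) (at x within cbox a b)" by simp
  qed
  have sq: "(\<mu> x)\<^sup>2 = 1" if x: "x \<in> {a..b}" for x
  proof -
    have "\<mu> x = dS' x * C x - S x * dC' x" using dF[OF x] by (simp add: \<mu>_def algebra_simps)
    then have "\<mu> x * \<mu> x = \<mu> x * (dS' x * C x - S x * dC' x)" by simp
    also have "\<dots> = dS' x * (\<mu> x * C x) - (\<mu> x * S x) * dC' x" by (simp add: algebra_simps)
    also have "\<dots> = 1" using par[OF x] W'[OF x] by (simp add: mult.commute)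
    finally show ?thesis by (simp add: power2_eq_square)
  qed
  have "continuous_on {a..b} \<mu>"
    unfolding \<mu>_def[abs_def] by (intro continuous_intros sol_continuous[OF C] sol_continuous[OF S] sol_continuous[OF C'] sol_continuous[OF S'])
  moreover have "finite (\<mu> ` {a..b})"
  proof (rule finite_subset)
    have "\<mu> x = 1 \<or> \<mu> x = -1" if "x \<in> {a..b}" for x
      using sq[OF that] by (simp add: power2_eq_1_iff)
    then show "\<mu> ` {a..b} \<subseteq> {1, -1}" by blast
  qed simp
  ultimately have "\<mu> constant_on {a..b}"
    by (intro continuous_finite_range_constant) auto
  then obtain m where m: "\<And>x. x \<in> {a..b} \<Longrightarrow> \<mu> x = m" unfolding constant_on_def by blast
  have m2: "m\<^sup>2 = 1" using sq[of a] m[of a] ab by simp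
  have dpar: "dy' x = m * dy x" if y: "sol P a b y dy" and y': "sol P' a b y' dy'"
    and e: "\<And>x. x \<in> {a..b} \<Longrightarrow> y' x = m * y x" and x: "x \<in> {a..b}" for y dy y' dy' x
  proof (rule vector_derivative_unique_within_closed_interval[OF ab])
    show "x \<in> cbox a b" using x by simp
    show "(y' has_vector_derivative dy' x) (at x within cbox a b)" using y' x unfolding sol_def by auto
    have "((\<lambda>x. m * y x) has_vector_derivative m * dy x) (at x within {a..b})"
      using y x unfolding sol_def by (auto intro: has_vector_derivative_mult_right)
    then show "(y' has_vector_derivative m * dy x) (at x within cbox a b)"
      using has_vector_derivative_transform[OF x, of y' "\<lambda>x. m * y x" "m * dy x"] e by simp
  qed
  have pC: "C' x = m * C x" and pS: "S' x = m * S x" if "x \<in> {a..b}" for x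
    using par[OF that] m[OF that] by auto
  show "\<exists>\<mu>. \<mu>\<^sup>2 = 1 \<and> (\<forall>x\<in>{a..b}. C' x = \<mu> * C x \<and> S' x = \<mu> * S x \<and> dC' x = \<mu> * dC x \<and> dS' x = \<mu> * dS x)"
    using m2 pC pS dpar[OF C C' pC] dpar[OF S S' pS] by blast
  \<comment> \<open>Multiplying the second equation by \<open>m\<close> and using
    \<open>m^2 = 1\<close> writes both potentials against the same function \<open>y\<close>, with
    the same indefinite integral.\<close>
  have ae: "AE x in lebesgue. x \<in> {a..b} \<longrightarrow> (P x - P' x) * y x = 0"
    if y: "sol P a b y dy" and y': "sol P' a b y' dy'" and e: "\<And>x. x \<in> {a..b} \<Longrightarrow> y' x = m * y x" for y dy y' dy'
  proof (rule AE_eq_0_if_integrals_eq_0)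
    have "(\<lambda>x. P x - P' x) absolutely_integrable_on {a..b}" by (rule set_integral_diff(1)[OF P P'])
    then show "(\<lambda>x. (P x - P' x) * y x) absolutely_integrable_on {a..b}"
      by (rule abs_int_mult_continuous) (rule sol_continuous[OF y])
    fix x assume x: "x \<in> {a..b}"
    have 1: "((\<lambda>x. P x * y x) has_integral (dy x - dy a)) {a..x}"
      using ac_deriv_onD(2)[OF sol_ac(2)[OF y], of a x] x by auto
    have "((\<lambda>x. P' x * y' x) has_integral (dy' x - dy' a)) {a..x}"
      using ac_deriv_onD(2)[OF sol_ac(2)[OF y'], of a x] x by auto
    then have "((\<lambda>x. m * (P' x * y' x)) has_integral (m * (dy' x - dy' a))) {a..x}"
      by (rule has_integral_mult_right)
    moreover have "m * (dy' x - dy' a) = dy x - dy a"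
    proof -
      have "m * (dy' x - dy' a) = m\<^sup>2 * (dy x - dy a)"
        using dpar[OF y y' e, of x] dpar[OF y y' e, of a] x ab by (simp add: power2_eq_square algebra_simps)
      then show ?thesis using m2 by simp
    qed
    ultimately have "((\<lambda>x. m * (P' x * y' x)) has_integral (dy x - dy a)) {a..x}" by simp
    moreover have "m * (P' t * y' t) = P' t * y t" if "t \<in> {a..x}" for t
    proof -
      have "m * (P' t * y' t) = m\<^sup>2 * (P' t * y t)"
        using e[of t] that x by (simp add: power2_eq_square algebra_simps)
      then show ?thesis using m2 by simp
    qed
    ultimately have 2: "((\<lambda>x. P' x * y x) has_integral (dy x - dy a)) {a..x}"
      using has_integral_eq[of "{a..x}" "\<lambda>x. m * (P' x * y' x)" "\<lambda>x. P' x * y x"] by simp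
    show "((\<lambda>x. (P x - P' x) * y x) has_integral 0) {a..x}"
      using has_integral_diff[OF 1 2] by (simp add: left_diff_distrib)
  qed
  have aeC: "AE x in lebesgue. x \<in> {a..b} \<longrightarrow> (P x - P' x) * C x = 0"
    by (rule ae[OF C C']) (rule pC)
  have aeS: "AE x in lebesgue. x \<in> {a..b} \<longrightarrow> (P x - P' x) * S x = 0"
    by (rule ae[OF S S']) (rule pS)
  show "AE x in lebesgue. x \<in> {a..b} \<longrightarrow> P x = P' x"
    using aeC aeS
  proof eventually_elim
    case (elim x)
    show ?case
    proof
      assume x: "x \<in> {a..b}"
      \<comment> \<open>A single solution may vanish at \<open>x\<close>, so its equation alone does
        not determine the potential there; the Wronskian excludes a common zero.\<close>
      then have "C x \<noteq> 0 \<or> S x \<noteq> 0" using W[OF x] by auto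
      then show "P x = P' x" using elim x by auto
    qed
  qed
qed

text \<open>The left end point is excluded: at \<open>pi - \<delta>\<close> the derivative within
  the short interval is one-sided, while within \<open>{0..pi}\<close> it may be two-sided.
  Elsewhere the two sets coincide near \<open>x\<close>.\<close>

lemma nderiv_within_local:
  assumes "0 < \<delta>" "\<delta> \<le> pi" "x \<in> {pi - \<delta><..pi}"
  shows "nderiv_within {pi - \<delta>..pi} j f x = nderiv_within {0..pi} j f x"
  using assms(3)
proof (induction j arbitrary: x)
  case (Suc j)
  have at: "at x within {pi - \<delta>..pi} = at x within {0..pi}"
    by (rule at_within_nhd[of x "{pi - \<delta><..}"]) (use Suc.prems assms in auto)
  have "eventually (\<lambda>y. y \<in> {pi - \<delta><..}) (nhds x)"
    by (rule eventually_nhds_in_open) (use Suc.prems in auto)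
  then have "eventually (\<lambda>y. y \<in> {0..pi} \<longrightarrow> nderiv_within {pi - \<delta>..pi} j f y = nderiv_within {0..pi} j f y) (nhds x)"
    by eventually_elim (use Suc.IH in auto)
  then have "vector_derivative (nderiv_within {pi - \<delta>..pi} j f) (at x within {0..pi}) =
      vector_derivative (nderiv_within {0..pi} j f) (at x within {0..pi})"
    by (rule vector_derivative_cong_eq) (use Suc.prems assms in auto)
  then show ?case by (simp add: at)
qed simp

text \<open>The derivatives are moved to the common base set \<open>{0..pi}\<close>, so that two
  functions with different \<open>\<delta>\<close> can be subtracted. Of the continuity of the last
  derivative only the limit at \<open>pi\<close> is kept.\<close>

lemma C_near_pi_derivatives:
  assumes f: "C_near_pi m f" and m: "m \<ge> 0"
  shows "\<exists>\<delta>. 0 < \<delta> \<and> \<delta> \<le> pi \<and>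
    (\<forall>j<nat m. \<forall>x\<in>{pi - \<delta><..pi}. (nderiv_within {0..pi} j f has_vector_derivative nderiv_within {0..pi} (Suc j) f x) (at x within {0..pi})) \<and>
    (nderiv_within {0..pi} (nat m) f \<longlongrightarrow> nderiv_within {0..pi} (nat m) f pi) (at_left pi)"
proof -
  obtain \<delta> where \<delta>: "0 < \<delta>" "\<delta> \<le> pi" "C_on (nat m) f {pi - \<delta>..pi}"
    using f m unfolding C_near_pi_def by blast
  let ?S = "{pi - \<delta>..pi}"
  have 1: "(nderiv_within {0..pi} j f has_vector_derivative nderiv_within {0..pi} (Suc j) f x) (at x within {0..pi})"
    if j: "j < nat m" and x: "x \<in> {pi - \<delta><..pi}" for j x
  proof -
    have at: "at x within ?S = at x within {0..pi}"
      by (rule at_within_nhd[of x "{pi - \<delta><..}"]) (use x \<delta> in auto)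
    have "nderiv_within ?S j f differentiable (at x within ?S)"
      using \<delta>(3) j x unfolding C_on_def by auto
    then have "(nderiv_within ?S j f has_vector_derivative nderiv_within ?S (Suc j) f x) (at x within ?S)"
      by (simp add: vector_derivative_works)
    then have D: "(nderiv_within ?S j f has_vector_derivative nderiv_within {0..pi} (Suc j) f x) (at x within {0..pi})"
      unfolding at nderiv_within_local[OF \<delta>(1,2) x] .
    show ?thesis
    proof (rule has_vector_derivative_transform_within[OF D])
      show "0 < x - (pi - \<delta>)" using x by simp
      show "x \<in> {0..pi}" using x \<delta> by auto
      fix y assume "y \<in> {0..pi}" "dist y x < x - (pi - \<delta>)"
      then have "y \<in> {pi - \<delta><..pi}" by (auto simp: dist_real_def)
      then show "nderiv_within ?S j f y = nderiv_within {0..pi} j f y"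
        by (rule nderiv_within_local[OF \<delta>(1,2)])
    qed
  qed
  have "continuous_on ?S (nderiv_within ?S (nat m) f)" using \<delta>(3) unfolding C_on_def by auto
  then have "(nderiv_within ?S (nat m) f \<longlongrightarrow> nderiv_within ?S (nat m) f pi) (at pi within ?S)"
    using \<delta>(1) unfolding continuous_on_def by auto
  then have L: "(nderiv_within ?S (nat m) f \<longlongrightarrow> nderiv_within ?S (nat m) f pi) (at_left pi)"
    using at_within_Icc_at_left[of "pi - \<delta>" pi] \<delta>(1) by simp
  have "(nderiv_within {0..pi} (nat m) f \<longlongrightarrow> nderiv_within ?S (nat m) f pi) (at_left pi)"
  proof (rule Lim_transform_eventually[OF L])
    have "eventually (\<lambda>x. x \<in> {pi - \<delta><..<pi}) (at_left pi)"
      using \<delta>(1) by (intro eventually_at_leftI[of "pi - \<delta>"]) auto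
    then show "eventually (\<lambda>x. nderiv_within ?S (nat m) f x = nderiv_within {0..pi} (nat m) f x) (at_left pi)"
      by eventually_elim (rule nderiv_within_local[OF \<delta>(1,2)], auto)
  qed
  then have 2: "(nderiv_within {0..pi} (nat m) f \<longlongrightarrow> nderiv_within {0..pi} (nat m) f pi) (at_left pi)"
    using nderiv_within_local[OF \<delta>(1,2), of pi "nat m" f] \<delta>(1) by simp
  show ?thesis using \<delta>(1,2) 1 2 by blast
qed

text \<open>The derivative of order \<open>m\<close> of \<open>f - g\<close> is at most
  \<open>e\<close> near \<open>pi\<close> by continuity, and each integration from
  \<open>pi\<close>, where the lower derivatives vanish, gains a factor \<open>pi - t\<close>. The
  factorials of Taylor's formula are given away.\<close>

lemma taylor_at_pi:
  assumes f: "C_near_pi m f" and g: "C_near_pi m g" and m: "m \<ge> 0"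
    and eq: "\<And>j. int j \<le> m \<Longrightarrow> nderiv_at_pi j f = nderiv_at_pi j g" and e: "e > 0"
  shows "\<exists>\<eta>>0. \<forall>t. pi - \<eta> < t \<longrightarrow> t \<le> pi \<longrightarrow> norm (f t - g t) \<le> e * (pi - t) ^ nat m"
proof -
  define D where "D j x = nderiv_within {0..pi} j f x - nderiv_within {0..pi} j g x" for j x
  obtain \<delta>1 where d1: "0 < \<delta>1" "\<delta>1 \<le> pi"
    "\<And>j x. j < nat m \<Longrightarrow> x \<in> {pi - \<delta>1<..pi} \<Longrightarrow> (nderiv_within {0..pi} j f has_vector_derivative nderiv_within {0..pi} (Suc j) f x) (at x within {0..pi})"
    "(nderiv_within {0..pi} (nat m) f \<longlongrightarrow> nderiv_within {0..pi} (nat m) f pi) (at_left pi)"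
    using C_near_pi_derivatives[OF f m] by blast
  obtain \<delta>2 where d2: "0 < \<delta>2" "\<delta>2 \<le> pi"
    "\<And>j x. j < nat m \<Longrightarrow> x \<in> {pi - \<delta>2<..pi} \<Longrightarrow> (nderiv_within {0..pi} j g has_vector_derivative nderiv_within {0..pi} (Suc j) g x) (at x within {0..pi})"
    "(nderiv_within {0..pi} (nat m) g \<longlongrightarrow> nderiv_within {0..pi} (nat m) g pi) (at_left pi)"
    using C_near_pi_derivatives[OF g m] by blast
  have D0: "D j pi = 0" if "j \<le> nat m" for j
  proof -
    have "int j \<le> m" using that m by linarith
    then show ?thesis using eq[of j] by (simp add: D_def nderiv_at_pi_def)
  qed
  have "(D (nat m) \<longlongrightarrow> D (nat m) pi) (at_left pi)"
    unfolding D_def[abs_def] by (intro tendsto_diff d1 d2)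
  then have "eventually (\<lambda>x. norm (D (nat m) x) < e) (at_left pi)"
    using D0[of "nat m"] e by (auto dest: tendstoD)
  then obtain c where c: "c < pi" "\<And>x. c < x \<Longrightarrow> x < pi \<Longrightarrow> norm (D (nat m) x) < e"
    unfolding eventually_at_left_field by blast
  define \<eta> where "\<eta> = min (min \<delta>1 \<delta>2) (pi - c)"
  have \<eta>: "\<eta> > 0" using d1 d2 c by (simp add: \<eta>_def)
  \<comment> \<open>The induction descends from the highest derivative; \<open>i\<close> counts the
    integrations carried out.\<close>
  have main: "norm (D (nat m - i) t) \<le> e * (pi - t) ^ i" if "i \<le> nat m" "pi - \<eta> < t" "t \<le> pi" for i t
    using that
  proof (induction i arbitrary: t)
    case 0
    show ?case
    proof (cases "t = pi")
      case True then show ?thesis using D0[of "nat m"] e by simp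
    next
      case False
      have "\<eta> \<le> pi - c" by (simp add: \<eta>_def)
      then have "c < t" "t < pi" using 0 False by auto
      then show ?thesis using c(2)[of t] by auto
    qed
  next
    case (Suc i)
    define j where "j = nat m - Suc i"
    have j: "Suc j = nat m - i" "j < nat m" using Suc.prems by (auto simp: j_def)
    have "(D (Suc j) has_integral (D j pi - D j t)) {t..pi}"
    proof (rule fundamental_theorem_of_calculus)
      show "t \<le> pi" using Suc.prems by simp
      fix x assume x: "x \<in> {t..pi}"
      have "(D j has_vector_derivative D (Suc j) x) (at x within {0..pi})"
        unfolding D_def[abs_def]
        by (intro has_vector_derivative_diff d1(3) d2(3)) (use j x Suc.prems in \<open>auto simp: \<eta>_def\<close>)
      then show "(D j has_vector_derivative D (Suc j) x) (at x within {t..pi})"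
        by (rule has_vector_derivative_within_subset) (use Suc.prems d1 in \<open>auto simp: \<eta>_def\<close>)
    qed
    then have "norm (D j pi - D j t) \<le> (e * (pi - t) ^ i) * measure lborel {t..pi}"
    proof (rule has_integral_bound_real[where S = "{}", rotated 2])
      show "0 \<le> e * (pi - t) ^ i" using e Suc.prems by simp
      fix x assume x: "x \<in> {t..pi} - {}"
      then have "norm (D (Suc j) x) \<le> e * (pi - x) ^ i"
        unfolding j using Suc.prems by (intro Suc.IH) auto
      also have "\<dots> \<le> e * (pi - t) ^ i" using e x by (intro mult_left_mono power_mono) auto
      finally show "norm (D (Suc j) x) \<le> e * (pi - t) ^ i" .
    qed simp
    then show ?case using D0[of j] j Suc.prems by (simp add: j_def mult_ac)
  qed
  show ?thesis
  proof (intro exI[of _ \<eta>] conjI allI impI \<eta>)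
    fix t assume "pi - \<eta> < t" "t \<le> pi"
    from main[OF order_refl this] show "norm (f t - g t) \<le> e * (pi - t) ^ nat m" by (simp add: D_def)
  qed
qed

section \<open>Laplace integrals of the difference of the potentials\<close>

lemma exp_decay_integral_le:
  fixes r a b :: real
  assumes "r > 0" "a \<le> b"
  shows "((\<lambda>t. r * exp (- r * (b - t))) has_integral (1 - exp (- r * (b - a)))) {a..b}"
proof -
  have "((\<lambda>t. r * exp (- r * (b - t))) has_integral (exp (- r * (b - b)) - exp (- r * (b - a)))) {a..b}"
    by (rule fundamental_theorem_of_calculus[OF assms(2)])
       (auto intro!: derivative_eq_intros simp: has_real_derivative_iff_has_vector_derivative[symmetric])
  then show ?thesis by simp
qed

lemma power_le_fact_exp:
  fixes y :: real
  assumes "y \<ge> 0"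
  shows "y ^ n \<le> fact n * exp y"
proof -
  have "y ^ n / fact n \<le> (\<Sum>k. y ^ k / fact k)"
  proof -
    have "(\<Sum>k\<in>{n}. y ^ k / fact k) \<le> (\<Sum>k. y ^ k / fact k)"
      by (rule sum_le_suminf) (use assms summable_exp[of y] in \<open>auto simp: field_simps\<close>)
    then show ?thesis by simp
  qed
  also have "\<dots> = exp y" by (simp add: exp_def field_simps scaleR_conv_of_real)
  finally show ?thesis by (simp add: field_simps)
qed

text \<open>The kernel concentrates at \<open>pi\<close> on the scale \<open>1 / r\<close>. There
  the difference is \<open>o((pi - t)^m)\<close>, which yields \<open>o(r^(- (m + 1)))\<close>; at
  distance at least \<open>\<eta>\<close> from \<open>pi\<close> the kernel is exponentially
  small.\<close>

lemma laplace_decay: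
  fixes q q' :: "real \<Rightarrow> complex"
  assumes q: "q absolutely_integrable_on {0..pi}" "q' absolutely_integrable_on {0..pi}"
    and m: "m \<ge> -1" and C: "C_near_pi m q" "C_near_pi m q'"
    and eq: "\<And>j. int j \<le> m \<Longrightarrow> nderiv_at_pi j q = nderiv_at_pi j q'"
    and d: "0 \<le> d" "d < pi" and e: "e > 0"
  shows "\<exists>R. \<forall>r\<ge>R. r ^ nat (m + 1) * integral {d..pi} (\<lambda>t. norm (q' t - q t) * exp (- (2 * r) * (pi - t))) \<le> e"
proof -
  define p where "p t = norm (q' t - q t)" for t
  have qq: "(\<lambda>t. q' t - q t) absolutely_integrable_on {0..pi}" by (rule set_integral_diff(1)[OF q(2,1)])
  have pint: "p integrable_on {0..pi}" unfolding p_def[abs_def] by (rule abs_integrable_imp_norm[OF qq])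
  have psub: "p integrable_on {s..t}" if "0 \<le> s" "t \<le> pi" for s t
    by (rule integrable_on_subinterval[OF pint]) (use that in auto)
  have pe: "(\<lambda>t. p t * exp (- (2 * r) * (pi - t))) integrable_on {s..t}" if "0 \<le> s" "t \<le> pi" for s t r
  proof -
    have "(\<lambda>t. (q' t - q t) * of_real (exp (- (2 * r) * (pi - t)))) absolutely_integrable_on {0..pi}"
      by (rule abs_int_mult_continuous[OF qq]) (intro continuous_intros)
    then have "(\<lambda>t. norm ((q' t - q t) * of_real (exp (- (2 * r) * (pi - t))))) integrable_on {0..pi}"
      by (rule abs_integrable_imp_norm)
    then have "(\<lambda>t. p t * exp (- (2 * r) * (pi - t))) integrable_on {0..pi}"
      by (simp add: p_def norm_mult)
    then show ?thesis by (rule integrable_on_subinterval) (use that in auto)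
  qed
  define K where "K = nat (m + 1)"
  have near: "\<exists>\<eta>>0. \<eta> \<le> pi - d \<and> (\<forall>r\<ge>1. r ^ K * integral {pi - \<eta>..pi} (\<lambda>t. p t * exp (- (2 * r) * (pi - t))) \<le> e / 2)"
  proof (cases "m \<ge> 0")
    case True
    define M where "M = nat m"
    have K: "K = Suc M" using True by (simp add: K_def M_def)
    define e' where "e' = e / (2 * fact M)"
    have "e' > 0" using e by (simp add: e'_def)
    obtain \<eta>0 where e0: "\<eta>0 > 0" "\<And>t. pi - \<eta>0 < t \<Longrightarrow> t \<le> pi \<Longrightarrow> norm (q t - q' t) \<le> e' * (pi - t) ^ M"
      using taylor_at_pi[OF C True eq \<open>e' > 0\<close>] unfolding M_def by blast
    define \<eta> where "\<eta> = min (\<eta>0 / 2) (pi - d)"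
    show ?thesis
    proof (intro exI[of _ \<eta>] conjI allI impI)
      show "\<eta> > 0" "\<eta> \<le> pi - d" using e0 d by (auto simp: \<eta>_def)
      then have \<eta>: "0 \<le> pi - \<eta>" "pi - \<eta> \<le> pi" using d by auto
      fix r :: real assume r: "r \<ge> 1"
      have "integral {pi - \<eta>..pi} (\<lambda>t. r ^ K * (p t * exp (- (2 * r) * (pi - t))))
         \<le> integral {pi - \<eta>..pi} (\<lambda>t. (e' * fact M) * (r * exp (- r * (pi - t))))"
      proof (rule integral_le)
        show "(\<lambda>t. r ^ K * (p t * exp (- (2 * r) * (pi - t)))) integrable_on {pi - \<eta>..pi}"
          by (intro integrable_on_mult_right pe \<eta>) auto
        show "(\<lambda>t. (e' * fact M) * (r * exp (- r * (pi - t)))) integrable_on {pi - \<eta>..pi}"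
          by (intro integrable_continuous_real continuous_intros)
        fix t assume t: "t \<in> {pi - \<eta>..pi}"
        have "\<eta> < \<eta>0" using e0 by (simp add: \<eta>_def min_def)
        then have "p t \<le> e' * (pi - t) ^ M" using e0(2)[of t] t by (simp add: p_def norm_minus_commute)
        then have "r ^ K * (p t * exp (- (2 * r) * (pi - t))) \<le> r ^ K * ((e' * (pi - t) ^ M) * exp (- (2 * r) * (pi - t)))"
          using r by (intro mult_left_mono mult_right_mono) auto
        also have "\<dots> = e' * r * (r * (pi - t)) ^ M * exp (- (2 * r) * (pi - t))"
          by (simp add: K power_mult_distrib)
        \<comment> \<open>Half of the exponential decay pays for the power of
          \<open>r * (pi - t)\<close>, the other half still integrates to at most
          \<open>1 / r\<close>. The factorial explains \<open>e'\<close>.\<close>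
        also have "\<dots> \<le> e' * r * (fact M * exp (r * (pi - t))) * exp (- (2 * r) * (pi - t))"
          using r t \<open>e' > 0\<close> by (intro mult_right_mono mult_left_mono power_le_fact_exp) auto
        also have "\<dots> = (e' * fact M) * (r * (exp (r * (pi - t)) * exp (- (2 * r) * (pi - t))))" by simp
        also have "exp (r * (pi - t)) * exp (- (2 * r) * (pi - t)) = exp (- r * (pi - t))"
          by (simp add: exp_add[symmetric])
        finally show "r ^ K * (p t * exp (- (2 * r) * (pi - t))) \<le> (e' * fact M) * (r * exp (- r * (pi - t)))" .
      qed
      also have "\<dots> = (e' * fact M) * (1 - exp (- r * (pi - (pi - \<eta>))))"
        using exp_decay_integral_le[of r "pi - \<eta>" pi] r \<eta> by (intro integral_unique has_integral_mult_right) auto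
      also have "\<dots> \<le> (e' * fact M) * 1" using \<open>e' > 0\<close> by (intro mult_left_mono) auto
      also have "\<dots> = e / 2" by (simp add: e'_def)
      finally show "r ^ K * integral {pi - \<eta>..pi} (\<lambda>t. p t * exp (- (2 * r) * (pi - t))) \<le> e / 2" by simp
    qed
  next
    case False
    then have K: "K = 0" using m by (simp add: K_def)
    \<comment> \<open>For \<open>m = -1\<close> no power of \<open>r\<close> has to be won, since
      \<open>K = 0\<close>; the smallness comes from the continuity of the indefinite integral at
      \<open>pi\<close>.\<close>
    have "continuous_on {0..pi} (\<lambda>x. integral {0..x} p)"
      by (rule indefinite_integral_continuous_1[OF pint])
    then have "((\<lambda>x. integral {0..x} p) \<longlongrightarrow> integral {0..pi} p) (at_left pi)"
      using at_within_Icc_at_left[of 0 pi] unfolding continuous_on_def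
      by (metis atLeastAtMost_iff order_refl pi_ge_zero pi_gt_zero)
    then have "eventually (\<lambda>x. dist (integral {0..x} p) (integral {0..pi} p) < e / 2) (at_left pi)"
      using e by (intro tendstoD) auto
    moreover have "eventually (\<lambda>x. x \<in> {d<..<pi}) (at_left pi)"
      using d by (intro eventually_at_leftI[of d]) auto
    ultimately have "eventually (\<lambda>x. dist (integral {0..x} p) (integral {0..pi} p) < e / 2 \<and> x \<in> {d<..<pi}) (at_left pi)"
      by (rule eventually_conj)
    then obtain c where c: "dist (integral {0..c} p) (integral {0..pi} p) < e / 2" "c \<in> {d<..<pi}"
      using eventually_happens'[OF trivial_limit_at_left_real] by blast
    show ?thesis
    proof (intro exI[of _ "pi - c"] conjI allI impI)
      show "pi - c > 0" "pi - c \<le> pi - d" using c by auto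
      fix r :: real assume r: "r \<ge> 1"
      have "integral {c..pi} (\<lambda>t. p t * exp (- (2 * r) * (pi - t))) \<le> integral {c..pi} p"
      proof (rule integral_le)
        show "(\<lambda>t. p t * exp (- (2 * r) * (pi - t))) integrable_on {c..pi}"
          by (rule pe) (use c d in auto)
        show "p integrable_on {c..pi}" by (rule psub) (use c d in auto)
        fix t assume t: "t \<in> {c..pi}"
        have "exp (- (2 * r) * (pi - t)) \<le> 1" using r t by (auto simp: mult_le_0_iff)
        then show "p t * exp (- (2 * r) * (pi - t)) \<le> p t"
          using mult_left_mono[of _ 1 "p t"] by (simp add: p_def)
      qed
      also have "integral {c..pi} p = integral {0..pi} p - integral {0..c} p"
        using Henstock_Kurzweil_Integration.integral_combine[of 0 c pi p] pint c d by simp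
      also have "\<dots> \<le> e / 2" using c(1) unfolding dist_real_def by linarith
      finally show "r ^ K * integral {pi - (pi - c)..pi} (\<lambda>t. p t * exp (- (2 * r) * (pi - t))) \<le> e / 2"
        by (simp add: K)
    qed
  qed
  then obtain \<eta> where \<eta>: "\<eta> > 0" "\<eta> \<le> pi - d"
    "\<And>r. r \<ge> 1 \<Longrightarrow> r ^ K * integral {pi - \<eta>..pi} (\<lambda>t. p t * exp (- (2 * r) * (pi - t))) \<le> e / 2" by blast
  define B where "B = integral {0..pi} p"
  have B0: "B \<ge> 0" unfolding B_def by (intro integral_nonneg pint) (auto simp: p_def)
  have "((\<lambda>r. r ^ K * (B * exp (- (2 * r) * \<eta>))) \<longlongrightarrow> 0) at_top"
    using \<eta>(1) by real_asymp
  then have "eventually (\<lambda>r. r ^ K * (B * exp (- (2 * r) * \<eta>)) < e / 2) at_top"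
    using e by (intro order_tendstoD) auto
  then obtain R where R: "\<And>r. r \<ge> R \<Longrightarrow> r ^ K * (B * exp (- (2 * r) * \<eta>)) < e / 2"
    unfolding eventually_at_top_linorder by blast
  show ?thesis
  proof (intro exI[of _ "max 1 R"] allI impI)
    fix r assume r: "r \<ge> max 1 R"
    let ?f = "\<lambda>t. p t * exp (- (2 * r) * (pi - t))"
    have rR: "R \<le> r" using r by simp
    have "integral {d..pi - \<eta>} ?f \<le> integral {d..pi - \<eta>} (\<lambda>t. p t * exp (- (2 * r) * \<eta>))"
    proof (rule integral_le)
      show "?f integrable_on {d..pi - \<eta>}" using d \<eta> by (intro pe) auto
      show "(\<lambda>t. p t * exp (- (2 * r) * \<eta>)) integrable_on {d..pi - \<eta>}"
        using d \<eta> by (intro integrable_on_mult_left psub) auto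
      fix t assume t: "t \<in> {d..pi - \<eta>}"
      have "exp (- (2 * r) * (pi - t)) \<le> exp (- (2 * r) * \<eta>)"
        using t r by (simp add: mult_left_mono)
      then show "?f t \<le> p t * exp (- (2 * r) * \<eta>)" by (intro mult_left_mono) (auto simp: p_def)
    qed
    also have "\<dots> = integral {d..pi - \<eta>} p * exp (- (2 * r) * \<eta>)" by simp
    also have "\<dots> \<le> B * exp (- (2 * r) * \<eta>)"
    proof -
      have "integral {d..pi - \<eta>} p \<le> B" unfolding B_def
        by (rule integral_subset_le) (use d \<eta> pint psub in \<open>auto simp: p_def\<close>)
      then show ?thesis by (intro mult_right_mono) auto
    qed
    finally have "r ^ K * integral {d..pi - \<eta>} ?f \<le> r ^ K * (B * exp (- (2 * r) * \<eta>))"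
      using r by (intro mult_left_mono) auto
    then have 1: "r ^ K * integral {d..pi - \<eta>} ?f \<le> e / 2" using R[OF rR] by linarith
    have "integral {d..pi} ?f = integral {d..pi - \<eta>} ?f + integral {pi - \<eta>..pi} ?f"
      by (rule Henstock_Kurzweil_Integration.integral_combine[symmetric]) (use d \<eta> pe in auto)
    then have "r ^ K * integral {d..pi} ?f = r ^ K * integral {d..pi - \<eta>} ?f + r ^ K * integral {pi - \<eta>..pi} ?f"
      by (simp add: distrib_left)
    also have "\<dots> \<le> e" using 1 \<eta>(3)[of r] r by simp
    finally show "r ^ nat (m + 1) * integral {d..pi} (\<lambda>t. norm (q' t - q t) * exp (- (2 * r) * (pi - t))) \<le> e"
      by (simp add: K_def p_def)
  qed
qed

section \<open>The characteristic functions\<close>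

lemma prod_linear_ratio_tendsto:
  assumes "finite S"
  shows "((\<lambda>r::real. (\<Prod>n\<in>S. - (of_real r)\<^sup>2 - a n) / (- (of_real r)\<^sup>2) ^ card S) \<longlongrightarrow> (1::complex)) at_top"
proof -
  have one: "((\<lambda>r::real. (- (of_real r)\<^sup>2 - c) / (- (of_real r)\<^sup>2)) \<longlongrightarrow> 1) at_top" for c :: complex
  proof -
    have "((\<lambda>r::real. norm (c / (of_real r)\<^sup>2)) \<longlongrightarrow> 0) at_top"
      by (simp add: norm_divide norm_power) real_asymp
    then have "((\<lambda>r::real. c / (of_real r)\<^sup>2) \<longlongrightarrow> 0) at_top" by (rule tendsto_norm_zero_cancel)
    then have "((\<lambda>r::real. 1 + c / (of_real r)\<^sup>2) \<longlongrightarrow> 1 + 0) at_top" by (intro tendsto_intros)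
    then have L: "((\<lambda>r::real. 1 + c / (of_real r)\<^sup>2) \<longlongrightarrow> 1) at_top" by simp
    show ?thesis
    proof (rule Lim_transform_eventually[OF L])
      show "eventually (\<lambda>r::real. 1 + c / (of_real r)\<^sup>2 = (- (of_real r)\<^sup>2 - c) / (- (of_real r)\<^sup>2)) at_top"
        using eventually_gt_at_top[of 0] by eventually_elim (simp add: field_simps)
    qed
  qed
  have "((\<lambda>r::real. \<Prod>n\<in>S. (- (of_real r)\<^sup>2 - a n) / (- (of_real r)\<^sup>2)) \<longlongrightarrow> (\<Prod>n\<in>S. 1)) at_top"
    by (intro tendsto_prod one)
  then show ?thesis unfolding prod_dividef prod_constant by simp
qed

text \<open>Lagrange's identity is used on \<open>[d, pi]\<close> only. Relative to the product of
  the two end values, the Wronskian at \<open>d\<close> is exponentially small, so the jump and the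
  potentials left of \<open>d\<close> do not enter the rate; the rest is the integral of the
  difference of the potentials against \<open>Z * Z'\<close>, which is a Laplace integral.\<close>

lemma phi_fam_wronskian_decay:
  assumes q: "q absolutely_integrable_on {0..pi}" "q' absolutely_integrable_on {0..pi}"
    and \<beta>: "\<beta> > 0" "\<beta>' > 0" and d: "0 < d" "d < pi"
    and P: "phi_fam q h \<beta> \<gamma> d Y dY Z dZ" and P': "phi_fam q' h' \<beta>' \<gamma>' d Y' dY' Z' dZ'"
    and m: "m \<ge> -1" and C: "C_near_pi m q" "C_near_pi m q'"
    and eq: "\<And>j. int j \<le> m \<Longrightarrow> nderiv_at_pi j q = nderiv_at_pi j q'" and e: "e > 0"
  shows "\<exists>R\<ge>1. \<forall>r\<ge>R. let l = - ((complex_of_real r)\<^sup>2) in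
     Z l pi \<noteq> 0 \<and> Z' l pi \<noteq> 0 \<and>
     norm (dZ l pi - of_real r * Z l pi) \<le> e * r * norm (Z l pi) \<and>
     norm (dZ' l pi - of_real r * Z' l pi) \<le> e * r * norm (Z' l pi) \<and>
     r ^ nat (m + 1) * norm (Z l pi * dZ' l pi - dZ l pi * Z' l pi) \<le> e * (norm (Z l pi) * norm (Z' l pi))"
proof -
  obtain C1 where C1: "C1 > 0" "\<forall>\<epsilon>>0. \<exists>R\<ge>1. \<forall>k. R \<le> norm k \<longrightarrow> norm k \<le> 2 * Re k \<longrightarrow>
     phi_est d C1 \<epsilon> k (Y (- (k\<^sup>2))) (dY (- (k\<^sup>2))) (Z (- (k\<^sup>2))) (dZ (- (k\<^sup>2)))"
    using phi_fam_asymp[OF q(1) d \<beta>(1) P] by blast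
  obtain C2 where C2: "C2 > 0" "\<forall>\<epsilon>>0. \<exists>R\<ge>1. \<forall>k. R \<le> norm k \<longrightarrow> norm k \<le> 2 * Re k \<longrightarrow>
     phi_est d C2 \<epsilon> k (Y' (- (k\<^sup>2))) (dY' (- (k\<^sup>2))) (Z' (- (k\<^sup>2))) (dZ' (- (k\<^sup>2)))"
    using phi_fam_asymp[OF q(2) d \<beta>(2) P'] by blast
  obtain R1 where R1: "R1 \<ge> 1" "\<And>k. R1 \<le> norm k \<Longrightarrow> norm k \<le> 2 * Re k \<Longrightarrow>
     phi_est d C1 e k (Y (- (k\<^sup>2))) (dY (- (k\<^sup>2))) (Z (- (k\<^sup>2))) (dZ (- (k\<^sup>2)))"
    using spec[OF C1(2), of e] e by blast
  obtain R2 where R2: "R2 \<ge> 1" "\<And>k. R2 \<le> norm k \<Longrightarrow> norm k \<le> 2 * Re k \<Longrightarrow>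
     phi_est d C2 e k (Y' (- (k\<^sup>2))) (dY' (- (k\<^sup>2))) (Z' (- (k\<^sup>2))) (dZ' (- (k\<^sup>2)))"
    using spec[OF C2(2), of e] e by blast
  define K where "K = nat (m + 1)"
  define c where "c = C1 * C2"
  have c0: "c > 0" using C1 C2 by (simp add: c_def)
  \<comment> \<open>Half of \<open>e\<close> goes to the Wronskian at \<open>d\<close> and half to
    the integral; \<open>c\<close> is the product of the two decay constants.\<close>
  define e1 where "e1 = e / (2 * c)"
  have e1: "e1 > 0" using e c0 by (simp add: e1_def)
  have d0: "0 \<le> d" using d by simp
  obtain R3 where R3: "\<And>r. r \<ge> R3 \<Longrightarrow> r ^ K * integral {d..pi} (\<lambda>t. norm (q' t - q t) * exp (- (2 * r) * (pi - t))) \<le> e1"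
    using laplace_decay[OF q m C eq d0 d(2) e1] unfolding K_def by blast
  have "pi - d > 0" using d by simp
  then have "((\<lambda>r. r ^ K * (2 * r * exp (- (2 * r) * (pi - d)))) \<longlongrightarrow> 0) at_top" by real_asymp
  then have "eventually (\<lambda>r. r ^ K * (2 * r * exp (- (2 * r) * (pi - d))) < e1) at_top"
    using e1 by (rule order_tendstoD)
  then obtain R4 where R4: "\<And>r. r \<ge> R4 \<Longrightarrow> r ^ K * (2 * r * exp (- (2 * r) * (pi - d))) < e1"
    unfolding eventually_at_top_linorder by blast
  show ?thesis
  proof (intro exI[of _ "max (max R1 R2) (max R3 R4)"] conjI allI impI)
    show "1 \<le> max (max R1 R2) (max R3 R4)" using R1(1) by simp
    fix r assume r: "max (max R1 R2) (max R3 R4) \<le> r"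
    then have rr: "R1 \<le> r" "R2 \<le> r" "R3 \<le> r" "R4 \<le> r" "1 \<le> r" using R1(1) by auto
    define k where "k = complex_of_real r"
    have k: "norm k = r" "Re k = r" using rr by (auto simp: k_def)
    define l where "l = - (k\<^sup>2)"
    have E1: "phi_est d C1 e k (Y l) (dY l) (Z l) (dZ l)" unfolding l_def by (rule R1(2)) (use rr k in auto)
    have E2: "phi_est d C2 e k (Y' l) (dY' l) (Z' l) (dZ' l)" unfolding l_def by (rule R2(2)) (use rr k in auto)
    have s1: "sol (\<lambda>x. q x - l) d pi (Z l) (dZ l)" and s2: "sol (\<lambda>x. q' x - l) d pi (Z' l) (dZ' l)"
      using P P' unfolding phi_fam_def jsol_def by auto
    define A where "A = norm (Z l pi) * norm (Z' l pi)"
    define W where "W x = Z l x * dZ' l x - dZ l x * Z' l x" for x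
    have b: "norm (Z l x) \<le> C1 * exp (- r * (pi - x)) * norm (Z l pi)" "norm (dZ l x) \<le> C1 * r * exp (- r * (pi - x)) * norm (Z l pi)"
      "norm (Z' l x) \<le> C2 * exp (- r * (pi - x)) * norm (Z' l pi)" "norm (dZ' l x) \<le> C2 * r * exp (- r * (pi - x)) * norm (Z' l pi)"
      if "x \<in> {d..pi}" for x
      using E1 E2 that unfolding phi_est_def k by blast+
    have ee: "exp (- r * (pi - x)) * exp (- r * (pi - x)) = exp (- (2 * r) * (pi - x))" for x
      by (simp add: exp_add[symmetric])
    have ZZ: "norm (Z l x) * norm (Z' l x) \<le> c * A * exp (- (2 * r) * (pi - x))" if x: "x \<in> {d..pi}" for x
    proof -
      have "norm (Z l x) * norm (Z' l x) \<le> (C1 * exp (- r * (pi - x)) * norm (Z l pi)) * (C2 * exp (- r * (pi - x)) * norm (Z' l pi))"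
        using b[OF x] C1(1) C2(1) by (intro mult_mono) auto
      also have "\<dots> = c * A * (exp (- r * (pi - x)) * exp (- r * (pi - x)))" by (simp add: c_def A_def)
      finally show ?thesis unfolding ee .
    qed
    have Wd: "norm (W d) \<le> c * A * (2 * r * exp (- (2 * r) * (pi - d)))"
    proof -
      have dd: "d \<in> {d..pi}" using d by simp
      have "norm (Z l d) * norm (dZ' l d) \<le> (C1 * exp (- r * (pi - d)) * norm (Z l pi)) * (C2 * r * exp (- r * (pi - d)) * norm (Z' l pi))"
        using b[OF dd] C1(1) C2(1) rr by (intro mult_mono) auto
      moreover have "norm (dZ l d) * norm (Z' l d) \<le> (C1 * r * exp (- r * (pi - d)) * norm (Z l pi)) * (C2 * exp (- r * (pi - d)) * norm (Z' l pi))"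
        using b[OF dd] C1(1) C2(1) rr by (intro mult_mono) auto
      moreover have "norm (W d) \<le> norm (Z l d) * norm (dZ' l d) + norm (dZ l d) * norm (Z' l d)"
        unfolding W_def by (metis norm_mult norm_triangle_ineq4)
      ultimately have "norm (W d) \<le> c * A * (2 * r * (exp (- r * (pi - d)) * exp (- r * (pi - d))))"
        by (simp add: c_def A_def mult_ac)
      then show ?thesis unfolding ee .
    qed
    have I: "((\<lambda>x. (q' x - q x) * Z l x * Z' l x) has_integral (W pi - W d)) {d..pi}"
      using ac_deriv_onD(2)[OF sol_lagrange[OF s1 s2], of d pi] d by (simp add: W_def)
    have qq: "(\<lambda>t. q' t - q t) absolutely_integrable_on {d..pi}"
      by (rule absolutely_integrable_on_subinterval[OF set_integral_diff(1)[OF q(2,1)]]) (use d in auto)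
    have pe: "(\<lambda>t. norm (q' t - q t) * exp (- (2 * r) * (pi - t))) integrable_on {d..pi}"
    proof -
      have "(\<lambda>t. (q' t - q t) * of_real (exp (- (2 * r) * (pi - t)))) absolutely_integrable_on {d..pi}"
        by (rule abs_int_mult_continuous[OF qq]) (intro continuous_intros)
      from abs_integrable_imp_norm[OF this] show ?thesis by (simp add: norm_mult)
    qed
    have Wi: "norm (W pi - W d) \<le> c * A * integral {d..pi} (\<lambda>t. norm (q' t - q t) * exp (- (2 * r) * (pi - t)))"
    proof -
      have "norm (W pi - W d) = norm (integral {d..pi} (\<lambda>x. (q' x - q x) * Z l x * Z' l x))"
        using I by (simp add: integral_unique)
      also have "\<dots> \<le> integral {d..pi} (\<lambda>t. c * A * (norm (q' t - q t) * exp (- (2 * r) * (pi - t))))"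
      proof (rule integral_norm_bound_integral)
        show "(\<lambda>x. (q' x - q x) * Z l x * Z' l x) integrable_on {d..pi}" using I by blast
        show "(\<lambda>t. c * A * (norm (q' t - q t) * exp (- (2 * r) * (pi - t)))) integrable_on {d..pi}"
          by (rule integrable_on_mult_right[OF pe])
        fix x assume x: "x \<in> {d..pi}"
        have "norm ((q' x - q x) * Z l x * Z' l x) = norm (q' x - q x) * (norm (Z l x) * norm (Z' l x))"
          by (simp add: norm_mult)
        also have "\<dots> \<le> norm (q' x - q x) * (c * A * exp (- (2 * r) * (pi - x)))"
          by (rule mult_left_mono[OF ZZ[OF x]]) simp
        finally show "norm ((q' x - q x) * Z l x * Z' l x) \<le> c * A * (norm (q' x - q x) * exp (- (2 * r) * (pi - x)))"
          by (simp add: mult_ac)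
      qed
      finally show ?thesis by simp
    qed
    define I2 where "I2 = integral {d..pi} (\<lambda>t. norm (q' t - q t) * exp (- (2 * r) * (pi - t)))"
    define I1 where "I1 = 2 * r * exp (- (2 * r) * (pi - d))"
    have cA: "c * A \<ge> 0" using c0 by (simp add: A_def)
    have rK: "r ^ K \<ge> 0" using rr by simp
    have "norm (W pi) \<le> norm (W d) + norm (W pi - W d)" by (metis add.commute norm_triangle_sub)
    also have "\<dots> \<le> c * A * I1 + c * A * I2" using Wd Wi unfolding I1_def I2_def by (rule add_mono)
    finally have "r ^ K * norm (W pi) \<le> r ^ K * (c * A * I1 + c * A * I2)" using rK by (rule mult_left_mono)
    also have "\<dots> = c * A * (r ^ K * I1) + c * A * (r ^ K * I2)" by (simp add: algebra_simps)
    also have "\<dots> \<le> c * A * e1 + c * A * e1"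
      using R3[OF rr(3)] R4[OF rr(4)] cA unfolding I1_def I2_def by (intro add_mono mult_left_mono) auto
    also have "\<dots> = e * A" using c0 by (simp add: e1_def)
    finally have main: "r ^ K * norm (W pi) \<le> e * A" .
    show "let l = - ((complex_of_real r)\<^sup>2) in
     Z l pi \<noteq> 0 \<and> Z' l pi \<noteq> 0 \<and>
     norm (dZ l pi - of_real r * Z l pi) \<le> e * r * norm (Z l pi) \<and>
     norm (dZ' l pi - of_real r * Z' l pi) \<le> e * r * norm (Z' l pi) \<and>
     r ^ nat (m + 1) * norm (Z l pi * dZ' l pi - dZ l pi * Z' l pi) \<le> e * (norm (Z l pi) * norm (Z' l pi))"
      unfolding Let_def k_def[symmetric] l_def[symmetric]
      using E1 E2 main unfolding phi_est_def k A_def W_def K_def by blast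
  qed
qed

lemma quotient_near_1:
  fixes f g :: "real \<Rightarrow> complex"
  assumes "\<And>e. e > 0 \<Longrightarrow> \<exists>R. \<forall>r\<ge>R. f r \<noteq> 0 \<and> norm (g r - of_real r * f r) \<le> e * r * norm (f r)"
  shows "((\<lambda>r. (g r + H * f r) / (of_real r * f r)) \<longlongrightarrow> 1) at_top"
proof (rule tendstoI)
  fix e :: real assume e: "e > 0"
  obtain R where R: "\<And>r. r \<ge> R \<Longrightarrow> f r \<noteq> 0 \<and> norm (g r - of_real r * f r) \<le> (e/2) * r * norm (f r)"
    using assms[of "e/2"] e by auto
  have "((\<lambda>r. norm H / r) \<longlongrightarrow> 0) at_top" by real_asymp
  then have "eventually (\<lambda>r. norm H / r < e / 2) at_top" using e by (intro order_tendstoD) auto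
  then show "eventually (\<lambda>r. dist ((g r + H * f r) / (of_real r * f r)) 1 < e) at_top"
    using eventually_ge_at_top[of "max 1 R"]
  proof eventually_elim
    case (elim r)
    then have r: "r > 0" "f r \<noteq> 0" and b: "norm (g r - of_real r * f r) \<le> (e/2) * r * norm (f r)"
      using R[of r] by auto
    have "(g r + H * f r) / (of_real r * f r) - 1 = (g r - of_real r * f r) / (of_real r * f r) + H / of_real r"
      using r by (simp add: field_simps)
    also have "norm \<dots> \<le> norm ((g r - of_real r * f r) / (of_real r * f r)) + norm (H / of_real r)"
      by (rule norm_triangle_ineq)
    also have "\<dots> = norm (g r - of_real r * f r) / (r * norm (f r)) + norm H / r"
      using r by (simp add: norm_divide norm_mult)
    also have "\<dots> \<le> e / 2 + norm H / r"
      using b r by (simp add: divide_le_eq mult_ac)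
    also have "\<dots> < e" using elim(1) by linarith
    finally show ?case by (simp add: dist_norm)
  qed
qed

text \<open>Multiplying the two proportionalities crosswise gives one identity with \<open>X\<close>
  on one side and \<open>V\<close> on the other. Its leading behaviour at \<open>l = - r^2\<close>
  gives \<open>c1 = c2\<close>. Then \<open>X - V\<close> times \<open>(g' + H * f') * f\<close>
  equals \<open>X\<close> times the Wronskian, in which \<open>H\<close> cancels, and the decay of
  the Wronskian forces \<open>X = V\<close>. The conclusion is for large \<open>norm l\<close>
  because \<open>X\<close> has to be cancelled.\<close>

lemma linear_factors_eq:
  fixes f g f' g' :: "complex \<Rightarrow> complex" and a a' b b' :: "nat \<Rightarrow> complex"
  assumes fin: "finite S" "finite T"
    and p1: "\<And>l. (g l + H * f l) * (\<Prod>n\<in>S. l - a' n) = c1 * ((g' l + H * f' l) * (\<Prod>n\<in>S. l - a n))"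
    and p2: "\<And>l. f l * (\<Prod>n\<in>T. l - b' n) = c2 * (f' l * (\<Prod>n\<in>T. l - b n))"
    and c: "c1 \<noteq> 0" "c2 \<noteq> 0"
    and K: "2 * (card S + card T) \<le> K + 1"
    and est: "\<And>e. e > 0 \<Longrightarrow> \<exists>R\<ge>1. \<forall>r\<ge>R. let l = - ((complex_of_real r)\<^sup>2) in
     f l \<noteq> 0 \<and> f' l \<noteq> 0 \<and> norm (g l - of_real r * f l) \<le> e * r * norm (f l) \<and>
     norm (g' l - of_real r * f' l) \<le> e * r * norm (f' l) \<and>
     r ^ K * norm (f l * g' l - g l * f' l) \<le> e * (norm (f l) * norm (f' l))"
  shows "\<exists>R. \<forall>l. R \<le> norm l \<longrightarrow> f l * g' l = g l * f' l"
proof -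
  define X where "X l = (\<Prod>n\<in>S. l - a' n) * (\<Prod>n\<in>T. l - b n)" for l
  define V where "V l = (\<Prod>n\<in>S. l - a n) * (\<Prod>n\<in>T. l - b' n)" for l
  define p where "p = card S + card T"
  have cross: "c2 * (X l * ((g l + H * f l) * f' l)) = c1 * (V l * ((g' l + H * f' l) * f l))" for l
  proof -
    have "c2 * (X l * ((g l + H * f l) * f' l)) = ((g l + H * f l) * (\<Prod>n\<in>S. l - a' n)) * (c2 * (f' l * (\<Prod>n\<in>T. l - b n)))"
      by (simp add: X_def mult_ac)
    also have "\<dots> = (c1 * ((g' l + H * f' l) * (\<Prod>n\<in>S. l - a n))) * (f l * (\<Prod>n\<in>T. l - b' n))"
      by (simp only: p1 p2)
    finally show ?thesis by (simp add: V_def mult_ac)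
  qed
  define L where "L r = - ((complex_of_real r)\<^sup>2)" for r
  have est': "\<exists>R\<ge>1. \<forall>r\<ge>R. f (L r) \<noteq> 0 \<and> f' (L r) \<noteq> 0 \<and> norm (g (L r) - of_real r * f (L r)) \<le> e * r * norm (f (L r)) \<and>
     norm (g' (L r) - of_real r * f' (L r)) \<le> e * r * norm (f' (L r)) \<and>
     r ^ K * norm (f (L r) * g' (L r) - g (L r) * f' (L r)) \<le> e * (norm (f (L r)) * norm (f' (L r)))" if "e > 0" for e
    using est[OF that] unfolding Let_def L_def .
  define u u' where "u r = (g (L r) + H * f (L r)) / (of_real r * f (L r))"
    and "u' r = (g' (L r) + H * f' (L r)) / (of_real r * f' (L r))" for r
  have lu: "(u \<longlongrightarrow> 1) at_top" and lu': "(u' \<longlongrightarrow> 1) at_top"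
    unfolding u_def[abs_def] u'_def[abs_def]
    using est' by (intro quotient_near_1; blast)+
  have lX: "((\<lambda>r. X (L r) / L r ^ p) \<longlongrightarrow> 1) at_top"
    using tendsto_mult[OF prod_linear_ratio_tendsto[OF fin(1), of a'] prod_linear_ratio_tendsto[OF fin(2), of b]]
    by (simp add: X_def L_def p_def power_add)
  have lV: "((\<lambda>r. V (L r) / L r ^ p) \<longlongrightarrow> 1) at_top"
    using tendsto_mult[OF prod_linear_ratio_tendsto[OF fin(1), of a] prod_linear_ratio_tendsto[OF fin(2), of b']]
    by (simp add: V_def L_def p_def power_add)
  obtain R1 where R1: "R1 \<ge> 1" "\<And>r. r \<ge> R1 \<Longrightarrow> f (L r) \<noteq> 0 \<and> f' (L r) \<noteq> 0"
    using est'[of 1] by auto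
  have ev1: "eventually (\<lambda>r. r > 0 \<and> f (L r) \<noteq> 0 \<and> f' (L r) \<noteq> 0) at_top"
    using eventually_ge_at_top[of R1] by eventually_elim (use R1 in auto)
  have frac: "c * ((x / y) * (w / (r * s))) = c * (x * (w * t)) / (y * (r * (s * t)))" if "t \<noteq> 0" for t c x y w r s :: complex
    using that by simp
  have cc: "c1 = c2"
  proof -
    have "((\<lambda>r. c2 * ((X (L r) / L r ^ p) * u r)) \<longlongrightarrow> c2 * (1 * 1)) at_top"
      by (intro tendsto_intros lX lu)
    moreover have "((\<lambda>r. c1 * ((V (L r) / L r ^ p) * u' r)) \<longlongrightarrow> c1 * (1 * 1)) at_top"
      by (intro tendsto_intros lV lu')
    moreover have "eventually (\<lambda>r. c2 * ((X (L r) / L r ^ p) * u r) = c1 * ((V (L r) / L r ^ p) * u' r)) at_top"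
      using ev1
    proof eventually_elim
      case (elim r)
      define D where "D = L r ^ p * (of_real r * (f (L r) * f' (L r)))"
      have "c2 * ((X (L r) / L r ^ p) * u r) = c2 * (X (L r) * ((g (L r) + H * f (L r)) * f' (L r))) / D"
        unfolding u_def D_def by (rule frac) (use elim in auto)
      also have "\<dots> = c1 * (V (L r) * ((g' (L r) + H * f' (L r)) * f (L r))) / D" by (simp only: cross)
      also have "\<dots> = c1 * ((V (L r) / L r ^ p) * u' r)"
        unfolding u'_def D_def using frac[of "f (L r)" c1 "V (L r)" "L r ^ p" "g' (L r) + H * f' (L r)" "of_real r" "f' (L r)"] elim
        by (simp add: mult.commute[of "f' (L r)"])
      finally show ?case .
    qed
    ultimately have "((\<lambda>r. c1 * ((V (L r) / L r ^ p) * u' r)) \<longlongrightarrow> c2 * (1 * 1)) at_top"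
      by - (rule Lim_transform_eventually)
    then have "c2 * (1 * 1) = c1 * (1 * 1)"
      using \<open>((\<lambda>r. c1 * ((V (L r) / L r ^ p) * u' r)) \<longlongrightarrow> c1 * (1 * 1)) at_top\<close>
      by (rule tendsto_unique[OF trivial_limit_at_top_linorder])
    then show ?thesis by simp
  qed
  have cross2: "X l * ((g l + H * f l) * f' l) = V l * ((g' l + H * f' l) * f l)" for l
    using cross[of l] c cc by simp
  have lim0: "((\<lambda>r. X (L r) - V (L r)) \<longlongrightarrow> 0) at_top"
  proof (rule tendstoI)
    fix e :: real assume e: "e > 0"
    obtain R where R: "R \<ge> 1" "\<And>r. r \<ge> R \<Longrightarrow> f (L r) \<noteq> 0 \<and> f' (L r) \<noteq> 0 \<and>
       r ^ K * norm (f (L r) * g' (L r) - g (L r) * f' (L r)) \<le> (e/8) * (norm (f (L r)) * norm (f' (L r)))"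
      using est'[of "e/8"] e by auto
    have "eventually (\<lambda>r. norm (u' r) > 1/2) at_top"
      using tendsto_norm[OF lu'] by (rule order_tendstoD) simp
    moreover have "eventually (\<lambda>r. norm (X (L r) / L r ^ p) < 2) at_top"
      using tendsto_norm[OF lX] by (rule order_tendstoD) simp
    ultimately show "eventually (\<lambda>r. dist (X (L r) - V (L r)) 0 < e) at_top"
      using eventually_ge_at_top[of R]
    proof eventually_elim
      case (elim r)
      have r: "r \<ge> 1" using elim R by simp
      have nz: "f (L r) \<noteq> 0" "f' (L r) \<noteq> 0" using R elim by auto
      define w where "w = f (L r) * g' (L r) - g (L r) * f' (L r)"
      have nL: "norm (L r) = r ^ 2" using r by (simp add: L_def norm_power)
      have "(X (L r) - V (L r)) * ((g' (L r) + H * f' (L r)) * f (L r)) = X (L r) * w"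
        using cross2[of "L r"] by (simp add: w_def algebra_simps)
      moreover have "u' r * (of_real r * (f' (L r) * f (L r))) = (g' (L r) + H * f' (L r)) * f (L r)"
        using nz r by (simp add: u'_def)
      ultimately have "(X (L r) - V (L r)) * u' r * (of_real r * (f' (L r) * f (L r))) = X (L r) * w"
        by (simp only: mult.assoc)
      then have "norm ((X (L r) - V (L r)) * u' r * (of_real r * (f' (L r) * f (L r)))) = norm (X (L r) * w)"
        by (rule arg_cong)
      then have "norm (X (L r) - V (L r)) * norm (u' r) * (r * (norm (f (L r)) * norm (f' (L r)))) = norm (X (L r)) * norm w"
        using r by (simp add: norm_mult mult_ac)
      also have "norm (X (L r)) \<le> 2 * norm (L r ^ p)"
        using elim(2) r nL by (simp add: norm_divide norm_power divide_less_eq split: if_splits)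
      also have "norm (L r ^ p) = r ^ (2 * p)" by (simp add: norm_power nL power_mult)
      \<comment> \<open>The number of exceptional eigenvalues enters here: one power of
        \<open>r\<close> comes from the logarithmic derivative \<open>g' / f'\<close>, the other
        \<open>K\<close> from the decay of the Wronskian.\<close>
      also have "r ^ (2 * p) \<le> r ^ (K + 1)" using K r by (intro power_increasing) (auto simp: p_def)
      finally have "norm (X (L r) - V (L r)) * norm (u' r) * (r * (norm (f (L r)) * norm (f' (L r)))) \<le> 2 * r ^ (K + 1) * norm w"
        by (simp add: mult_right_mono)
      also have "\<dots> = 2 * r * (r ^ K * norm w)" by simp
      also have "\<dots> \<le> 2 * r * ((e/8) * (norm (f (L r)) * norm (f' (L r))))"
        using R(2)[of r] elim r unfolding w_def by (intro mult_left_mono) auto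
      also have "\<dots> = (e / 4) * (r * (norm (f (L r)) * norm (f' (L r))))" by simp
      finally have 1: "norm (X (L r) - V (L r)) * norm (u' r) \<le> e / 4"
        by (rule mult_right_le_imp_le) (use r nz in simp)
      have "norm (X (L r) - V (L r)) * (1/2) \<le> norm (X (L r) - V (L r)) * norm (u' r)"
        using elim(1) by (intro mult_left_mono) auto
      with 1 e show ?case by simp
    qed
  qed
  \<comment> \<open>A polynomial that tends to 0 along the negative real axis is 0, so the
    asymptotic statement becomes an identity for all \<open>l\<close>.\<close>
  define Pol where "Pol = (\<Prod>n\<in>S. [:- a' n, 1:]) * (\<Prod>n\<in>T. [:- b n, 1:]) - (\<Prod>n\<in>S. [:- a n, 1:]) * (\<Prod>n\<in>T. [:- b' n, 1:])"
  have Pol: "poly Pol l = X l - V l" for l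
    by (simp add: Pol_def X_def V_def poly_prod)
  have "Pol = 0"
  proof (rule poly_eq_0_if_tendsto)
    have "((\<lambda>x. X (L (sqrt x)) - V (L (sqrt x))) \<longlongrightarrow> 0) at_top"
      by (rule filterlim_compose[OF lim0 sqrt_at_top])
    then show "((\<lambda>x::real. poly Pol (- of_real x)) \<longlongrightarrow> 0) at_top"
    proof (rule Lim_transform_eventually)
      show "eventually (\<lambda>x. X (L (sqrt x)) - V (L (sqrt x)) = poly Pol (- of_real x)) at_top"
        using eventually_ge_at_top[of 0]
        by eventually_elim (simp add: Pol L_def flip: of_real_power)
    qed
  qed
  then have XV: "X l = V l" for l using Pol[of l] by simp
  \<comment> \<open>This radius exceeds the modulus of every zero of \<open>X\<close>.\<close>
  define R where "R = 1 + (\<Sum>n\<in>S. norm (a' n)) + (\<Sum>n\<in>T. norm (b n))"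
  show ?thesis
  proof (intro exI[of _ R] allI impI)
    fix l :: complex assume l: "R \<le> norm l"
    have s0: "(\<Sum>n\<in>S. norm (a' n)) \<ge> 0" "(\<Sum>n\<in>T. norm (b n)) \<ge> 0" by (auto intro: sum_nonneg)
    have "l \<noteq> a' n" if "n \<in> S" for n
      using member_le_sum[of n S "\<lambda>n. norm (a' n)"] that fin l s0 by (auto simp: R_def)
    moreover have "l \<noteq> b n" if "n \<in> T" for n
      using member_le_sum[of n T "\<lambda>n. norm (b n)"] that fin l s0 by (auto simp: R_def)
    ultimately have "X l \<noteq> 0" unfolding X_def using fin by (auto simp: prod_zero_iff)
    then have "(g l + H * f l) * f' l = (g' l + H * f' l) * f l"
      using cross2[of l] XV[of l] by simp
    then show "f l * g' l = g l * f' l" by (simp add: algebra_simps)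
  qed
qed

lemma right_end_solutions:
  assumes q: "q absolutely_integrable_on {0..pi}" and d: "0 < d" "d < pi" and \<beta>: "\<beta> > 0"
  obtains CL dCL CR dCR SL dSL SR dSR where
    "jsol q \<beta> \<gamma> d l 0 CL dCL CR dCR" "CR pi = 1" "dCR pi = 0"
    "jsol q \<beta> \<gamma> d l 0 SL dSL SR dSR" "SR pi = 0" "dSR pi = 1"
proof -
  have d': "0 \<le> d" "d \<le> pi" "\<beta> \<noteq> 0" using d \<beta> by auto
  show ?thesis
    using jsol_exists_right[OF q d', of \<gamma> l 1 0] jsol_exists_right[OF q d', of \<gamma> l 0 1] that by blast
qed

theorem corollary1:
  fixes q q' :: "real \<Rightarrow> complex"
    and h h' H \<gamma> \<gamma>' :: complex
    and \<beta> \<beta>' d :: real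
    and m :: int
    and \<Lambda>\<^sub>1 \<Lambda>\<^sub>1_inf :: "nat set"
    and lam lam' lam_inf lam_inf' :: "nat \<Rightarrow> complex"
  assumes "q absolutely_integrable_on {0..pi}" and "q' absolutely_integrable_on {0..pi}"
    and "\<beta> > 0" and "\<beta>' > 0"
    and "0 < d" and "d < pi"
    and "zero_sequence (Delta q h H \<beta> \<gamma> d) lam"
    and "zero_sequence (Delta_inf q h \<beta> \<gamma> d) lam_inf"
    and "zero_sequence (Delta q' h' H \<beta>' \<gamma>' d) lam'"
    and "zero_sequence (Delta_inf q' h' \<beta>' \<gamma>' d) lam_inf'"
    and "m \<ge> -1"
    and "C_near_pi m q" and "C_near_pi m q'"
    and "\<And>j. int j \<le> m \<Longrightarrow> nderiv_at_pi j q = nderiv_at_pi j q'"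
    and "finite \<Lambda>\<^sub>1" and "finite \<Lambda>\<^sub>1_inf"
    and "int (card \<Lambda>\<^sub>1 + card \<Lambda>\<^sub>1_inf) = (m + 2) div 2"
    and "\<And>n. n \<notin> \<Lambda>\<^sub>1 \<Longrightarrow> lam n = lam' n"
    and "\<And>n. n \<notin> \<Lambda>\<^sub>1_inf \<Longrightarrow> lam_inf n = lam_inf' n"
  shows "h = h' \<and> \<beta> = \<beta>' \<and> \<gamma> = \<gamma>' \<and> (AE x in lebesgue. x \<in> {0..pi} \<longrightarrow> q x = q' x)"
proof -
  note q = assms(1,2) and \<beta> = assms(3,4) and d = assms(5,6)
  obtain Y dY Z dZ where F: "\<And>l. jsol q \<beta> \<gamma> d l 0 (Y l) (dY l) (Z l) (dZ l)" "\<And>l. Y l 0 = 1" "\<And>l. dY l 0 = h"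
    "\<And>l. phi q h \<beta> \<gamma> d pi l = Z l pi" "\<And>l. dphi q h \<beta> \<gamma> d pi l = dZ l pi"
    by (rule phi_family[OF q(1) d, of \<beta> \<gamma> h]) (rule that; assumption)
  obtain Y' dY' Z' dZ' where F': "\<And>l. jsol q' \<beta>' \<gamma>' d l 0 (Y' l) (dY' l) (Z' l) (dZ' l)" "\<And>l. Y' l 0 = 1" "\<And>l. dY' l 0 = h'"
    "\<And>l. phi q' h' \<beta>' \<gamma>' d pi l = Z' l pi" "\<And>l. dphi q' h' \<beta>' \<gamma>' d pi l = dZ' l pi"
    by (rule phi_family[OF q(2) d, of \<beta>' \<gamma>' h']) (rule that; assumption)
  have P: "phi_fam q h \<beta> \<gamma> d Y dY Z dZ" and P': "phi_fam q' h' \<beta>' \<gamma>' d Y' dY' Z' dZ'"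
    unfolding phi_fam_def using F F' by auto
  have d0: "0 \<le> d" "d \<le> pi" using d by auto
  note ent = jsol_entire[OF q(1) order_refl d0 F(1-3)] and ent' = jsol_entire[OF q(2) order_refl d0 F'(1-3)]
  have D: "Delta q h H \<beta> \<gamma> d = (\<lambda>l. dZ l pi + H * Z l pi)" "Delta_inf q h \<beta> \<gamma> d = (\<lambda>l. (-1) * Z l pi)"
    by (auto simp: Delta_def Delta_inf_def F fun_eq_iff)
  have D': "Delta q' h' H \<beta>' \<gamma>' d = (\<lambda>l. dZ' l pi + H * Z' l pi)" "Delta_inf q' h' \<beta>' \<gamma>' d = (\<lambda>l. (-1) * Z' l pi)"
    by (auto simp: Delta_def Delta_inf_def F' fun_eq_iff)
  obtain c1 where c1: "c1 \<noteq> 0" "\<And>l. (dZ l pi + H * Z l pi) * (\<Prod>n\<in>\<Lambda>\<^sub>1. l - lam' n) = c1 * ((dZ' l pi + H * Z' l pi) * (\<Prod>n\<in>\<Lambda>\<^sub>1. l - lam n))"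
  proof (rule zero_sequences_proportional)
    show "zero_sequence (\<lambda>l. dZ l pi + H * Z l pi) lam" "zero_sequence (\<lambda>l. dZ' l pi + H * Z' l pi) lam'"
      using assms(7,9) unfolding D D' .
    show "(\<lambda>l. dZ l pi + H * Z l pi) holomorphic_on UNIV" "(\<lambda>l. dZ' l pi + H * Z' l pi) holomorphic_on UNIV"
      by (intro holomorphic_intros ent ent')+
    show "order_half (\<lambda>l. dZ l pi + H * Z l pi)" "order_half (\<lambda>l. dZ' l pi + H * Z' l pi)"
      by (intro order_half_add order_half_cmult ent ent')+
    show "finite \<Lambda>\<^sub>1" "\<And>n. n \<notin> \<Lambda>\<^sub>1 \<Longrightarrow> lam n = lam' n" by (fact assms)+
  qed blast
  obtain c2 where c2: "c2 \<noteq> 0" "\<And>l. ((-1) * Z l pi) * (\<Prod>n\<in>\<Lambda>\<^sub>1_inf. l - lam_inf' n) = c2 * (((-1) * Z' l pi) * (\<Prod>n\<in>\<Lambda>\<^sub>1_inf. l - lam_inf n))"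
  proof (rule zero_sequences_proportional)
    show "zero_sequence (\<lambda>l. (-1) * Z l pi) lam_inf" "zero_sequence (\<lambda>l. (-1) * Z' l pi) lam_inf'"
      using assms(8,10) unfolding D D' .
    show "(\<lambda>l. (-1) * Z l pi) holomorphic_on UNIV" "(\<lambda>l. (-1) * Z' l pi) holomorphic_on UNIV"
      by (intro holomorphic_intros ent ent')+
    show "order_half (\<lambda>l. (-1) * Z l pi)" "order_half (\<lambda>l. (-1) * Z' l pi)"
      by (intro order_half_cmult ent ent')+
    show "finite \<Lambda>\<^sub>1_inf" "\<And>n. n \<notin> \<Lambda>\<^sub>1_inf \<Longrightarrow> lam_inf n = lam_inf' n" by (fact assms)+
  qed blast
  have "\<exists>R. \<forall>l. R \<le> norm l \<longrightarrow> Z l pi * dZ' l pi = dZ l pi * Z' l pi"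
  proof (rule linear_factors_eq[of \<Lambda>\<^sub>1 \<Lambda>\<^sub>1_inf "\<lambda>l. dZ l pi" H "\<lambda>l. Z l pi" lam' c1 "\<lambda>l. dZ' l pi" "\<lambda>l. Z' l pi" lam lam_inf' c2 lam_inf "nat (m + 1)"])
    show "finite \<Lambda>\<^sub>1" "finite \<Lambda>\<^sub>1_inf" by (fact assms)+
    show "Z l pi * (\<Prod>n\<in>\<Lambda>\<^sub>1_inf. l - lam_inf' n) = c2 * (Z' l pi * (\<Prod>n\<in>\<Lambda>\<^sub>1_inf. l - lam_inf n))" for l
      using c2(2)[of l] by simp
    show "2 * (card \<Lambda>\<^sub>1 + card \<Lambda>\<^sub>1_inf) \<le> nat (m + 1) + 1"
    proof -
      \<comment> \<open>Twice the integer part of \<open>(m + 2) / 2\<close> is at most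
        \<open>m + 2\<close>, and \<open>m \<ge> -1\<close> makes this equal to
        \<open>nat (m + 1) + 1\<close>.\<close>
      have "2 * int (card \<Lambda>\<^sub>1 + card \<Lambda>\<^sub>1_inf) \<le> m + 2" unfolding assms(17) by presburger
      then have "int (2 * (card \<Lambda>\<^sub>1 + card \<Lambda>\<^sub>1_inf)) \<le> int (nat (m + 1) + 1)"
        using assms(11) by simp
      then show ?thesis by (simp only: of_nat_le_iff)
    qed
    show "\<exists>R\<ge>1. \<forall>r\<ge>R. let l = - ((complex_of_real r)\<^sup>2) in
     Z l pi \<noteq> 0 \<and> Z' l pi \<noteq> 0 \<and> norm (dZ l pi - of_real r * Z l pi) \<le> e * r * norm (Z l pi) \<and>
     norm (dZ' l pi - of_real r * Z' l pi) \<le> e * r * norm (Z' l pi) \<and>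
     r ^ nat (m + 1) * norm (Z l pi * dZ' l pi - dZ l pi * Z' l pi) \<le> e * (norm (Z l pi) * norm (Z' l pi))" if "e > 0" for e
      by (rule phi_fam_wronskian_decay[OF q \<beta> d P P' assms(11-14) that])
  qed (use c1 c2 in auto)
  then obtain R where rel: "\<And>l. R \<le> norm l \<Longrightarrow> Z l pi * dZ' l pi = dZ l pi * Z' l pi" by blast
  \<comment> \<open>From here on a single value of the parameter suffices for reading off the
    coefficients; this one satisfies \<open>R \<le> norm l\<close>. All values are still used inside
    the Wronskian argument.\<close>
  define l where "l = complex_of_real R"
  have rl: "Z l pi * dZ' l pi = dZ l pi * Z' l pi" by (rule rel) (simp add: l_def)
  obtain CL dCL CR dCR SL dSL SR dSR where
    C: "jsol q \<beta> \<gamma> d l 0 CL dCL CR dCR" "CR pi = 1" "dCR pi = 0"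
    and S: "jsol q \<beta> \<gamma> d l 0 SL dSL SR dSR" "SR pi = 0" "dSR pi = 1"
    by (rule right_end_solutions[OF q(1) d \<beta>(1), of \<gamma> l])
  obtain CL' dCL' CR' dCR' SL' dSL' SR' dSR' where
    C': "jsol q' \<beta>' \<gamma>' d l 0 CL' dCL' CR' dCR'" "CR' pi = 1" "dCR' pi = 0"
    and S': "jsol q' \<beta>' \<gamma>' d l 0 SL' dSL' SR' dSR'" "SR' pi = 0" "dSR' pi = 1"
    by (rule right_end_solutions[OF q(2) d \<beta>(2), of \<gamma>' l])
  have CRs: "sol (\<lambda>x. q x - l) d pi CR dCR" and SRs: "sol (\<lambda>x. q x - l) d pi SR dSR"
    and CLs: "sol (\<lambda>x. q x - l) 0 d CL dCL" and SLs: "sol (\<lambda>x. q x - l) 0 d SL dSL"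
    and J: "CR d = of_real \<beta> * CL d" "dCR d = of_real (inverse \<beta>) * dCL d + \<gamma> * CL d"
      "SR d = of_real \<beta> * SL d" "dSR d = of_real (inverse \<beta>) * dSL d + \<gamma> * SL d"
    using C(1) S(1) unfolding jsol_def by auto
  have CRs': "sol (\<lambda>x. q' x - l) d pi CR' dCR'" and SRs': "sol (\<lambda>x. q' x - l) d pi SR' dSR'"
    and CLs': "sol (\<lambda>x. q' x - l) 0 d CL' dCL'" and SLs': "sol (\<lambda>x. q' x - l) 0 d SL' dSL'"
    and J': "CR' d = of_real \<beta>' * CL' d" "dCR' d = of_real (inverse \<beta>') * dCL' d + \<gamma>' * CL' d"
      "SR' d = of_real \<beta>' * SL' d" "dSR' d = of_real (inverse \<beta>') * dSL' d + \<gamma>' * SL' d"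
    using C'(1) S'(1) unfolding jsol_def by auto
  have b0: "\<beta> \<noteq> 0" "\<beta>' \<noteq> 0" using \<beta> by auto
  have sub: "p absolutely_integrable_on {s..t}" if "p absolutely_integrable_on {0..pi}" "0 \<le> s" "t \<le> pi"
    for p :: "real \<Rightarrow> complex" and s t
    by (rule absolutely_integrable_on_subinterval[OF that(1)]) (use that in auto)

  \<comment> \<open>Fundamental systems normalised at the right end point\<close>
  have WR: "CR x * dSR x - dCR x * SR x = 1" if "x \<in> {d..pi}" for x
    using sol_wronskian[OF CRs SRs that, of pi] C S d by simp
  have WR': "CR' x * dSR' x - dCR' x * SR' x = 1" if "x \<in> {d..pi}" for x
    using sol_wronskian[OF CRs' SRs' that, of pi] C' S' d by simp
  have WL: "CL x * dSL x - dCL x * SL x = 1" if "x \<in> {0..d}" for x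
    using jsol_wronskian[OF C(1) S(1), of x pi] that C S d b0 by simp
  have WL': "CL' x * dSL' x - dCL' x * SL' x = 1" if "x \<in> {0..d}" for x
    using jsol_wronskian[OF C'(1) S'(1), of x pi] that C' S' d b0 by simp

  \<comment> \<open>The solution \<open>s\<close> started at \<open>x\<close> with data
    \<open>(0, 1)\<close> has end values \<open>s (pi) = - SR x\<close> and
    \<open>ds (pi) = CR x\<close>, by constancy of Wronskians. So the vanishing Wronskian at
    \<open>pi\<close> becomes a relation at \<open>x\<close>.\<close>
  have FR: "SR' x * CR x - SR x * CR' x = 0" if x: "x \<in> {d..pi}" for x
  proof -
    have xx: "d \<le> x" "x \<le> pi" "0 \<le> x" using x d by auto
    have "\<forall>l. \<exists>s ds. sol (\<lambda>x. q x - l) x pi s ds \<and> s x = 0 \<and> ds x = 1"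
      using sol_exists[OF abs_int_diff_const[OF sub[OF q(1) xx(3) order_refl]] xx(2)] by blast
    then obtain s ds where s: "\<And>l. sol (\<lambda>x. q x - l) x pi (s l) (ds l)" "\<And>l. s l x = 0" "\<And>l. ds l x = 1" by metis
    have "\<forall>l. \<exists>s ds. sol (\<lambda>x. q' x - l) x pi s ds \<and> s x = 0 \<and> ds x = 1"
      using sol_exists[OF abs_int_diff_const[OF sub[OF q(2) xx(3) order_refl]] xx(2)] by blast
    then obtain s' ds' where s': "\<And>l. sol (\<lambda>x. q' x - l) x pi (s' l) (ds' l)" "\<And>l. s' l x = 0" "\<And>l. ds' l x = 1" by metis
    have "s l pi * ds' l pi - ds l pi * s' l pi = 0"
      by (rule wronskian_vanish_right[OF q d \<beta> P P' rel xx(1,2) s s'])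
    moreover have "SR x = - s l pi" "CR x = ds l pi"
      using sol_wronskian[OF sol_subset[OF SRs xx(1) order_refl] s(1), of x pi]
        sol_wronskian[OF sol_subset[OF CRs xx(1) order_refl] s(1), of x pi] xx s S C by auto
    moreover have "SR' x = - s' l pi" "CR' x = ds' l pi"
      using sol_wronskian[OF sol_subset[OF SRs' xx(1) order_refl] s'(1), of x pi]
        sol_wronskian[OF sol_subset[OF CRs' xx(1) order_refl] s'(1), of x pi] xx s' S' C' by auto
    ultimately show ?thesis by (simp add: mult.commute)
  qed
  have FL: "SL' x * CL x - SL x * CL' x = 0" if x: "x \<in> {0..d}" for x
  proof -
    have xx: "0 \<le> x" "x \<le> d" using x by auto
    have "\<forall>l. \<exists>s ds S dS. jsol q \<beta> \<gamma> d l x s ds S dS \<and> s x = 0 \<and> ds x = 1"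
      using jsol_exists[OF q(1) xx d0(2)] by blast
    then obtain s ds T dT where s: "\<And>l. jsol q \<beta> \<gamma> d l x (s l) (ds l) (T l) (dT l)" "\<And>l. s l x = 0" "\<And>l. ds l x = 1" by metis
    have "\<forall>l. \<exists>s ds S dS. jsol q' \<beta>' \<gamma>' d l x s ds S dS \<and> s x = 0 \<and> ds x = 1"
      using jsol_exists[OF q(2) xx d0(2)] by blast
    then obtain s' ds' T' dT' where s': "\<And>l. jsol q' \<beta>' \<gamma>' d l x (s' l) (ds' l) (T' l) (dT' l)" "\<And>l. s' l x = 0" "\<And>l. ds' l x = 1" by metis
    have "T l pi * dT' l pi - dT l pi * T' l pi = 0"
      by (rule wronskian_vanish_left[OF q d \<beta> P P' rel xx s s'])
    moreover have "SL x = - T l pi" "CL x = dT l pi"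
      using jsol_wronskian[OF S(1) s(1), of x pi] jsol_wronskian[OF C(1) s(1), of x pi] xx s S C d0 b0 by auto
    moreover have "SL' x = - T' l pi" "CL' x = dT' l pi"
      using jsol_wronskian[OF S'(1) s'(1), of x pi] jsol_wronskian[OF C'(1) s'(1), of x pi] xx s' S' C' d0 b0 by auto
    ultimately show ?thesis by (simp add: mult.commute)
  qed

  \<comment> \<open>Reading off the coefficients\<close>
  have iR: "(\<lambda>x. q x - l) absolutely_integrable_on {d..pi}" "(\<lambda>x. q' x - l) absolutely_integrable_on {d..pi}"
    and iL: "(\<lambda>x. q x - l) absolutely_integrable_on {0..d}" "(\<lambda>x. q' x - l) absolutely_integrable_on {0..d}"
    using q d0 by (auto intro: abs_int_diff_const[OF sub[OF q(1) d0(1) order_refl]] abs_int_diff_const[OF sub[OF q(2) d0(1) order_refl]]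
      abs_int_diff_const[OF sub[OF q(1) order_refl d0(2)]] abs_int_diff_const[OF sub[OF q(2) order_refl d0(2)]])
  note parR = parallel_fundamental_systems[OF d(2) iR CRs SRs CRs' SRs' WR WR' FR]
  note parL = parallel_fundamental_systems[OF d(1) iL CLs SLs CLs' SLs' WL WL' FL]
  obtain \<mu> where \<mu>: "\<And>x. x \<in> {d..pi} \<Longrightarrow> CR' x = \<mu> * CR x \<and> SR' x = \<mu> * SR x \<and> dCR' x = \<mu> * dCR x \<and> dSR' x = \<mu> * dSR x"
    using parR(1) by blast
  \<comment> \<open>The sign is fixed on the right because both systems have the same data at
    \<open>pi\<close>. On the left it is at first undetermined and is settled through the
    jump.\<close>
  have "\<mu> = 1" using \<mu>[of pi] C C' d0 by simp
  then have atd: "CR' d = CR d" "SR' d = SR d" "dCR' d = dCR d" "dSR' d = dSR d" using \<mu>[of d] d0 by auto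
  obtain \<nu> where \<nu>2: "\<nu>\<^sup>2 = 1" and \<nu>: "\<And>x. x \<in> {0..d} \<Longrightarrow> CL' x = \<nu> * CL x \<and> SL' x = \<nu> * SL x \<and> dCL' x = \<nu> * dCL x \<and> dSL' x = \<nu> * dSL x"
    using parL(1) by blast
  have nzd: "CL d \<noteq> 0 \<or> SL d \<noteq> 0" using WL[of d] d0 by auto
  have "(of_real \<beta>' * \<nu> - of_real \<beta>) * CL d = 0" "(of_real \<beta>' * \<nu> - of_real \<beta>) * SL d = 0"
    using atd(1,2) J J' \<nu>[of d] d0 by (auto simp: algebra_simps)
  \<comment> \<open>Only the product of \<open>\<beta>'\<close> and the sign is visible at first;
    squaring gives \<open>\<beta>^2\<close>, and positivity of both numbers gives
    \<open>\<beta> = \<beta>'\<close> and then the sign 1.\<close>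
  then have \<nu>\<beta>: "of_real \<beta>' * \<nu> = of_real \<beta>" using nzd by auto
  then have "(of_real \<beta>' * \<nu>)\<^sup>2 = (of_real \<beta>)\<^sup>2" by simp
  then have "complex_of_real (\<beta>'\<^sup>2) = of_real (\<beta>\<^sup>2)" using \<nu>2 by (simp add: power_mult_distrib)
  then have "\<beta>'\<^sup>2 = \<beta>\<^sup>2" by (simp only: of_real_eq_iff)
  then have \<beta>eq: "\<beta> = \<beta>'" using \<beta> by (simp add: power2_eq_iff_nonneg)
  then have "\<nu> = 1" using \<nu>\<beta> b0 by simp
  then have left: "CL' x = CL x" "SL' x = SL x" "dCL' x = dCL x" "dSL' x = dSL x" if "x \<in> {0..d}" for x
    using \<nu>[OF that] by auto
  have dd: "d \<in> {0..d}" "0 \<in> {0..d}" using d by auto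
  have "\<gamma> * CL d = \<gamma>' * CL d" "\<gamma> * SL d = \<gamma>' * SL d"
    using atd(3,4) J(2,4) J'(2,4) left[OF dd(1)] \<beta>eq by auto
  then have \<gamma>eq: "\<gamma> = \<gamma>'" using nzd by auto

  \<comment> \<open>The Wronskians of phi with the two solutions turn the end values at
    \<open>pi\<close> into linear expressions in \<open>h\<close> at 0. Equal ratios of end values
    then give a determinant equal to \<open>h - h'\<close> times the Wronskian 1.\<close>
  have W0: "dCL 0 - h * CL 0 = - dZ l pi" "dSL 0 - h * SL 0 = Z l pi"
    using jsol_wronskian[OF F(1) C(1), of 0 pi] jsol_wronskian[OF F(1) S(1), of 0 pi] F C S d0 b0 by auto
  have W0': "dCL 0 - h' * CL 0 = - dZ' l pi" "dSL 0 - h' * SL 0 = Z' l pi"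
    using jsol_wronskian[OF F'(1) C'(1), of 0 pi] jsol_wronskian[OF F'(1) S'(1), of 0 pi] F' C' S' d0 b0 left[OF dd(2)] by auto
  have "(dSL 0 - h * SL 0) * (dCL 0 - h' * CL 0) = (dCL 0 - h * CL 0) * (dSL 0 - h' * SL 0)"
    unfolding W0 W0' using rl by simp
  then have "(h - h') * (CL 0 * dSL 0 - dCL 0 * SL 0) = 0" by (simp add: algebra_simps)
  then have heq: "h = h'" using WL[OF dd(2)] by simp

  have "AE x in lebesgue. x \<in> {0..d} \<longrightarrow> q x - l = q' x - l"
    by (rule parL(2))
  moreover have "AE x in lebesgue. x \<in> {d..pi} \<longrightarrow> q x - l = q' x - l"
    by (rule parR(2))
  ultimately have "AE x in lebesgue. x \<in> {0..pi} \<longrightarrow> q x = q' x"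
    by eventually_elim auto
  with heq \<beta>eq \<gamma>eq show ?thesis by blast
qed

end
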